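(* Let $\gamma\in(0,1)$, $T>0$, and let $\mathbf{K}:L^2(\mathbb{R})\to L^2(\mathbb{R})$ be given by $\mathcal{F}(\mathbf{K}\theta)(\omega)=E_{\gamma,1}(-|\omega|^2T^\gamma)\,\mathcal{F}\theta(\omega)$. Let $\Lambda=\mathbb{Z}^2$, and let $u_\lambda(x)=2^{\lambda_D/2}\psi(2^{\lambda_D}x-\lambda_T)$, $\lambda=(\lambda_D,\lambda_T)\in\Lambda$, be an orthonormal wavelet basis of $L^2(\mathbb{R})$ with mother wavelet $\psi$ such that $\operatorname{supp}(\mathcal{F}\psi)\subset\{\omega\in\mathbb{R}:a_u\le|\omega|\le b_u\}$ for some positive constants $a_u,b_u$. Let $$\kappa_\lambda=\begin{cases}2^{-2\lambda_D},&\lambda_D\ge1,\\ 1,&\lambda_D<1,\end{cases}\qquad v_\lambda=\kappa_\lambda\,\mathbf{K}\,\mathcal{F}^{-1}\left(|E_{\gamma,1}(-|\omega|^2T^\gamma)|^{-2}\,\mathcal{F}u_\lambda\right).$$ Let $p>0$ and $\varphi(\mu)=\mu^{p/2}$. Then: (a) $(u_\lambda,v_\lambda,\kappa_\lambda)_{\lambda\in\Lambda}$ is a diagonal frame decomposition (DFD) of $\mathbf{K}$. (b) If $\theta_0\in H^p(\mathbb{R})$, then $\theta_0\in\mathbf{M}_{\varphi,E}$ for $E$ large enough. (c) For $E>0$ there exists $\delta_0>0$ such that $(0,\delta_0]\subset\bigcup_{\lambda\in\Lambda}D_{\lambda,\beta}$ for $\beta=2^{-(2+p)}$, where $D_{\lambda,\beta}=[\delta^*_\lambda,\beta^{-1}\delta^*_\lambda]$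 and $\delta^*_\lambda=|\mathbf{v}|_{\inf}^{-1}E\sqrt{\kappa_\lambda^2\varphi(\kappa_\lambda^2)}$.
   Context: $\mathcal{F}f(\omega)=\int_{\mathbb{R}}f(t)e^{-i\omega t}\,dt$ is the Fourier transform on $L^2(\mathbb{R})$. The Mittag-Leffler function is $E_{\alpha,\beta}(z)=\sum_{n\ge0}z^n/\Gamma(\alpha n+\beta)$. ($\mathbf{K}$ maps the initial value $\theta_0$ of the time-fractional heat equation $\partial_t^\gamma u-\Delta u=0$ on $\mathbb{R}$, Caputo derivative, to the final value $u(\cdot,T)$.) $H^p(\mathbb{R})$ is the $L^2$-based Sobolev space. A family $\mathbf{w}=(w_\lambda)_{\lambda\in\Lambda}$ in a closed subspace $H$ of a Hilbert space is a frame over $H$ if there are $0<A_w,B_w<\infty$ with $A_w\|x\|^2\le\sum_\lambda|\langle x,w_\lambda\rangle|^2\le B_w\|x\|^2$ for all $x\in H$; $|\mathbf{w}|_{\inf}=\inf\{(\sum_\lambda|\langle x,w_\lambda\rangle|^2)^{1/2}:x\in H,\|x\|=1\}$. $(u_\lambda,v_\lambda,\kappa_\lambda)_{\lambda}$ is a DFD of a bounded operator $\mathbf{K}:X\to Y$ if $(u_\lambda)$ is a frame over $(\ker\mathbf{K})^\perp$, $(v_\lambda)$ is a frame over $\overline{\mathrm{ran}\,\mathbf{K}}$, $\kappa_\lambda\in(0,\infty)$, and $\mathbf{K}^*v_\lambda=\kappa_\lambda u_\lambda$ for all $\lambda$. $\mathbf{M}_{\varphi,E}=\{\theta\in L^2(\mathbb{R}):\sum_\lambda[\varphi(\kappa_\lambda^2)]^{-1}|\langle\theta,u_\lambda\rangle|^2\le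 E^2\}$. *)

theory Defs
  imports "HOL-Analysis.Analysis"
begin

text \<open>
  Elements of \<open>L\<^sup>2(\<real>)\<close> are represented by Borel functions \<open>\<real> \<rightarrow> \<complex>\<close>, and equality in \<open>L\<^sup>2(\<real>)\<close>
  is equality almost everywhere.
\<close>

definition L2 :: "(real \<Rightarrow> complex) set" where
  "L2 = {f \<in> borel_measurable lborel. integrable lborel (\<lambda>x. (cmod (f x))\<^sup>2)}"

definition L2_inner :: "(real \<Rightarrow> complex) \<Rightarrow> (real \<Rightarrow> complex) \<Rightarrow> complex" where
  "L2_inner f g = (LINT x|lborel. f x * cnj (g x))"

definition L2_norm :: "(real \<Rightarrow> complex) \<Rightarrow> real" where
  "L2_norm f = sqrt (LINT x|lborel. (cmod (f x))\<^sup>2)"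

definition L2_tendsto :: "(nat \<Rightarrow> real \<Rightarrow> complex) \<Rightarrow> (real \<Rightarrow> complex) \<Rightarrow> bool" where
  "L2_tendsto F g \<longleftrightarrow>
     (\<forall>n. F n \<in> L2) \<and> g \<in> L2 \<and> (\<lambda>n. L2_norm (\<lambda>x. F n x - g x)) \<longlonglongrightarrow> 0"

definition L2_closure :: "(real \<Rightarrow> complex) set \<Rightarrow> (real \<Rightarrow> complex) set" where
  "L2_closure S = {g \<in> L2. \<forall>e>0. \<exists>f\<in>S \<inter> L2. L2_norm (\<lambda>x. g x - f x) < e}"

definition L2_orth :: "(real \<Rightarrow> complex) set \<Rightarrow> (real \<Rightarrow> complex) set" where
  "L2_orth S = {f \<in> L2. \<forall>g\<in>S. L2_inner f g = 0}"

definition L2_closed_subspace :: "(real \<Rightarrow> complex) set \<Rightarrow> bool" where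
  "L2_closed_subspace H \<longleftrightarrow> H \<subseteq> L2 \<and> (\<lambda>x. 0) \<in> H \<and>
     (\<forall>f\<in>H. \<forall>g\<in>H. \<forall>a b. (\<lambda>x. a * f x + b * g x) \<in> H) \<and> L2_closure H \<subseteq> H"

definition L2_orthonormal_basis :: "('i \<Rightarrow> real \<Rightarrow> complex) \<Rightarrow> bool" where
  "L2_orthonormal_basis u \<longleftrightarrow> (\<forall>l. u l \<in> L2) \<and>
     (\<forall>l m. L2_inner (u l) (u m) = (if l = m then 1 else 0)) \<and>
     L2_closure {f. \<exists>S c. finite S \<and> f = (\<lambda>x. \<Sum>l\<in>S. c l * u l x)} = L2"

definition L2_bounded_operator ::
    "((real \<Rightarrow> complex) \<Rightarrow> real \<Rightarrow> complex) \<Rightarrow> bool" where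
  "L2_bounded_operator K \<longleftrightarrow> (\<forall>f\<in>L2. K f \<in> L2) \<and>
     (\<forall>f\<in>L2. \<forall>g\<in>L2. \<forall>a b. AE x in lborel.
        K (\<lambda>x. a * f x + b * g x) x = a * K f x + b * K g x) \<and>
     (\<exists>C. \<forall>f\<in>L2. L2_norm (K f) \<le> C * L2_norm f)"

definition L2_ker :: "((real \<Rightarrow> complex) \<Rightarrow> real \<Rightarrow> complex) \<Rightarrow> (real \<Rightarrow> complex) set" where
  "L2_ker K = {f \<in> L2. AE x in lborel. K f x = 0}"

text \<open>A representative of \<open>K\<^sup>* g\<close>, which is determined up to a null set.\<close>

definition L2_adjoint ::
    "((real \<Rightarrow> complex) \<Rightarrow> real \<Rightarrow> complex) \<Rightarrow> (real \<Rightarrow> complex) \<Rightarrow> real \<Rightarrow> complex" where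
  "L2_adjoint K g = (SOME h. h \<in> L2 \<and> (\<forall>f\<in>L2. L2_inner (K f) g = L2_inner f h))"

text \<open>
  The Fourier transform on \<open>L\<^sup>2(\<real>)\<close> is the \<open>L\<^sup>2\<close>-limit of the absolutely convergent Fourier
  integrals of the truncations of \<open>f\<close> to \<open>[-n, n]\<close>. Both \<open>fourier\<close> and \<open>fourier_inv\<close> select a
  representative, which is determined up to a null set.
\<close>

definition fourier :: "(real \<Rightarrow> complex) \<Rightarrow> real \<Rightarrow> complex" where
  "fourier f = (SOME g. L2_tendsto
     (\<lambda>n \<omega>. LINT t:{- real n..real n}|lborel. f t * exp (- \<i> * of_real (\<omega> * t))) g)"

definition fourier_inv :: "(real \<Rightarrow> complex) \<Rightarrow> real \<Rightarrow> complex" where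
  "fourier_inv g = (SOME f. f \<in> L2 \<and> (AE \<omega> in lborel. fourier f \<omega> = g \<omega>))"

definition sobolev :: "real \<Rightarrow> (real \<Rightarrow> complex) set" where
  "sobolev p = {f \<in> L2. integrable lborel (\<lambda>\<omega>. (1 + \<omega>\<^sup>2) powr p * (cmod (fourier f \<omega>))\<^sup>2)}"

definition mittag_leffler ::
    "real \<Rightarrow> real \<Rightarrow> 'a::{banach, real_normed_field} \<Rightarrow> 'a" where
  "mittag_leffler \<alpha> \<beta> z = (\<Sum>n. z ^ n / of_real (Gamma (\<alpha> * real n + \<beta>)))"

definition L2_frame :: "(real \<Rightarrow> complex) set \<Rightarrow> ('i \<Rightarrow> real \<Rightarrow> complex) \<Rightarrow> bool" where
  "L2_frame H w \<longleftrightarrow> L2_closed_subspace H \<and> (\<forall>l. w l \<in> H) \<and>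
     (\<exists>A>0. \<exists>B>0. \<forall>f\<in>H.
        (\<lambda>l. (cmod (L2_inner f (w l)))\<^sup>2) summable_on UNIV \<and>
        A * (L2_norm f)\<^sup>2 \<le> (\<Sum>\<^sub>\<infinity>l. (cmod (L2_inner f (w l)))\<^sup>2) \<and>
        (\<Sum>\<^sub>\<infinity>l. (cmod (L2_inner f (w l)))\<^sup>2) \<le> B * (L2_norm f)\<^sup>2)"

text \<open>Meaningful only for families whose sums converge on \<open>H\<close>, in particular for frames over \<open>H\<close>.\<close>

definition frame_inf :: "(real \<Rightarrow> complex) set \<Rightarrow> ('i \<Rightarrow> real \<Rightarrow> complex) \<Rightarrow> real" where
  "frame_inf H w =
     Inf {sqrt (\<Sum>\<^sub>\<infinity>l. (cmod (L2_inner f (w l)))\<^sup>2) | f. f \<in> H \<and> L2_norm f = 1}"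

definition L2_DFD :: "((real \<Rightarrow> complex) \<Rightarrow> real \<Rightarrow> complex) \<Rightarrow>
    ('i \<Rightarrow> real \<Rightarrow> complex) \<Rightarrow> ('i \<Rightarrow> real \<Rightarrow> complex) \<Rightarrow> ('i \<Rightarrow> real) \<Rightarrow> bool" where
  "L2_DFD K u v \<kappa> \<longleftrightarrow> L2_bounded_operator K \<and>
     L2_frame (L2_orth (L2_ker K)) u \<and>
     L2_frame (L2_closure (K ` L2)) v \<and>
     (\<forall>l. \<kappa> l > 0) \<and>
     (\<forall>l. AE x in lborel. L2_adjoint K (v l) x = of_real (\<kappa> l) * u l x)"

definition source_set ::
    "(real \<Rightarrow> real) \<Rightarrow> real \<Rightarrow> ('i \<Rightarrow> real) \<Rightarrow> ('i \<Rightarrow> real \<Rightarrow> complex) \<Rightarrow> (real \<Rightarrow> complex) set" where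
  "source_set \<phi> E \<kappa> u = {f \<in> L2.
     (\<lambda>l. inverse (\<phi> ((\<kappa> l)\<^sup>2)) * (cmod (L2_inner f (u l)))\<^sup>2) summable_on UNIV \<and>
     (\<Sum>\<^sub>\<infinity>l. inverse (\<phi> ((\<kappa> l)\<^sup>2)) * (cmod (L2_inner f (u l)))\<^sup>2) \<le> E\<^sup>2}"

end

theory Submission
  imports Defs "HOL-Probability.Characteristic_Functions"
begin

text \<open>
  On the frequency side \<open>K\<close> is multiplication by \<open>m(\<omega>) = E\<^sub>\<gamma>(- \<omega>\<^sup>2 T\<^sup>\<gamma>)\<close>, and the whole theorem rests on
  two facts: \<open>m\<close> is positive and comparable to \<open>(1 + \<omega>\<^sup>2)\<^sup>-\<^sup>1\<close>, and the Fourier transforms of the wavelets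
  of scale \<open>j\<close> live in the band \<open>a 2\<^sup>j \<le> \<bar>\<omega>\<bar> \<le> b 2\<^sup>j\<close>. On that band \<open>m\<close> is comparable to \<open>\<kappa>\<^sub>j\<close>, and every
  frequency belongs to a bounded number of bands.

  Consequently the family \<open>v\<^sub>l\<close>, whose transforms are \<open>\<kappa>\<^sub>j m\<^sup>-\<^sup>1\<close> times those of \<open>u\<^sub>l\<close>, differs
  from the wavelet basis on each band by a factor that is bounded above and below uniformly in \<open>j\<close>.
  Bessel's inequality in each scale and the bounded overlap give its upper frame bound (\<open>dyadic_Bessel\<close>). The same inequality for the biorthogonal family,
  with \<open>\<kappa>\<^sub>j\<^sup>-\<^sup>1 m\<close> in place of \<open>\<kappa>\<^sub>j m\<^sup>-\<^sup>1\<close>, gives the lower bound by duality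
  (\<open>dyadic_multiplier_frame\<close>). The relation \<open>K\<^sup>* v\<^sub>l = \<kappa>\<^sub>j u\<^sub>l\<close> is a cancellation of \<open>m\<close> against \<open>m\<^sup>-\<^sup>1\<close>, and \<open>K\<close>
  is injective with dense range since \<open>m\<close> is positive and bounded away from \<open>0\<close> on bounded sets
  (\<open>multiplier_operator\<close>). For the smoothness statement, \<open>\<phi>(\<kappa>\<^sub>j\<^sup>2)\<^sup>-\<^sup>1 = 2\<^sup>2\<^sup>j\<^sup>p\<close> for \<open>j \<ge> 1\<close>
  is dominated by a multiple of \<open>(1 + \<omega>\<^sup>2)\<^sup>p\<close> on the \<open>j\<close>-th band, so that \<open>dyadic_Bessel\<close> with this weight
  bounds the sum by the Sobolev norm. For the covering statement, \<open>\<delta>\<^sup>*\<close> at scale \<open>j \<ge> 1\<close> is a constant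
  times \<open>2\<^sup>-\<^sup>j\<^sup>(\<^sup>2\<^sup>+\<^sup>p\<^sup>)\<close>; the quotient of two consecutive values is exactly \<open>\<beta>\<close>, so the intervals of
  consecutive scales share endpoints.

  The analysis behind this has two parts. The first is the Fourier transform on \<open>L\<^sup>2\<close>: boundedness,
  Plancherel's identity and surjectivity, obtained by inserting Gaussian weights (\<open>fourier_integral_L2\<close>,
  \<open>Plancherel\<close>, \<open>fourier_surj\<close>). The second is the two-sided estimate
  \<open>1 / (1 + \<Gamma>(1 - \<gamma>) x) \<le> E\<^sub>\<gamma>(- x) \<le> 1 / (1 + x / \<Gamma>(1 + \<gamma>))\<close> (\<open>mittag_leffler_bounds\<close>). Here
  \<open>E\<^sub>\<gamma>(- x)\<close> is the limit of the \<open>n\<close>-th coefficients of \<open>(1 - z)\<^sup>\<gamma>\<^sup>-\<^sup>1 / ((1 - z)\<^sup>\<gamma> + x n\<^sup>-\<^sup>\<gamma>)\<close>. The coefficients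
  of \<open>(1 - z)\<^sup>\<gamma>\<close> of positive degree are negative, which makes each of these sequences decreasing,
  and the discrete forms of the two bounds follow by comparing convolutions.
\<close>

section \<open>The space of square-integrable functions\<close>

lemma borel_measurable_cnj [measurable (raw)]:
  "f \<in> borel_measurable M \<Longrightarrow> (\<lambda>x. cnj (f x)) \<in> borel_measurable M"
  by (rule borel_measurable_continuous_on[where f = cnj]) (auto intro: continuous_intros)

lemma L2_measurable [measurable_dest]: "f \<in> L2 \<Longrightarrow> f \<in> borel_measurable borel"
  by (simp add: L2_def)

lemma L2_integrable: "f \<in> L2 \<Longrightarrow> integrable lborel (\<lambda>x. (cmod (f x))\<^sup>2)"
  by (simp add: L2_def)

lemma L2_I:
  "f \<in> borel_measurable borel \<Longrightarrow> integrable lborel (\<lambda>x. (cmod (f x))\<^sup>2) \<Longrightarrow> f \<in> L2"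
  by (simp add: L2_def)

lemma L2_bound:
  assumes "f \<in> borel_measurable borel" "g \<in> L2" "AE x in lborel. cmod (f x) \<le> C * cmod (g x)"
  shows "f \<in> L2"
proof (rule L2_I)
  have "AE x in lborel. norm ((cmod (f x))\<^sup>2) \<le> norm (C\<^sup>2 * (cmod (g x))\<^sup>2)"
    using assms(3)
  proof eventually_elim
    case (elim x)
    then have "(cmod (f x))\<^sup>2 \<le> (C * cmod (g x))\<^sup>2" by (intro power_mono) auto
    then show ?case by (simp add: power_mult_distrib)
  qed
  then show "integrable lborel (\<lambda>x. (cmod (f x))\<^sup>2)"
    using assms(1) L2_integrable[OF assms(2)]
    by (intro Bochner_Integration.integrable_bound[OF integrable_mult_right[OF L2_integrable[OF assms(2)], of "C\<^sup>2"]]) auto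
qed (fact assms(1))

lemma L2_zero [simp, intro]: "(\<lambda>x. 0) \<in> L2"
  by (simp add: L2_def)

lemma L2_scale [intro]: "f \<in> L2 \<Longrightarrow> (\<lambda>x. c * f x) \<in> L2"
  by (rule L2_bound[of _ f "cmod c"]) (auto simp: norm_mult)

lemma L2_cnj [intro]: "f \<in> L2 \<Longrightarrow> (\<lambda>x. cnj (f x)) \<in> L2"
  by (rule L2_bound[of _ f 1]) (auto dest: L2_measurable)

lemma cmod_add_sq_le: "(cmod (a + b))\<^sup>2 \<le> 2 * (cmod a)\<^sup>2 + 2 * (cmod b)\<^sup>2"
proof -
  have "(cmod (a + b))\<^sup>2 \<le> (cmod a + cmod b)\<^sup>2"
    by (intro power_mono norm_triangle_ineq) auto
  also have "\<dots> \<le> 2 * (cmod a)\<^sup>2 + 2 * (cmod b)\<^sup>2"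
    using sum_squares_bound[of "cmod a" "cmod b"] by (simp add: power2_sum)
  finally show ?thesis .
qed

lemma L2_add [intro]:
  assumes f: "f \<in> L2" and g: "g \<in> L2"
  shows "(\<lambda>x. f x + g x) \<in> L2"
proof (rule L2_I)
  note [measurable] = L2_measurable[OF f] L2_measurable[OF g]
  show "(\<lambda>x. f x + g x) \<in> borel_measurable borel" by measurable
  show "integrable lborel (\<lambda>x. (cmod (f x + g x))\<^sup>2)"
    by (rule Bochner_Integration.integrable_bound
          [of _ "\<lambda>x. 2 * (cmod (f x))\<^sup>2 + 2 * (cmod (g x))\<^sup>2"])
       (use cmod_add_sq_le L2_integrable[OF f] L2_integrable[OF g] in \<open>auto intro!: AE_I2\<close>)
qed

lemma L2_diff [intro]: "f \<in> L2 \<Longrightarrow> g \<in> L2 \<Longrightarrow> (\<lambda>x. f x - g x) \<in> L2"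
  using L2_add[of f "\<lambda>x. (-1) * g x"] L2_scale[of g "-1"] by simp

lemma L2_sum [intro]: "(\<And>i. i \<in> I \<Longrightarrow> f i \<in> L2) \<Longrightarrow> (\<lambda>x. \<Sum>i\<in>I. f i x) \<in> L2"
  by (induction I rule: infinite_finite_induct) auto

lemma L2_AE_cong:
  assumes "f \<in> L2" "g \<in> borel_measurable borel" "AE x in lborel. f x = g x"
  shows "g \<in> L2"
  by (rule L2_bound[of _ f 1]) (use assms in auto)

lemma L2_integrable_mult:
  assumes f: "f \<in> L2" and g: "g \<in> L2"
  shows "integrable lborel (\<lambda>x. f x * cnj (g x))"
proof -
  note [measurable] = L2_measurable[OF f] L2_measurable[OF g]
  have "cmod (f x * cnj (g x)) \<le> (cmod (f x))\<^sup>2 + (cmod (g x))\<^sup>2" for x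
  proof -
    have "0 \<le> cmod (f x) * cmod (g x)" by simp
    then show ?thesis
      using sum_squares_bound[of "cmod (f x)" "cmod (g x)"] unfolding norm_mult complex_mod_cnj by linarith
  qed
  then show ?thesis
    by (intro Bochner_Integration.integrable_bound
          [OF Bochner_Integration.integrable_add[OF L2_integrable[OF f] L2_integrable[OF g]]])
       (auto intro!: AE_I2)
qed

lemma L2_norm_nonneg [simp]: "0 \<le> L2_norm f"
  by (simp add: L2_norm_def)

lemma L2_norm_sq: "(L2_norm f)\<^sup>2 = (LINT x|lborel. (cmod (f x))\<^sup>2)"
  by (simp add: L2_norm_def)

lemma L2_inner_self: "L2_inner f f = of_real ((L2_norm f)\<^sup>2)"
  by (simp add: L2_inner_def L2_norm_sq complex_norm_square[symmetric] flip: integral_complex_of_real)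

lemma L2_inner_commute: "L2_inner g f = cnj (L2_inner f g)"
  by (simp add: L2_inner_def mult.commute flip: Bochner_Integration.integral_cnj)

lemma L2_inner_cong_AE:
  assumes "f \<in> L2" "f' \<in> borel_measurable borel" "g \<in> L2" "g' \<in> borel_measurable borel"
    and "AE x in lborel. f x = f' x" "AE x in lborel. g x = g' x"
  shows "L2_inner f g = L2_inner f' g'"
  unfolding L2_inner_def
proof (rule integral_cong_AE)
  show "AE x in lborel. f x * cnj (g x) = f' x * cnj (g' x)"
    using assms(5,6) by eventually_elim simp
qed (use assms in auto)

lemma L2_norm_cong_AE:
  assumes "f \<in> borel_measurable borel" "f' \<in> borel_measurable borel" "AE x in lborel. f x = f' x"
  shows "L2_norm f = L2_norm f'"
  unfolding L2_norm_def
  by (intro arg_cong[where f = sqrt] integral_cong_AE) (use assms in auto)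

lemma L2_inner_add_left:
  "f \<in> L2 \<Longrightarrow> g \<in> L2 \<Longrightarrow> h \<in> L2 \<Longrightarrow> L2_inner (\<lambda>x. f x + g x) h = L2_inner f h + L2_inner g h"
  by (simp add: L2_inner_def ring_distribs L2_integrable_mult)

lemma L2_inner_diff_left:
  "f \<in> L2 \<Longrightarrow> g \<in> L2 \<Longrightarrow> h \<in> L2 \<Longrightarrow> L2_inner (\<lambda>x. f x - g x) h = L2_inner f h - L2_inner g h"
  by (simp add: L2_inner_def ring_distribs L2_integrable_mult)

lemma L2_inner_scale_left: "L2_inner (\<lambda>x. c * f x) h = c * L2_inner f h"
  by (simp add: L2_inner_def mult.assoc)

lemma L2_inner_scale_right: "L2_inner f (\<lambda>x. c * h x) = cnj c * L2_inner f h"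
  by (simp add: L2_inner_def mult.left_commute)

lemma L2_inner_diff_right:
  "f \<in> L2 \<Longrightarrow> g \<in> L2 \<Longrightarrow> h \<in> L2 \<Longrightarrow> L2_inner h (\<lambda>x. f x - g x) = L2_inner h f - L2_inner h g"
  by (simp add: L2_inner_def ring_distribs L2_integrable_mult)

lemma L2_inner_add_right:
  "f \<in> L2 \<Longrightarrow> g \<in> L2 \<Longrightarrow> h \<in> L2 \<Longrightarrow> L2_inner h (\<lambda>x. f x + g x) = L2_inner h f + L2_inner h g"
  by (simp add: L2_inner_def ring_distribs L2_integrable_mult)

lemma L2_inner_zero [simp]: "L2_inner (\<lambda>x. 0) g = 0" "L2_inner g (\<lambda>x. 0) = 0"
  by (simp_all add: L2_inner_def)

lemma L2_inner_sum_left: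
  "(\<And>i. i \<in> I \<Longrightarrow> f i \<in> L2) \<Longrightarrow> h \<in> L2 \<Longrightarrow>
     L2_inner (\<lambda>x. \<Sum>i\<in>I. f i x) h = (\<Sum>i\<in>I. L2_inner (f i) h)"
  by (induction I rule: infinite_finite_induct) (auto simp: L2_inner_add_left L2_sum)

lemma L2_norm_eq_0_iff: "f \<in> L2 \<Longrightarrow> L2_norm f = 0 \<longleftrightarrow> (AE x in lborel. f x = 0)"
  by (simp add: L2_norm_def integral_nonneg_eq_0_iff_AE L2_integrable)

lemma L2_norm_scale: "L2_norm (\<lambda>x. c * f x) = cmod c * L2_norm f"
  by (simp add: L2_norm_def norm_mult power_mult_distrib real_sqrt_mult)

lemma L2_norm_minus_commute: "L2_norm (\<lambda>x. f x - g x) = L2_norm (\<lambda>x. g x - f x)"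
  by (simp add: L2_norm_def norm_minus_commute)

lemma L2_Cauchy_Schwarz:
  assumes f: "f \<in> L2" and g: "g \<in> L2"
  shows "cmod (L2_inner f g) \<le> L2_norm f * L2_norm g"
proof (cases "L2_norm f = 0 \<or> L2_norm g = 0")
  case True
  then have "AE x in lborel. f x * cnj (g x) = 0"
    using f g by (auto simp: L2_norm_eq_0_iff)
  then have "L2_inner f g = 0"
    unfolding L2_inner_def by (rule integral_eq_zero_AE)
  then show ?thesis by simp
next
  case False
  define t where "t = L2_norm g / L2_norm f"
  have t: "t > 0" using False by (simp add: t_def less_le)
  have le: "cmod (f x * cnj (g x)) \<le> (t * (cmod (f x))\<^sup>2 + (cmod (g x))\<^sup>2 / t) / 2" for x
  proof -
    have "0 \<le> (t * cmod (f x) - cmod (g x))\<^sup>2 / t" using t by simp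
    also have "\<dots> = t * (cmod (f x))\<^sup>2 + (cmod (g x))\<^sup>2 / t - 2 * (cmod (f x) * cmod (g x))"
      using t by (simp add: power2_eq_square field_simps)
    finally show ?thesis by (simp add: norm_mult)
  qed
  have "cmod (L2_inner f g) \<le> (LINT x|lborel. cmod (f x * cnj (g x)))"
    unfolding L2_inner_def by simp
  also have "\<dots> \<le> (LINT x|lborel. (t * (cmod (f x))\<^sup>2 + (cmod (g x))\<^sup>2 / t) / 2)"
    using le by (intro integral_mono) (auto intro!: L2_integrable_mult L2_integrable f g
        integrable_norm Bochner_Integration.integrable_add simp del: complex_mod_cnj)
  also have "\<dots> = (t * (L2_norm f)\<^sup>2 + (L2_norm g)\<^sup>2 / t) / 2"
    by (simp add: L2_norm_sq L2_integrable f g)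
  also have "\<dots> = L2_norm f * L2_norm g"
    using False by (simp add: t_def power2_eq_square)
  finally show ?thesis .
qed

lemma L2_norm_triangle:
  assumes f: "f \<in> L2" and g: "g \<in> L2"
  shows "L2_norm (\<lambda>x. f x + g x) \<le> L2_norm f + L2_norm g"
proof (rule power2_le_imp_le)
  have "of_real ((L2_norm (\<lambda>x. f x + g x))\<^sup>2) =
      of_real ((L2_norm f)\<^sup>2 + (L2_norm g)\<^sup>2) + (L2_inner f g + cnj (L2_inner f g))"
    unfolding of_real_add L2_inner_self[symmetric] L2_inner_commute[of g f, symmetric]
    using f g by (simp add: L2_inner_add_left L2_inner_add_right L2_add)
  also have "\<dots> = of_real ((L2_norm f)\<^sup>2 + (L2_norm g)\<^sup>2 + 2 * Re (L2_inner f g))"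
    by (simp add: complex_add_cnj)
  finally have "(L2_norm (\<lambda>x. f x + g x))\<^sup>2 = (L2_norm f)\<^sup>2 + (L2_norm g)\<^sup>2 + 2 * Re (L2_inner f g)"
    by (simp only: of_real_eq_iff)
  also have "Re (L2_inner f g) \<le> L2_norm f * L2_norm g"
    using L2_Cauchy_Schwarz[OF f g] complex_Re_le_cmod order_trans by blast
  finally show "(L2_norm (\<lambda>x. f x + g x))\<^sup>2 \<le> (L2_norm f + L2_norm g)\<^sup>2"
    by (simp add: power2_sum)
qed simp

lemma L2_norm_triangle_diff:
  assumes "f \<in> L2" "g \<in> L2" "h \<in> L2"
  shows "L2_norm (\<lambda>x. f x - h x) \<le> L2_norm (\<lambda>x. f x - g x) + L2_norm (\<lambda>x. g x - h x)"
  using L2_norm_triangle[of "\<lambda>x. f x - g x" "\<lambda>x. g x - h x"] assms by auto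

lemma L2_norm_diff_le:
  assumes "f \<in> L2" "g \<in> L2"
  shows "\<bar>L2_norm f - L2_norm g\<bar> \<le> L2_norm (\<lambda>x. f x - g x)"
  using L2_norm_triangle_diff[of f g "\<lambda>x. 0"] L2_norm_triangle_diff[of g f "\<lambda>x. 0"] assms
    L2_norm_minus_commute[of f g] by auto

lemma L2_AE_eqI:
  assumes "f \<in> L2" "g \<in> L2" "\<And>h. h \<in> L2 \<Longrightarrow> L2_inner f h = L2_inner g h"
  shows "AE x in lborel. f x = g x"
proof -
  let ?d = "\<lambda>x. f x - g x"
  have d: "?d \<in> L2" using assms by auto
  have "L2_inner ?d ?d = 0" using assms d by (simp add: L2_inner_diff_left)
  then have "L2_norm ?d = 0" by (simp add: L2_inner_self)
  then show ?thesis using L2_norm_eq_0_iff[OF d] by simp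
qed

subsection \<open>Convergence in norm\<close>

lemma L2_tendstoD:
  assumes "L2_tendsto F g"
  shows "F n \<in> L2" "g \<in> L2" "(\<lambda>n. L2_norm (\<lambda>x. F n x - g x)) \<longlonglongrightarrow> 0"
  using assms by (auto simp: L2_tendsto_def)

lemma L2_tendsto_inner:
  assumes F: "L2_tendsto F g" and h: "h \<in> L2"
  shows "(\<lambda>n. L2_inner (F n) h) \<longlonglongrightarrow> L2_inner g h"
proof (rule LIM_zero_cancel, rule Lim_null_comparison)
  note D = L2_tendstoD[OF F]
  show "\<forall>\<^sub>F n in sequentially. cmod (L2_inner (F n) h - L2_inner g h) \<le>
          L2_norm (\<lambda>x. F n x - g x) * L2_norm h"
    using L2_Cauchy_Schwarz[OF L2_diff[OF D(1) D(2)] h] D(1,2) h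
    by (simp add: L2_inner_diff_left)
  show "(\<lambda>n. L2_norm (\<lambda>x. F n x - g x) * L2_norm h) \<longlonglongrightarrow> 0"
    using tendsto_mult_right[OF D(3), of "L2_norm h"] by simp
qed

lemma L2_tendsto_norm:
  assumes F: "L2_tendsto F g"
  shows "(\<lambda>n. L2_norm (F n)) \<longlonglongrightarrow> L2_norm g"
proof (rule LIM_zero_cancel, rule Lim_null_comparison)
  note D = L2_tendstoD[OF F]
  show "\<forall>\<^sub>F n in sequentially. norm (L2_norm (F n) - L2_norm g) \<le> L2_norm (\<lambda>x. F n x - g x)"
    using L2_norm_diff_le[OF D(1) D(2)] by simp
qed (rule L2_tendstoD(3)[OF F])

lemma L2_tendsto_unique:
  assumes F: "L2_tendsto F g" and F': "L2_tendsto F h"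
  shows "AE x in lborel. g x = h x"
  by (intro L2_AE_eqI L2_tendstoD(2)[OF F] L2_tendstoD(2)[OF F'])
     (meson F F' L2_tendsto_inner LIMSEQ_unique)

lemma L2_tendsto_linear:
  assumes F: "L2_tendsto F f" and G: "L2_tendsto G g"
  shows "L2_tendsto (\<lambda>n x. a * F n x + b * G n x) (\<lambda>x. a * f x + b * g x)"
  unfolding L2_tendsto_def
proof (intro conjI allI)
  note D = L2_tendstoD[OF F] L2_tendstoD[OF G]
  show "(\<lambda>x. a * F n x + b * G n x) \<in> L2" for n by (intro L2_add L2_scale D)
  show "(\<lambda>x. a * f x + b * g x) \<in> L2" by (intro L2_add L2_scale D)
  show "(\<lambda>n. L2_norm (\<lambda>x. a * F n x + b * G n x - (a * f x + b * g x))) \<longlonglongrightarrow> 0"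
  proof (rule Lim_null_comparison)
    have "L2_norm (\<lambda>x. a * F n x + b * G n x - (a * f x + b * g x)) \<le>
        cmod a * L2_norm (\<lambda>x. F n x - f x) + cmod b * L2_norm (\<lambda>x. G n x - g x)" for n
    proof -
      have "L2_norm (\<lambda>x. a * F n x + b * G n x - (a * f x + b * g x)) =
          L2_norm (\<lambda>x. a * (F n x - f x) + b * (G n x - g x))"
        by (rule arg_cong[where f = L2_norm]) (auto simp: algebra_simps)
      also have "\<dots> \<le> L2_norm (\<lambda>x. a * (F n x - f x)) + L2_norm (\<lambda>x. b * (G n x - g x))"
        by (intro L2_norm_triangle L2_scale L2_diff D)
      finally show ?thesis by (simp add: L2_norm_scale)
    qed
    then show "\<forall>\<^sub>F n in sequentially.
        norm (L2_norm (\<lambda>x. a * F n x + b * G n x - (a * f x + b * g x))) \<le>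
        cmod a * L2_norm (\<lambda>x. F n x - f x) + cmod b * L2_norm (\<lambda>x. G n x - g x)"
      by simp
    show "(\<lambda>n. cmod a * L2_norm (\<lambda>x. F n x - f x) + cmod b * L2_norm (\<lambda>x. G n x - g x)) \<longlonglongrightarrow> 0"
      by (rule tendsto_eq_intros D refl | simp)+
  qed
qed

text \<open>Fatou's lemma in the form in which it yields membership in \<open>L\<^sup>2\<close> of a pointwise limit.\<close>

lemma L2_Fatou:
  assumes F: "\<And>n. F n \<in> L2" and bnd: "\<And>n. L2_norm (F n) \<le> C"
    and g: "g \<in> borel_measurable borel" and lim: "AE x in lborel. (\<lambda>n. F n x) \<longlonglongrightarrow> g x"
  shows "g \<in> L2" "L2_norm g \<le> C"
proof -
  note [measurable] = g L2_measurable[OF F]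
  have C: "C \<ge> 0" using bnd[of 0] L2_norm_nonneg order_trans by blast
  have "(\<integral>\<^sup>+ x. ennreal ((cmod (g x))\<^sup>2) \<partial>lborel) =
      (\<integral>\<^sup>+ x. liminf (\<lambda>n. ennreal ((cmod (F n x))\<^sup>2)) \<partial>lborel)"
  proof (rule nn_integral_cong_AE)
    show "AE x in lborel. ennreal ((cmod (g x))\<^sup>2) = liminf (\<lambda>n. ennreal ((cmod (F n x))\<^sup>2))"
      using lim
    proof eventually_elim
      case (elim x)
      then have "(\<lambda>n. ennreal ((cmod (F n x))\<^sup>2)) \<longlonglongrightarrow> ennreal ((cmod (g x))\<^sup>2)"
        by (intro tendsto_ennrealI tendsto_power tendsto_norm)
      then show ?case by (simp only: lim_imp_Liminf[OF sequentially_bot])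
    qed
  qed
  also have "\<dots> \<le> liminf (\<lambda>n. \<integral>\<^sup>+ x. ennreal ((cmod (F n x))\<^sup>2) \<partial>lborel)"
    by (rule nn_integral_liminf) measurable
  also have "\<dots> \<le> ennreal (C\<^sup>2)"
  proof -
    have "(\<integral>\<^sup>+ x. ennreal ((cmod (F n x))\<^sup>2) \<partial>lborel) \<le> ennreal (C\<^sup>2)" for n
      using bnd[of n] by (subst nn_integral_eq_integral[OF L2_integrable[OF F]])
        (auto simp: L2_norm_sq[symmetric] intro!: ennreal_leI power_mono)
    then have "liminf (\<lambda>n. \<integral>\<^sup>+ x. ennreal ((cmod (F n x))\<^sup>2) \<partial>lborel) \<le> liminf (\<lambda>n::nat. ennreal (C\<^sup>2))"
      by (intro Liminf_mono always_eventually) auto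
    then show ?thesis by (simp only: Liminf_const[OF sequentially_bot])
  qed
  finally have le: "(\<integral>\<^sup>+ x. ennreal ((cmod (g x))\<^sup>2) \<partial>lborel) \<le> ennreal (C\<^sup>2)" .
  then have int: "integrable lborel (\<lambda>x. (cmod (g x))\<^sup>2)"
    by (intro integrableI_bounded) (auto simp: le_less_trans[OF le])
  then show "g \<in> L2" by (intro L2_I g)
  have "ennreal ((L2_norm g)\<^sup>2) \<le> ennreal (C\<^sup>2)"
    using le by (simp add: nn_integral_eq_integral[OF int] L2_norm_sq)
  then have "(L2_norm g)\<^sup>2 \<le> C\<^sup>2" by (simp add: ennreal_le_iff)
  then show "L2_norm g \<le> C" using C by (rule power2_le_imp_le)
qed

lemma L2_dominated_convergence:
  assumes F: "\<And>n. F n \<in> borel_measurable borel" and g: "g \<in> borel_measurable borel" and w: "w \<in> L2"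
    and bnd: "\<And>n x. cmod (F n x) \<le> C * cmod (w x)"
    and lim: "AE x in lborel. (\<lambda>n. F n x) \<longlonglongrightarrow> g x"
  shows "L2_tendsto F g"
proof -
  note [measurable] = F g L2_measurable[OF w]
  have gb: "AE x in lborel. cmod (g x) \<le> C * cmod (w x)"
    using lim
  proof eventually_elim
    case (elim x)
    then show ?case
      by (intro Lim_bounded[OF tendsto_norm[OF elim], of 0]) (use bnd in auto)
  qed
  have FL: "F n \<in> L2" for n by (rule L2_bound[OF F w]) (use bnd in auto)
  have gL: "g \<in> L2" by (rule L2_bound[OF g w gb])
  have "(\<lambda>n. LINT x|lborel. (cmod (F n x - g x))\<^sup>2) \<longlonglongrightarrow> (LINT (x::real)|lborel. (0::real))"
  proof (rule integral_dominated_convergence[where w = "\<lambda>x. (2 * C)\<^sup>2 * (cmod (w x))\<^sup>2"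
        and s = "\<lambda>n x. (cmod (F n x - g x))\<^sup>2" and f = "\<lambda>x. 0" and M = lborel])
    show "integrable lborel (\<lambda>x. (2 * C)\<^sup>2 * (cmod (w x))\<^sup>2)"
      using L2_integrable[OF w] by simp
    show "AE x in lborel. (\<lambda>n. (cmod (F n x - g x))\<^sup>2) \<longlonglongrightarrow> 0"
      using lim
    proof eventually_elim
      case (elim x)
      then have "(\<lambda>n. (cmod (F n x - g x))\<^sup>2) \<longlonglongrightarrow> (cmod (g x - g x))\<^sup>2"
        by (intro tendsto_intros)
      then show ?case by simp
    qed
    show "AE x in lborel. norm ((cmod (F n x - g x))\<^sup>2) \<le> (2 * C)\<^sup>2 * (cmod (w x))\<^sup>2" for n
      using gb
    proof eventually_elim
      case (elim x)
      have "cmod (F n x - g x) \<le> 2 * C * cmod (w x)"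
        using norm_triangle_ineq4[of "F n x" "g x"] elim bnd[of n x] by simp
      then have "(cmod (F n x - g x))\<^sup>2 \<le> (2 * C * cmod (w x))\<^sup>2" by (intro power_mono) auto
      then show ?case by (simp add: power_mult_distrib)
    qed
  qed auto
  then have "(\<lambda>n. sqrt (LINT x|lborel. (cmod (F n x - g x))\<^sup>2)) \<longlonglongrightarrow> sqrt 0"
    by (intro tendsto_real_sqrt) simp
  then show ?thesis using FL gL by (simp add: L2_tendsto_def L2_norm_def)
qed

lemma L2_tendsto_truncation:
  assumes f: "f \<in> L2"
  shows "L2_tendsto (\<lambda>n x. indicator {- real n..real n} x * f x) f"
proof (rule L2_dominated_convergence[OF _ _ f, of _ _ 1])
  note [measurable] = L2_measurable[OF f]
  show "(\<lambda>x. indicator {- real n..real n} x * f x) \<in> borel_measurable borel" for n by measurable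
  have "(\<lambda>n. indicator {- real n..real n} x * f x) \<longlonglongrightarrow> f x" for x
  proof (rule tendsto_eventually)
    obtain N :: nat where "\<bar>x\<bar> \<le> real N" using real_arch_simple by blast
    then show "\<forall>\<^sub>F n in sequentially. indicator {- real n..real n} x * f x = f x"
      by (intro eventually_sequentiallyI[of N]) (auto simp: indicator_def)
  qed
  then show "AE x in lborel. (\<lambda>n. indicator {- real n..real n} x * f x) \<longlonglongrightarrow> f x" by simp
qed (auto simp: indicator_def L2_measurable[OF f])

text \<open>
  Riesz-Fischer. Along a subsequence whose increments \<open>d\<^sub>k\<close> have norm at most \<open>8\<^sup>-\<^sup>k\<close>, the function
  \<open>\<Sum>\<^sub>k (2\<^sup>k \<bar>d\<^sub>k\<bar>)\<^sup>2\<close> has a finite integral. So it is finite almost everywhere, which forces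
  \<open>\<bar>d\<^sub>k\<bar> = O(2\<^sup>-\<^sup>k)\<close> pointwise and gives a pointwise limit; by Fatou's lemma this is the limit in norm.
\<close>

lemma L2_complete:
  assumes F: "\<And>n. F n \<in> L2"
    and Cauchy: "\<And>e. e > 0 \<Longrightarrow> \<exists>N. \<forall>m\<ge>N. \<forall>n\<ge>N. L2_norm (\<lambda>x. F m x - F n x) < e"
  obtains g where "L2_tendsto F g"
proof -
  note [measurable] = L2_measurable[OF F]
  have "\<exists>r. \<forall>k. (\<forall>m\<ge>r k. \<forall>n\<ge>r k. L2_norm (\<lambda>x. F m x - F n x) < (1/8)^k) \<and> r k < r (Suc k)"
  proof (rule dependent_nat_choice)
    show "\<exists>r. \<forall>m\<ge>r. \<forall>n\<ge>r. L2_norm (\<lambda>x. F m x - F n x) < (1/8)^0"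
      using Cauchy[of "(1/8)^0"] by auto
    fix x k
    obtain N where N: "\<forall>m\<ge>N. \<forall>n\<ge>N. L2_norm (\<lambda>x. F m x - F n x) < (1/8)^Suc k"
      using Cauchy[of "(1/8)^Suc k"] by auto
    then show "\<exists>y. (\<forall>m\<ge>y. \<forall>n\<ge>y. L2_norm (\<lambda>x. F m x - F n x) < (1/8)^Suc k) \<and> x < y"
      by (intro exI[of _ "max N (Suc x)"]) auto
  qed
  then obtain r where r: "\<And>k m n. m \<ge> r k \<Longrightarrow> n \<ge> r k \<Longrightarrow> L2_norm (\<lambda>x. F m x - F n x) < (1/8)^k"
      and r_less: "\<And>k. r k < r (Suc k)" by blast
  have mono: "strict_mono r" using r_less by (simp add: strict_mono_Suc_iff)
  define d where "d k x = F (r (Suc k)) x - F (r k) x" for k x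
  have d: "d k \<in> L2" for k using F by (auto simp: d_def[abs_def])
  note [measurable] = L2_measurable[OF d]
  have d_norm: "L2_norm (d k) \<le> (1/8)^k" for k
    using r[of k "r (Suc k)" "r k"] r_less[of k] by (simp add: d_def[abs_def])
  have "(\<integral>\<^sup>+ x. (\<Sum>k. ennreal ((2^k * cmod (d k x))\<^sup>2)) \<partial>lborel) =
      (\<Sum>k. \<integral>\<^sup>+ x. ennreal ((2^k * cmod (d k x))\<^sup>2) \<partial>lborel)"
    by (intro nn_integral_suminf) measurable
  also have "\<dots> \<le> (\<Sum>k. ennreal ((1/16)^k))"
  proof (intro suminf_le summableI)
    fix k
    have "((2::real)^k)\<^sup>2 = 4^k"
      by (simp add: power2_eq_square flip: power_mult_distrib)
    then have "(\<integral>\<^sup>+ x. ennreal ((2^k * cmod (d k x))\<^sup>2) \<partial>lborel) = ennreal (4^k * (L2_norm (d k))\<^sup>2)"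
      by (subst nn_integral_eq_integral)
         (auto simp: power_mult_distrib L2_integrable[OF d] L2_norm_sq)
    also have "\<dots> \<le> ennreal (4^k * ((1/8)^k)\<^sup>2)"
      using d_norm[of k] by (intro ennreal_leI mult_left_mono power_mono) auto
    also have "4^k * ((1/8)^k)\<^sup>2 = ((1/16)^k :: real)"
      by (simp add: power2_eq_square flip: power_mult_distrib)
    finally show "(\<integral>\<^sup>+ x. ennreal ((2^k * cmod (d k x))\<^sup>2) \<partial>lborel) \<le> ennreal ((1/16)^k)" .
  qed
  also have "\<dots> < \<infinity>"
    by (subst suminf_ennreal_eq[OF _ summable_sums]) (auto intro: summable_geometric)
  finally have "AE x in lborel. (\<Sum>k. ennreal ((2^k * cmod (d k x))\<^sup>2)) \<noteq> \<infinity>"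
    by (intro nn_integral_PInf_AE) auto
  then have conv: "AE x in lborel. convergent (\<lambda>n. F (r n) x)"
  proof eventually_elim
    case (elim x)
    define M where "M = enn2real (\<Sum>k. ennreal ((2^k * cmod (d k x))\<^sup>2))"
    have M: "(\<Sum>k. ennreal ((2^k * cmod (d k x))\<^sup>2)) = ennreal M"
      using elim unfolding M_def by (simp add: top.not_eq_extremum)
    have "norm (d k x) \<le> sqrt M * (1/2)^k" for k
    proof -
      have "(\<Sum>j\<in>{k}. ennreal ((2^j * cmod (d j x))\<^sup>2)) \<le> ennreal M"
        unfolding M[symmetric] by (intro sum_le_suminf summableI) auto
      then have "(2^k * cmod (d k x))\<^sup>2 \<le> M"
        by (simp add: ennreal_le_iff M_def)
      then have "2^k * cmod (d k x) \<le> sqrt M" by (rule real_le_rsqrt)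
      then show ?thesis by (simp add: field_simps power_divide)
    qed
    moreover have "summable (\<lambda>k. sqrt M * (1/2::real)^k)"
      by (intro summable_mult summable_geometric) simp
    ultimately have "summable (\<lambda>k. d k x)"
      by (metis summable_comparison_test')
    then have "convergent (\<lambda>n. F (r 0) x + (\<Sum>k<n. d k x))"
      by (intro convergent_add convergent_const) (simp add: summable_iff_convergent)
    moreover have "F (r 0) x + (\<Sum>k<n. d k x) = F (r n) x" for n
      unfolding d_def by (subst sum_lessThan_telescope) simp
    ultimately show ?case by simp
  qed
  define g where "g x = lim (\<lambda>n. F (r n) x)" for x
  have g [measurable]: "g \<in> borel_measurable borel"
    unfolding g_def[abs_def] by measurable
  have near: "(\<lambda>x. g x - F m x) \<in> L2 \<and> L2_norm (\<lambda>x. g x - F m x) \<le> e"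
    if e: "\<And>m n. m \<ge> N \<Longrightarrow> n \<ge> N \<Longrightarrow> L2_norm (\<lambda>x. F m x - F n x) < e" and "m \<ge> N" for e m N
  proof (rule conjI)
    have rge: "r (n + N) \<ge> N" for n
      using strict_mono_imp_increasing[OF mono, of "n + N"] by simp
    have lim: "AE x in lborel. (\<lambda>n. F (r (n + N)) x - F m x) \<longlonglongrightarrow> g x - F m x"
      using conv
    proof eventually_elim
      case (elim x)
      then have "(\<lambda>n. F (r n) x) \<longlonglongrightarrow> g x" by (simp add: convergent_LIMSEQ_iff g_def)
      from LIMSEQ_ignore_initial_segment[OF this] show ?case by (intro tendsto_intros)
    qed
    have A: "(\<lambda>x. F (r (n + N)) x - F m x) \<in> L2" "L2_norm (\<lambda>x. F (r (n + N)) x - F m x) \<le> e" for n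
      using e[of "r (n + N)" m] rge \<open>m \<ge> N\<close> F by (auto simp: less_imp_le)
    show "(\<lambda>x. g x - F m x) \<in> L2"
      by (rule L2_Fatou(1)[OF A(1) A(2) _ lim]) measurable
    show "L2_norm (\<lambda>x. g x - F m x) \<le> e"
      by (rule L2_Fatou(2)[OF A(1) A(2) _ lim]) measurable
  qed
  have "g \<in> L2"
  proof -
    have "(\<lambda>x. g x - F (r 0) x) \<in> L2" using near[of "r 0" "(1/8)^0" "r 0"] r[of 0] by auto
    from L2_add[OF this F[of "r 0"]] show ?thesis by simp
  qed
  moreover have "(\<lambda>n. L2_norm (\<lambda>x. F n x - g x)) \<longlonglongrightarrow> 0"
  proof (rule LIMSEQ_I)
    fix e :: real assume "e > 0"
    then obtain N where N: "\<And>m n. m \<ge> N \<Longrightarrow> n \<ge> N \<Longrightarrow> L2_norm (\<lambda>x. F m x - F n x) < e / 2"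
      using Cauchy[of "e / 2"] by auto
    have "L2_norm (\<lambda>x. F n x - g x) < e" if "n \<ge> N" for n
      using near[of N "e / 2" n, OF N that] \<open>e > 0\<close> L2_norm_minus_commute[of "F n" g] by linarith
    then show "\<exists>N. \<forall>n\<ge>N. norm (L2_norm (\<lambda>x. F n x - g x) - 0) < e"
      by auto
  qed
  ultimately show ?thesis using that F by (auto simp: L2_tendsto_def)
qed

lemma L2_indicator_bounded:
  "A \<in> sets borel \<Longrightarrow> A \<subseteq> {a..b} \<Longrightarrow> (\<lambda>x. indicator A x :: complex) \<in> L2"
proof (rule L2_I)
  assume A: "A \<in> sets borel" "A \<subseteq> {a..b}"
  have *: "(\<lambda>x. (cmod (indicator A x))\<^sup>2) = indicator A"
    by (auto simp: indicator_def)
  have "emeasure lborel A \<le> emeasure lborel {a..b}"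
    using A by (intro emeasure_mono) auto
  then have "emeasure lborel A < \<infinity>"
    by (rule le_less_trans) (simp add: emeasure_lborel_Icc_eq)
  then show "integrable lborel (\<lambda>x. (cmod (indicator A x))\<^sup>2)"
    unfolding * using A by simp
qed simp

text \<open>
  Indicators of bounded intervals span a dense subspace. The proof goes from intervals to all Borel
  sets inside a fixed interval by the \<open>\<pi>\<close>-\<open>\<lambda>\<close> theorem, and from there to simple functions.
\<close>

lemma L2_induct [consumes 1, case_names interval linear limit]:
  assumes f: "f \<in> L2"
    and interval: "\<And>a b. a \<le> b \<Longrightarrow> P (\<lambda>x. indicator {a<..b} x)"
    and linear: "\<And>f g a b. f \<in> L2 \<Longrightarrow> P f \<Longrightarrow> g \<in> L2 \<Longrightarrow> P g \<Longrightarrow> P (\<lambda>x. a * f x + b * g x)"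
    and limit: "\<And>F g. (\<And>n. P (F n)) \<Longrightarrow> L2_tendsto F g \<Longrightarrow> P g"
  shows "P f"
proof -
  define J where "J N = {- real N<..real N}" for N
  have IL: "(\<lambda>x. indicator (A \<inter> J N) x :: complex) \<in> L2" if "A \<in> sets borel" for A N
    by (rule L2_indicator_bounded[of _ "- real N" "real N"]) (use that in \<open>auto simp: J_def\<close>)
  have P0: "P (\<lambda>x. 0)" using interval[of 0 0] by simp
  have PA: "P (\<lambda>x. indicator (A \<inter> J N) x)" if "A \<in> sets borel" for A N
  proof -
    let ?G = "range (\<lambda>(a, b). {a<..b::real})"
    have eq: "sets borel = sigma_sets UNIV ?G"
      by (subst borel_sigma_sets_Ioc) auto
    have "Int_stable ?G"
    proof (rule Int_stableI)
      fix A B assume "A \<in> ?G" "B \<in> ?G"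
      then obtain a b c d where "A = {a<..b}" "B = {c<..d}" by auto
      then have "A \<inter> B = {max a c<..min b d}" by auto
      then show "A \<inter> B \<in> ?G" by auto
    qed
    moreover have "?G \<subseteq> Pow UNIV" by simp
    moreover have "A \<in> sigma_sets UNIV ?G" using that eq by simp
    ultimately show ?thesis
    proof (induction rule: sigma_sets_induct_disjoint)
      case (basic A)
      then obtain a b where A: "A = {a<..b}" by auto
      define c d where "c = max a (- real N)" and "d = max c (min b (real N))"
      have "A \<inter> J N = {c<..d}" by (auto simp: A J_def c_def d_def)
      then show ?case using interval[of c d] by (simp add: d_def)
    next
      case empty
      then show ?case using P0 by simp
    next
      case (compl A)
      have "P (\<lambda>x. 1 * indicator (UNIV \<inter> J N) x + (- 1) * indicator (A \<inter> J N) x)"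
      proof (rule linear[OF IL _ IL _])
        show "A \<in> sets borel" using compl(1) eq by simp
        show "P (\<lambda>x. indicator (UNIV \<inter> J N) x)"
          using interval[of "- real N" "real N"] by (simp add: J_def)
        show "P (\<lambda>x. indicator (A \<inter> J N) x)" by (rule compl(2))
      qed simp
      also have "(\<lambda>x. 1 * indicator (UNIV \<inter> J N) x + (- 1) * indicator (A \<inter> J N) x) =
          (\<lambda>x. indicator ((UNIV - A) \<inter> J N) x :: complex)"
        by (auto simp: indicator_def)
      finally show ?case .
    next
      case (union A)
      then have [measurable]: "A i \<in> sets borel" for i using eq by auto
      have fin: "P (\<lambda>x. indicator ((\<Union>i<n. A i) \<inter> J N) x)" for n
      proof (induction n)
        case 0
        then show ?case using P0 by simp
      next
        case (Suc n)
        have "P (\<lambda>x. 1 * indicator ((\<Union>i<n. A i) \<inter> J N) x + 1 * indicator (A n \<inter> J N) x)"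
          by (rule linear[OF IL Suc IL union(3)]) auto
        also have "(\<lambda>x. 1 * indicator ((\<Union>i<n. A i) \<inter> J N) x + 1 * indicator (A n \<inter> J N) x) =
            (\<lambda>x. indicator ((\<Union>i<Suc n. A i) \<inter> J N) x :: complex)"
        proof
          fix x
          have "x \<notin> A i" if "x \<in> A n" "i < n" for i
            using disjoint_family_onD[OF union(1), of i n] that by auto
          then show "1 * indicator ((\<Union>i<n. A i) \<inter> J N) x + 1 * indicator (A n \<inter> J N) x =
            (indicator ((\<Union>i<Suc n. A i) \<inter> J N) x :: complex)"
            by (auto simp: indicator_def less_Suc_eq)
        qed
        finally show ?case .
      qed
      show ?case
      proof (rule limit[OF fin], rule L2_dominated_convergence)
        show "(\<lambda>x. indicator (UNIV \<inter> J N) x) \<in> L2" by (rule IL) simp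
        show "cmod (indicator ((\<Union>i<n. A i) \<inter> J N) x) \<le> 1 * cmod (indicator (UNIV \<inter> J N) x)" for n x
          by (auto simp: indicator_def)
        have "(\<lambda>n. indicator ((\<Union>i<n. A i) \<inter> J N) x) \<longlonglongrightarrow> (indicator (\<Union> (range A) \<inter> J N) x :: complex)" for x
        proof (rule tendsto_eventually)
          show "\<forall>\<^sub>F n in sequentially. indicator ((\<Union>i<n. A i) \<inter> J N) x = indicator (\<Union> (range A) \<inter> J N) x"
          proof (cases "x \<in> \<Union> (range A)")
            case True
            then obtain i where "x \<in> A i" by auto
            then show ?thesis
              by (intro eventually_sequentiallyI[of "Suc i"]) (auto simp: indicator_def)
          qed (auto simp: indicator_def)
        qed
        then show "AE x in lborel. (\<lambda>n. indicator ((\<Union>i<n. A i) \<inter> J N) x) \<longlonglongrightarrow>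
            (indicator (\<Union> (range A) \<inter> J N) x :: complex)" by simp
      qed (auto simp: J_def)
    qed
  qed
  have sum: "P (\<lambda>x. \<Sum>i\<in>I. c i * indicator (A i \<inter> J N) x)"
    if "finite I" "\<And>i. i \<in> I \<Longrightarrow> A i \<in> sets borel" for I :: "complex set" and c A N
    using that
  proof (induction I)
    case empty
    then show ?case using P0 by simp
  next
    case (insert i I)
    have "P (\<lambda>x. c i * indicator (A i \<inter> J N) x + 1 * (\<Sum>i\<in>I. c i * indicator (A i \<inter> J N) x))"
    proof (rule linear[OF IL PA])
      show "(\<lambda>x. \<Sum>i\<in>I. c i * indicator (A i \<inter> J N) x) \<in> L2"
        using insert.prems by (intro L2_sum L2_scale IL) simp
      show "P (\<lambda>x. \<Sum>i\<in>I. c i * indicator (A i \<inter> J N) x)"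
        using insert by simp
    qed (use insert.prems in simp_all)
    then show ?case using insert.hyps by (simp only: sum.insert[of I i] mult_1 if_False not_False_eq_True)
  qed
  note [measurable] = L2_measurable[OF f]
  obtain s where s: "\<And>i. simple_function borel (s i)" "\<And>x. (\<lambda>i. s i x) \<longlonglongrightarrow> f x"
      "\<And>i x. cmod (s i x) \<le> 2 * cmod (f x)"
    using borel_measurable_implies_sequence_metric[of f borel 0] L2_measurable[OF f] by auto
  note [measurable] = borel_measurable_simple_function[OF s(1)]
  have step: "P (\<lambda>x. indicator (J n) x * s n x)" for n
  proof -
    have "finite (range (s n))" using simple_functionD(1)[OF s(1)[of n]] by simp
    then have "P (\<lambda>x. \<Sum>y\<in>range (s n). y * indicator (s n -` {y} \<inter> J n) x)"
      by (rule sum) (rule measurable_sets_borel[OF borel_measurable_simple_function[OF s(1)]], simp)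
    also have "(\<lambda>x. \<Sum>y\<in>range (s n). y * indicator (s n -` {y} \<inter> J n) x) = (\<lambda>x. indicator (J n) x * s n x)"
    proof
      fix x
      have "(\<Sum>y\<in>range (s n). y * indicator (s n -` {y} \<inter> J n) x) =
          (\<Sum>y\<in>range (s n). if y = s n x then y * indicator (J n) x else 0)"
        by (intro sum.cong) (auto simp: indicator_def)
      also have "\<dots> = indicator (J n) x * s n x"
        using \<open>finite (range (s n))\<close> by (simp add: sum.delta mult.commute)
      finally show "(\<Sum>y\<in>range (s n). y * indicator (s n -` {y} \<inter> J n) x) = indicator (J n) x * s n x" .
    qed
    finally show ?thesis .
  qed
  show "P f"
  proof (rule limit[OF step], rule L2_dominated_convergence[OF _ _ f])
    show "cmod (indicator (J n) x * s n x) \<le> 2 * cmod (f x)" for n x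
      using s(3)[of n x] by (auto simp: indicator_def)
    have "(\<lambda>n. indicator (J n) x * s n x) \<longlonglongrightarrow> f x" for x
    proof -
      obtain N :: nat where N: "\<bar>x\<bar> < real N" using reals_Archimedean2 by blast
      have "\<forall>\<^sub>F n in sequentially. s n x = indicator (J n) x * s n x"
        using N by (intro eventually_sequentiallyI[of N]) (auto simp: J_def indicator_def)
      with s(2)[of x] show ?thesis by (rule Lim_transform_eventually)
    qed
    then show "AE x in lborel. (\<lambda>n. indicator (J n) x * s n x) \<longlonglongrightarrow> f x" by simp
  qed (auto simp: J_def)
qed

section \<open>The Fourier integral of integrable functions\<close>

definition fourier_integral :: "(real \<Rightarrow> complex) \<Rightarrow> real \<Rightarrow> complex" where
  "fourier_integral f \<omega> = (LINT t|lborel. f t * exp (- \<i> * of_real (\<omega> * t)))"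

lemma cmod_exp_i [simp]: "cmod (exp (- (\<i> * complex_of_real x))) = 1" "cmod (exp (\<i> * complex_of_real x)) = 1"
  using norm_exp_i_times[of "- x"] norm_exp_i_times[of x] by simp_all

lemma cmod_exp_i' [simp]: "cmod (exp (- (\<i> * (complex_of_real x * complex_of_real y)))) = 1"
    "cmod (exp (\<i> * (complex_of_real x * complex_of_real y))) = 1"
  using cmod_exp_i[of "x * y"] by simp_all

lemma borel_measurable_fourier_integral [measurable]:
  assumes [measurable]: "f \<in> borel_measurable borel"
  shows "fourier_integral f \<in> borel_measurable borel"
proof -
  have "(\<lambda>\<omega>. LINT t|lborel. f t * exp (- \<i> * of_real (\<omega> * t))) \<in> borel_measurable lborel"
    by (rule lborel.borel_measurable_lebesgue_integral) measurable
  then show ?thesis by (simp add: fourier_integral_def[abs_def])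
qed

lemma integrable_mult_unimodular:
  assumes "integrable lborel f" "q \<in> borel_measurable borel" "\<And>x. cmod (q x) \<le> C"
  shows "integrable lborel (\<lambda>x. f x * q x :: complex)"
proof (rule Bochner_Integration.integrable_bound[of _ "\<lambda>x. C * cmod (f x)"])
  have "cmod (f x * q x) \<le> norm (C * cmod (f x))" for x
  proof -
    have "cmod (f x) * cmod (q x) \<le> cmod (f x) * C" by (intro mult_left_mono assms) simp
    also have "\<dots> \<le> norm (C * cmod (f x))" by (simp add: mult.commute)
    finally show ?thesis by (simp add: norm_mult)
  qed
  then show "AE x in lborel. norm (f x * q x) \<le> norm (C * cmod (f x))" by simp
qed (use assms in auto)

lemma integrable_fourier_kernel:
  assumes "integrable lborel f"
  shows "integrable lborel (\<lambda>t. f t * exp (- \<i> * of_real (\<omega> * t)))"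
  by (rule integrable_mult_unimodular[OF assms, of _ 1]) auto

lemma fourier_integral_bound:
  assumes "integrable lborel f"
  shows "cmod (fourier_integral f \<omega>) \<le> (LINT t|lborel. cmod (f t))"
proof -
  have "cmod (fourier_integral f \<omega>) \<le> (LINT t|lborel. cmod (f t * exp (- \<i> * of_real (\<omega> * t))))"
    unfolding fourier_integral_def by (rule integral_norm_bound)
  then show ?thesis by (simp add: norm_mult)
qed

lemma fourier_integral_linear:
  assumes "integrable lborel f" "integrable lborel g"
  shows "fourier_integral (\<lambda>x. a * f x + b * g x) \<omega> = a * fourier_integral f \<omega> + b * fourier_integral g \<omega>"
  using integrable_fourier_kernel[OF assms(1), of \<omega>] integrable_fourier_kernel[OF assms(2), of \<omega>]
  by (simp add: fourier_integral_def ring_distribs mult.assoc)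

text \<open>Fubini's theorem lets the Fourier kernel be moved from one factor to the other.\<close>

lemma fourier_integral_mult:
  assumes f: "integrable lborel f" and h: "integrable lborel h"
  shows "(LINT \<omega>|lborel. fourier_integral f \<omega> * h \<omega>) = (LINT t|lborel. f t * fourier_integral h t)"
proof -
  have [measurable]: "f \<in> borel_measurable borel" "h \<in> borel_measurable borel"
    using f h by (auto dest: borel_measurable_integrable)
  let ?k = "\<lambda>t \<omega>. f t * exp (- \<i> * of_real (\<omega> * t)) * h \<omega>"
  have "integrable (lborel \<Otimes>\<^sub>M lborel) (case_prod ?k)"
  proof (rule lborel_pair.Fubini_integrable)
    show "integrable lborel (\<lambda>x. LINT y|lborel. norm (case (x, y) of (t, \<omega>) \<Rightarrow> ?k t \<omega>))"
      using f by (simp add: norm_mult)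
    show "AE x in lborel. integrable lborel (\<lambda>y. case (x, y) of (t, \<omega>) \<Rightarrow> ?k t \<omega>)"
    proof (rule AE_I2)
      fix x
      have "integrable lborel (\<lambda>y. f x * (h y * exp (- \<i> * of_real (x * y))))"
        by (intro integrable_mult_right integrable_fourier_kernel h)
      then show "integrable lborel (\<lambda>y. case (x, y) of (t, \<omega>) \<Rightarrow> ?k t \<omega>)"
        by (simp add: mult_ac)
    qed
  qed measurable
  from lborel_pair.Fubini_integral[OF this]
  have "(LINT \<omega>|lborel. LINT t|lborel. ?k t \<omega>) = (LINT t|lborel. LINT \<omega>|lborel. ?k t \<omega>)" .
  moreover have "(LINT t|lborel. ?k t \<omega>) = fourier_integral f \<omega> * h \<omega>" for \<omega>
    by (simp add: fourier_integral_def)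
  moreover have "(LINT \<omega>|lborel. ?k t \<omega>) = f t * fourier_integral h t" for t
    by (simp add: fourier_integral_def mult_ac flip: integral_mult_right_zero)
  ultimately show ?thesis by (simp only:)
qed

subsection \<open>Gaussian regularization\<close>

definition gauss :: "nat \<Rightarrow> real \<Rightarrow> real" where
  "gauss n \<omega> = exp (- (\<omega> / n)\<^sup>2 / 2)"

text \<open>The normal density with mean \<open>s\<close> and standard deviation \<open>1 / n\<close>, in the variable \<open>t\<close>.\<close>

definition heat :: "nat \<Rightarrow> real \<Rightarrow> real \<Rightarrow> real" where
  "heat n s t = n * std_normal_density (n * (t - s))"

lemma borel_measurable_gauss [measurable]: "gauss n \<in> borel_measurable borel"
  unfolding gauss_def[abs_def] by measurable

lemma borel_measurable_heat [measurable]: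
  "case_prod (heat n) \<in> borel_measurable (borel \<Otimes>\<^sub>M borel)"
  "heat n s \<in> borel_measurable borel" "(\<lambda>s. heat n s t) \<in> borel_measurable borel"
  unfolding heat_def[abs_def] case_prod_unfold by measurable

lemma heat_nonneg [simp]: "0 \<le> heat n s t"
  by (simp add: heat_def normal_density_nonneg)

lemma gauss_bounds: "0 < gauss n \<omega>" "gauss n \<omega> \<le> 1"
  by (auto simp: gauss_def)

lemma gauss_tendsto: "(\<lambda>n. gauss n \<omega>) \<longlonglongrightarrow> 1"
proof -
  have "(\<lambda>n. exp (- (\<omega> / real n)\<^sup>2 / 2)) \<longlonglongrightarrow> exp (- 0\<^sup>2 / 2)"
    by (intro tendsto_intros lim_const_over_n) auto
  then show ?thesis by (simp add: gauss_def)
qed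

lemma gauss_eq: "gauss n \<omega> = sqrt (2 * pi) * std_normal_density (\<omega> / n)"
  by (simp add: gauss_def std_normal_density_def)

lemma integrable_gauss: "n > 0 \<Longrightarrow> integrable lborel (gauss n)"
proof -
  assume "n > 0"
  then have "integrable lborel (\<lambda>x. std_normal_density (0 + (1 / n) * x))"
    by (intro lborel_integrable_real_affine) auto
  then show ?thesis by (simp add: gauss_eq[abs_def])
qed

lemma heat_symmetric: "heat n s t = heat n t s"
  by (simp add: heat_def std_normal_density_def power2_commute[of s t] power_mult_distrib)

lemma has_integral_heat:
  assumes "n > 0"
  shows "integrable lborel (heat n s)" "(\<integral>\<^sup>+ t. ennreal (heat n s t) \<partial>lborel) = 1"
proof -
  have eq: "heat n s t = n * std_normal_density (- (n * s) + n * t)" for t :: real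
    by (simp add: heat_def algebra_simps)
  have "integrable lborel (\<lambda>t. std_normal_density (- (n * s) + n * t))"
    using assms by (intro lborel_integrable_real_affine) auto
  then have "integrable lborel (\<lambda>t. n * std_normal_density (- (n * s) + n * t))"
    by (rule integrable_mult_right)
  also have "(\<lambda>t::real. n * std_normal_density (- (n * s) + n * t)) = heat n s"
    by (rule ext) (rule eq[symmetric])
  finally show "integrable lborel (heat n s)" .
  interpret prob_space std_normal_distribution by (rule prob_space_normal_density) simp
  have "(\<integral>\<^sup>+ t. ennreal (std_normal_density t) \<partial>lborel) = 1"
    using emeasure_space_1 by (simp add: emeasure_density)
  also have "(\<integral>\<^sup>+ t. ennreal (std_normal_density t) \<partial>lborel) =
      \<bar>real n\<bar> * (\<integral>\<^sup>+ t. ennreal (std_normal_density (- (n * s) + n * t)) \<partial>lborel)"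
    using assms by (intro nn_integral_real_affine) auto
  also have "\<dots> = (\<integral>\<^sup>+ t. ennreal (heat n s t) \<partial>lborel)"
    by (simp add: eq ennreal_mult normal_density_nonneg nn_integral_cmult)
  finally show "(\<integral>\<^sup>+ t. ennreal (heat n s t) \<partial>lborel) = 1" .
qed

lemma fourier_integral_gauss:
  assumes "n > 0"
  shows "fourier_integral (\<lambda>\<omega>. of_real (gauss n \<omega>) * exp (\<i> * of_real (\<omega> * s))) t =
    of_real (2 * pi * heat n s t)"
proof -
  have n: "real n \<noteq> 0" using assms by simp
  let ?F = "\<lambda>\<omega>. of_real (gauss n \<omega>) * exp (\<i> * of_real (\<omega> * s)) * exp (- \<i> * of_real (t * \<omega>))"
  have "(LINT \<omega>|lborel. ?F \<omega>) = \<bar>real n\<bar> *\<^sub>R (LINT x|lborel. ?F (0 + n * x))"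
    using n by (rule lborel_integral_real_affine)
  also have "(LINT x|lborel. ?F (0 + n * x)) =
      (LINT x|lborel. of_real (sqrt (2 * pi)) * (of_real (std_normal_density x) * exp (\<i> * of_real (n * (s - t) * x))))"
  proof (rule Bochner_Integration.integral_cong[OF refl])
    fix x :: real
    have "exp (\<i> * of_real (n * (s - t) * x)) =
        exp (\<i> * of_real (n * x * s)) * exp (- \<i> * of_real (t * (n * x)))"
      by (simp add: exp_add[symmetric] algebra_simps)
    then show "?F (0 + n * x) = of_real (sqrt (2 * pi)) *
        (of_real (std_normal_density x) * exp (\<i> * of_real (n * (s - t) * x)))"
      using n by (simp add: gauss_eq mult.assoc)
  qed
  also have "\<dots> = of_real (sqrt (2 * pi)) * char std_normal_distribution (n * (s - t))"
    by (simp add: char_def integral_density normal_density_nonneg scaleR_conv_of_real)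
  also have "char std_normal_distribution (n * (s - t)) = of_real (exp (- (n * (s - t))\<^sup>2 / 2))"
    by (simp add: char_std_normal_distribution)
  finally have "(LINT \<omega>|lborel. ?F \<omega>) =
      of_real (n * (sqrt (2 * pi) * exp (- (n * (s - t))\<^sup>2 / 2)))"
    by (simp add: scaleR_conv_of_real)
  also have "n * (sqrt (2 * pi) * exp (- (n * (s - t))\<^sup>2 / 2)) = 2 * pi * heat n s t"
  proof -
    define A where "A = sqrt (2 * pi)"
    have A: "A > 0" "2 * pi = A * A" by (simp_all add: A_def)
    have "(n * (s - t))\<^sup>2 = (n * (t - s))\<^sup>2"
      by (simp add: power_mult_distrib power2_commute[of s t])
    then show ?thesis
      unfolding heat_def std_normal_density_def A_def[symmetric] using A(1) by (simp add: A(2))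
  qed
  finally show ?thesis by (simp only: fourier_integral_def)
qed

text \<open>
  The Gaussian weight makes the double integral absolutely convergent, and two applications of
  \<open>fourier_integral_mult\<close> turn it into convolution with the heat kernel.
\<close>

lemma gauss_weighted_inner:
  assumes f: "integrable lborel f" and g: "integrable lborel g" and n: "n > 0"
  shows "(LINT \<omega>|lborel. fourier_integral f \<omega> * cnj (fourier_integral g \<omega>) * of_real (gauss n \<omega>)) =
    of_real (2 * pi) * (LINT s|lborel. f s * cnj (LINT t|lborel. g t * of_real (heat n s t)))"
proof -
  have [measurable]: "f \<in> borel_measurable borel" "g \<in> borel_measurable borel"
    using f g by (auto dest: borel_measurable_integrable)
  let ?h = "\<lambda>\<omega>. cnj (fourier_integral g \<omega>) * of_real (gauss n \<omega>)"
  have gi: "integrable lborel (\<lambda>\<omega>. complex_of_real (gauss n \<omega>))"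
    using integrable_gauss[OF n] by simp
  have h: "integrable lborel ?h"
    using integrable_mult_unimodular[OF gi, of "\<lambda>\<omega>. cnj (fourier_integral g \<omega>)" "LINT t|lborel. cmod (g t)"]
      fourier_integral_bound[OF g] by (simp add: mult.commute)
  have "(LINT \<omega>|lborel. fourier_integral f \<omega> * cnj (fourier_integral g \<omega>) * of_real (gauss n \<omega>)) =
      (LINT s|lborel. f s * fourier_integral ?h s)"
    using fourier_integral_mult[OF f h] by (simp add: mult.assoc)
  also have "\<dots> = (LINT s|lborel. of_real (2 * pi) * (f s * cnj (LINT t|lborel. g t * of_real (heat n s t))))"
  proof (rule Bochner_Integration.integral_cong[OF refl])
    fix s
    have "fourier_integral ?h s = of_real (2 * pi) * cnj (LINT t|lborel. g t * of_real (heat n s t))"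
    proof -
      let ?q = "\<lambda>\<omega>. of_real (gauss n \<omega>) * exp (\<i> * of_real (\<omega> * s))"
      have q: "integrable lborel ?q"
        by (rule integrable_mult_unimodular[OF gi, of _ 1]) auto
      have "fourier_integral ?h s = cnj (LINT \<omega>|lborel. fourier_integral g \<omega> * ?q \<omega>)"
        unfolding fourier_integral_def[of ?h]
        by (simp add: exp_cnj mult_ac flip: Bochner_Integration.integral_cnj)
      also have "(LINT \<omega>|lborel. fourier_integral g \<omega> * ?q \<omega>) =
          (LINT t|lborel. g t * fourier_integral ?q t)"
        by (rule fourier_integral_mult[OF g q])
      also have "\<dots> = (LINT t|lborel. of_real (2 * pi) * (g t * of_real (heat n s t)))"
        unfolding fourier_integral_gauss[OF n] of_real_mult[of "2 * pi"] by (simp only: mult_ac)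
      also have "\<dots> = of_real (2 * pi) * (LINT t|lborel. g t * of_real (heat n s t))"
        by (rule integral_mult_right_zero)
      finally show ?thesis by simp
    qed
    then show "f s * fourier_integral ?h s =
        of_real (2 * pi) * (f s * cnj (LINT t|lborel. g t * of_real (heat n s t)))"
      by (simp only: mult_ac)
  qed
  also have "\<dots> = of_real (2 * pi) * (LINT s|lborel. f s * cnj (LINT t|lborel. g t * of_real (heat n s t)))"
    by (rule integral_mult_right_zero)
  finally show ?thesis .
qed

text \<open>
  The heat kernel has integral \<open>1\<close> in each variable, so \<open>\<bar>f(s) f(t)\<bar> \<le> (\<bar>f(s)\<bar>\<^sup>2 + \<bar>f(t)\<bar>\<^sup>2) / 2\<close> bounds the
  Gaussian-weighted norm of the transform by \<open>2 \<pi> \<parallel>f\<parallel>\<^sup>2\<close>, uniformly in the width. Fatou's lemma removes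
  the weight.
\<close>

lemma fourier_integral_L2:
  assumes f: "integrable lborel f" and fL: "f \<in> L2"
  shows "fourier_integral f \<in> L2" "L2_norm (fourier_integral f) \<le> sqrt (2 * pi) * L2_norm f"
proof -
  note [measurable] = L2_measurable[OF fL]
  let ?N = "(L2_norm f)\<^sup>2"
  have nnN: "(\<integral>\<^sup>+ s. ennreal ((cmod (f s))\<^sup>2) \<partial>lborel) = ennreal ?N"
    by (simp add: nn_integral_eq_integral[OF L2_integrable[OF fL]] L2_norm_sq)
  have heat_bound: "cmod (LINT s|lborel. f s * cnj (LINT t|lborel. f t * of_real (heat n s t))) \<le> ?N"
    if n: "n > 0" for n
  proof -
    have "ennreal (cmod (LINT s|lborel. f s * cnj (LINT t|lborel. f t * of_real (heat n s t)))) \<le>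
        (\<integral>\<^sup>+ s. ennreal (cmod (f s * cnj (LINT t|lborel. f t * of_real (heat n s t)))) \<partial>lborel)"
      by (cases "integrable lborel (\<lambda>s. f s * cnj (LINT t|lborel. f t * of_real (heat n s t)))")
         (auto intro: integral_norm_bound_ennreal simp: not_integrable_integral_eq)
    also have "\<dots> \<le> (\<integral>\<^sup>+ s. (\<integral>\<^sup>+ t. ennreal ((cmod (f s))\<^sup>2 * heat n s t / 2) +
        ennreal ((cmod (f t))\<^sup>2 * heat n s t / 2) \<partial>lborel) \<partial>lborel)"
    proof (rule nn_integral_mono)
      fix s
      have "ennreal (cmod (LINT t|lborel. f t * of_real (heat n s t))) \<le>
          (\<integral>\<^sup>+ t. ennreal (cmod (f t * of_real (heat n s t))) \<partial>lborel)"
        by (cases "integrable lborel (\<lambda>t. f t * of_real (heat n s t))")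
           (auto intro: integral_norm_bound_ennreal simp: not_integrable_integral_eq)
      then have "ennreal (cmod (f s * cnj (LINT t|lborel. f t * of_real (heat n s t)))) \<le>
          ennreal (cmod (f s)) * (\<integral>\<^sup>+ t. ennreal (cmod (f t * of_real (heat n s t))) \<partial>lborel)"
        by (simp add: norm_mult ennreal_mult mult_left_mono)
      also have "\<dots> = (\<integral>\<^sup>+ t. ennreal (cmod (f s)) * ennreal (cmod (f t * of_real (heat n s t))) \<partial>lborel)"
        by (rule nn_integral_cmult[symmetric]) measurable
      also have "\<dots> \<le> (\<integral>\<^sup>+ t. ennreal ((cmod (f s))\<^sup>2 * heat n s t / 2) +
          ennreal ((cmod (f t))\<^sup>2 * heat n s t / 2) \<partial>lborel)"
      proof (rule nn_integral_mono)
        fix t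
        have "cmod (f s) * cmod (f t) \<le> ((cmod (f s))\<^sup>2 + (cmod (f t))\<^sup>2) / 2"
          using sum_squares_bound[of "cmod (f s)" "cmod (f t)"] by simp
        then have "cmod (f s) * cmod (f t) * heat n s t \<le> ((cmod (f s))\<^sup>2 + (cmod (f t))\<^sup>2) / 2 * heat n s t"
          by (rule mult_right_mono) simp
        also have "\<dots> = (cmod (f s))\<^sup>2 * heat n s t / 2 + (cmod (f t))\<^sup>2 * heat n s t / 2"
          by (simp add: algebra_simps add_divide_distrib)
        finally have "cmod (f s) * cmod (f t * of_real (heat n s t)) \<le>
            (cmod (f s))\<^sup>2 * heat n s t / 2 + (cmod (f t))\<^sup>2 * heat n s t / 2"
          by (simp add: norm_mult mult.assoc)
        then show "ennreal (cmod (f s)) * ennreal (cmod (f t * of_real (heat n s t))) \<le>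
            ennreal ((cmod (f s))\<^sup>2 * heat n s t / 2) + ennreal ((cmod (f t))\<^sup>2 * heat n s t / 2)"
          by (simp add: ennreal_mult[symmetric] ennreal_plus[symmetric] ennreal_leI del: ennreal_plus)
      qed
      finally show "ennreal (cmod (f s * cnj (LINT t|lborel. f t * of_real (heat n s t)))) \<le> \<dots>" .
    qed
    also have "\<dots> = (\<integral>\<^sup>+ s. (\<integral>\<^sup>+ t. ennreal ((cmod (f s))\<^sup>2 / 2) * ennreal (heat n s t) \<partial>lborel) \<partial>lborel) +
        (\<integral>\<^sup>+ s. (\<integral>\<^sup>+ t. ennreal ((cmod (f t))\<^sup>2 / 2) * ennreal (heat n s t) \<partial>lborel) \<partial>lborel)"
      by (simp add: nn_integral_add ennreal_mult[symmetric])
    also have "(\<integral>\<^sup>+ s. (\<integral>\<^sup>+ t. ennreal ((cmod (f t))\<^sup>2 / 2) * ennreal (heat n s t) \<partial>lborel) \<partial>lborel) =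
        (\<integral>\<^sup>+ t. (\<integral>\<^sup>+ s. ennreal ((cmod (f t))\<^sup>2 / 2) * ennreal (heat n s t) \<partial>lborel) \<partial>lborel)"
      by (rule lborel_pair.Fubini'[symmetric]) measurable
    also have "\<dots> = (\<integral>\<^sup>+ t. ennreal ((cmod (f t))\<^sup>2 / 2) \<partial>lborel)"
      by (simp add: nn_integral_cmult heat_symmetric[of n _ t for t] has_integral_heat[OF n])
    also have "(\<integral>\<^sup>+ s. (\<integral>\<^sup>+ t. ennreal ((cmod (f s))\<^sup>2 / 2) * ennreal (heat n s t) \<partial>lborel) \<partial>lborel) =
        (\<integral>\<^sup>+ s. ennreal ((cmod (f s))\<^sup>2 / 2) \<partial>lborel)"
      by (simp add: nn_integral_cmult has_integral_heat[OF n])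
    also have "(\<integral>\<^sup>+ s. ennreal ((cmod (f s))\<^sup>2 / 2) \<partial>lborel) + (\<integral>\<^sup>+ s. ennreal ((cmod (f s))\<^sup>2 / 2) \<partial>lborel) =
        (\<integral>\<^sup>+ s. ennreal ((cmod (f s))\<^sup>2 / 2) + ennreal ((cmod (f s))\<^sup>2 / 2) \<partial>lborel)"
      by (rule nn_integral_add[symmetric]) measurable
    also have "\<dots> = ennreal ?N"
      by (simp add: ennreal_plus[symmetric] nnN del: ennreal_plus)
    finally show ?thesis by (simp add: ennreal_le_iff)
  qed
  define F where "F n \<omega> = fourier_integral f \<omega> * of_real (sqrt (gauss (Suc n) \<omega>))" for n \<omega>
  have sq: "(cmod (F n \<omega>))\<^sup>2 = (cmod (fourier_integral f \<omega>))\<^sup>2 * gauss (Suc n) \<omega>" for n \<omega>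
    using gauss_bounds(1)[of "Suc n" \<omega>] by (simp add: F_def norm_mult power_mult_distrib)
  have int: "integrable lborel (\<lambda>\<omega>. (cmod (F n \<omega>))\<^sup>2)" for n
  proof -
    have "integrable lborel (\<lambda>\<omega>. (LINT t|lborel. cmod (f t))\<^sup>2 * gauss (Suc n) \<omega>)"
      by (intro integrable_mult_right integrable_gauss) simp
    then show ?thesis
      unfolding sq using fourier_integral_bound[OF f] gauss_bounds(1)
      by (elim Bochner_Integration.integrable_bound)
         (auto intro!: AE_I2 mult_mono power_mono simp: abs_mult less_imp_le)
  qed
  have FL: "F n \<in> L2" for n
    by (rule L2_I[OF _ int]) (simp add: F_def[abs_def])
  have F_norm: "L2_norm (F n) \<le> sqrt (2 * pi) * L2_norm f" for n
  proof -
    have "complex_of_real ((L2_norm (F n))\<^sup>2) = (LINT \<omega>|lborel. complex_of_real ((cmod (F n \<omega>))\<^sup>2))"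
      by (simp only: L2_norm_sq integral_complex_of_real)
    also have "\<dots> = (LINT \<omega>|lborel. fourier_integral f \<omega> * cnj (fourier_integral f \<omega>) * of_real (gauss (Suc n) \<omega>))"
      unfolding sq of_real_mult complex_norm_square ..
    also have "\<dots> = of_real (2 * pi) * (LINT s|lborel. f s * cnj (LINT t|lborel. f t * of_real (heat (Suc n) s t)))"
      by (rule gauss_weighted_inner[OF f f]) simp
    finally have "cmod (complex_of_real ((L2_norm (F n))\<^sup>2)) \<le> 2 * pi * ?N"
      using heat_bound[of "Suc n"] by (simp only: norm_mult) simp
    then have "(L2_norm (F n))\<^sup>2 \<le> (sqrt (2 * pi) * L2_norm f)\<^sup>2"
      by (simp add: power_mult_distrib norm_power)
    then show ?thesis by (rule power2_le_imp_le) simp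
  qed
  have lim: "AE \<omega> in lborel. (\<lambda>n. F n \<omega>) \<longlonglongrightarrow> fourier_integral f \<omega>"
  proof (rule AE_I2)
    fix \<omega>
    have "(\<lambda>n. F n \<omega>) \<longlonglongrightarrow> fourier_integral f \<omega> * of_real (sqrt 1)"
      unfolding F_def by (intro tendsto_intros LIMSEQ_Suc[OF gauss_tendsto])
    then show "(\<lambda>n. F n \<omega>) \<longlonglongrightarrow> fourier_integral f \<omega>" by simp
  qed
  show "fourier_integral f \<in> L2" "L2_norm (fourier_integral f) \<le> sqrt (2 * pi) * L2_norm f"
    using L2_Fatou[OF FL F_norm _ lim] by simp_all
qed

section \<open>The Fourier transform on square-integrable functions\<close>

abbreviation truncate :: "nat \<Rightarrow> (real \<Rightarrow> complex) \<Rightarrow> real \<Rightarrow> complex" where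
  "truncate n f \<equiv> \<lambda>x. indicator {- real n..real n} x * f x"

lemma L2_bounded_support_integrable:
  assumes f: "f \<in> L2" and A: "A \<in> sets borel" "A \<subseteq> {a..b}"
  shows "integrable lborel (\<lambda>x. indicator A x * f x)" "(\<lambda>x. indicator A x * f x) \<in> L2"
proof -
  note [measurable] = L2_measurable[OF f] A(1)
  show "(\<lambda>x. indicator A x * f x) \<in> L2"
    by (rule L2_bound[OF _ f, of _ 1]) (auto simp: indicator_def)
  have "integrable lborel (\<lambda>x. f x * cnj (indicator A x))"
    by (rule L2_integrable_mult[OF f L2_indicator_bounded[OF A]])
  moreover have "f x * cnj (indicator A x) = indicator A x * f x" for x
    by (simp add: indicator_def)
  ultimately show "integrable lborel (\<lambda>x. indicator A x * f x)" by simp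
qed

lemma truncate_L2: "f \<in> L2 \<Longrightarrow> truncate n f \<in> L2"
  and integrable_truncate: "f \<in> L2 \<Longrightarrow> integrable lborel (truncate n f)"
  using L2_bounded_support_integrable[of f "{- real n..real n}" "- real n" "real n"] by auto

lemma fourier_integral_diff_norm:
  assumes "integrable lborel f" "f \<in> L2" "integrable lborel g" "g \<in> L2"
  shows "L2_norm (\<lambda>\<omega>. fourier_integral f \<omega> - fourier_integral g \<omega>) \<le> sqrt (2 * pi) * L2_norm (\<lambda>x. f x - g x)"
proof -
  have "fourier_integral (\<lambda>x. f x - g x) \<omega> = fourier_integral f \<omega> - fourier_integral g \<omega>" for \<omega>
    using fourier_integral_linear[of f g 1 "-1" \<omega>] assms by simp
  then have "fourier_integral (\<lambda>x. f x - g x) = (\<lambda>\<omega>. fourier_integral f \<omega> - fourier_integral g \<omega>)"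
    by (rule ext)
  then show ?thesis
    using fourier_integral_L2(2)[of "\<lambda>x. f x - g x"] assms by auto
qed

text \<open>
  The transforms of the truncations form a Cauchy sequence by the previous bound, so completeness
  provides the limit that the definition of \<open>fourier\<close> selects.
\<close>

lemma fourier_tendsto:
  assumes f: "f \<in> L2"
  shows "L2_tendsto (\<lambda>n. fourier_integral (truncate n f)) (fourier f)"
proof -
  have "\<exists>g. L2_tendsto (\<lambda>n. fourier_integral (truncate n f)) g"
  proof (rule L2_complete)
    show "fourier_integral (truncate n f) \<in> L2" for n
      by (intro fourier_integral_L2(1) integrable_truncate truncate_L2 f)
    fix e :: real assume e: "e > 0"
    define e' where "e' = e / sqrt (2 * pi) / 2"
    have e': "e' > 0" using e by (simp add: e'_def)
    note lim = L2_tendsto_truncation[OF f]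
    obtain N where N: "\<And>n. n \<ge> N \<Longrightarrow> L2_norm (\<lambda>x. truncate n f x - f x) < e'"
      using LIMSEQ_D[OF L2_tendstoD(3)[OF lim] e'] by auto
    have "L2_norm (\<lambda>\<omega>. fourier_integral (truncate m f) \<omega> - fourier_integral (truncate n f) \<omega>) < e"
      if "m \<ge> N" "n \<ge> N" for m n
    proof -
      have "L2_norm (\<lambda>\<omega>. fourier_integral (truncate m f) \<omega> - fourier_integral (truncate n f) \<omega>) \<le>
          sqrt (2 * pi) * L2_norm (\<lambda>x. truncate m f x - truncate n f x)"
        by (intro fourier_integral_diff_norm integrable_truncate truncate_L2 f)
      also have "L2_norm (\<lambda>x. truncate m f x - truncate n f x) \<le>
          L2_norm (\<lambda>x. truncate m f x - f x) + L2_norm (\<lambda>x. f x - truncate n f x)"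
        by (intro L2_norm_triangle_diff truncate_L2 f)
      also have "\<dots> < e' + e'"
        using N[OF that(1)] N[OF that(2)] by (simp add: L2_norm_minus_commute[of f])
      also have "sqrt (2 * pi) * (e' + e') = e" by (simp add: e'_def)
      finally show ?thesis by simp
    qed
    then show "\<exists>N. \<forall>m\<ge>N. \<forall>n\<ge>N. L2_norm (\<lambda>x. fourier_integral (truncate m f) x - fourier_integral (truncate n f) x) < e"
      by blast
  qed blast
  then have "L2_tendsto (\<lambda>n. fourier_integral (truncate n f))
      (SOME g. L2_tendsto (\<lambda>n. fourier_integral (truncate n f)) g)"
    by (rule someI_ex)
  moreover have "(\<lambda>\<omega>. LINT t:{- real n..real n}|lborel. f t * exp (- \<i> * of_real (\<omega> * t))) =
      fourier_integral (truncate n f)" for n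
    by (auto simp: fourier_integral_def set_lebesgue_integral_def scaleR_conv_of_real mult.assoc
        of_real_indicator)
  ultimately show ?thesis
    unfolding fourier_def by (simp only:)
qed

lemma fourier_L2 [intro]: "f \<in> L2 \<Longrightarrow> fourier f \<in> L2"
  by (rule L2_tendstoD(2)[OF fourier_tendsto])

lemma fourier_norm_le:
  assumes f: "f \<in> L2"
  shows "L2_norm (fourier f) \<le> sqrt (2 * pi) * L2_norm f"
proof (rule LIMSEQ_le)
  show "(\<lambda>n. L2_norm (fourier_integral (truncate n f))) \<longlonglongrightarrow> L2_norm (fourier f)"
    by (intro L2_tendsto_norm fourier_tendsto f)
  show "(\<lambda>n. sqrt (2 * pi) * L2_norm (truncate n f)) \<longlonglongrightarrow> sqrt (2 * pi) * L2_norm f"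
    by (intro tendsto_mult_left L2_tendsto_norm L2_tendsto_truncation f)
qed (use fourier_integral_L2(2)[OF integrable_truncate truncate_L2] f in blast)

lemma fourier_linear:
  assumes f: "f \<in> L2" and g: "g \<in> L2"
  shows "AE \<omega> in lborel. fourier (\<lambda>x. a * f x + b * g x) \<omega> = a * fourier f \<omega> + b * fourier g \<omega>"
proof (rule L2_tendsto_unique)
  have fg: "(\<lambda>x. a * f x + b * g x) \<in> L2" using f g by auto
  have "fourier_integral (truncate n (\<lambda>x. a * f x + b * g x)) =
      (\<lambda>\<omega>. a * fourier_integral (truncate n f) \<omega> + b * fourier_integral (truncate n g) \<omega>)" for n
    using fourier_integral_linear[OF integrable_truncate[OF f] integrable_truncate[OF g], where a = a and b = b]
    by (auto simp: algebra_simps)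
  with fourier_tendsto[OF fg]
  show "L2_tendsto (\<lambda>n \<omega>. a * fourier_integral (truncate n f) \<omega> + b * fourier_integral (truncate n g) \<omega>)
      (fourier (\<lambda>x. a * f x + b * g x))" by simp
  show "L2_tendsto (\<lambda>n \<omega>. a * fourier_integral (truncate n f) \<omega> + b * fourier_integral (truncate n g) \<omega>)
      (\<lambda>\<omega>. a * fourier f \<omega> + b * fourier g \<omega>)"
    by (intro L2_tendsto_linear fourier_tendsto f g)
qed

lemma fourier_scale: "f \<in> L2 \<Longrightarrow> AE \<omega> in lborel. fourier (\<lambda>x. a * f x) \<omega> = a * fourier f \<omega>"
  using fourier_linear[of f f a 0] by simp

lemma fourier_diff:
  "f \<in> L2 \<Longrightarrow> g \<in> L2 \<Longrightarrow> AE \<omega> in lborel. fourier (\<lambda>x. f x - g x) \<omega> = fourier f \<omega> - fourier g \<omega>"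
  using fourier_linear[of f g 1 "-1"] by simp

lemma L2_tendsto_fourier:
  assumes F: "L2_tendsto F g"
  shows "L2_tendsto (\<lambda>n. fourier (F n)) (fourier g)"
  unfolding L2_tendsto_def
proof (intro conjI allI)
  note D = L2_tendstoD[OF F]
  show "fourier (F n) \<in> L2" "fourier g \<in> L2" for n using D by auto
  show "(\<lambda>n. L2_norm (\<lambda>x. fourier (F n) x - fourier g x)) \<longlonglongrightarrow> 0"
  proof (rule Lim_null_comparison)
    have "L2_norm (\<lambda>x. fourier (F n) x - fourier g x) \<le> sqrt (2 * pi) * L2_norm (\<lambda>x. F n x - g x)" for n
    proof -
      have "L2_norm (\<lambda>x. fourier (F n) x - fourier g x) = L2_norm (fourier (\<lambda>x. F n x - g x))"
      proof (intro L2_norm_cong_AE L2_measurable fourier_L2 L2_diff D)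
        show "AE x in lborel. fourier (F n) x - fourier g x = fourier (\<lambda>x. F n x - g x) x"
          using fourier_diff[OF D(1)[of n] D(2)] by eventually_elim simp
      qed
      also have "\<dots> \<le> sqrt (2 * pi) * L2_norm (\<lambda>x. F n x - g x)"
        by (intro fourier_norm_le L2_diff D)
      finally show ?thesis .
    qed
    then show "\<forall>\<^sub>F n in sequentially. norm (L2_norm (\<lambda>x. fourier (F n) x - fourier g x)) \<le>
        sqrt (2 * pi) * L2_norm (\<lambda>x. F n x - g x)" by simp
    show "(\<lambda>n. sqrt (2 * pi) * L2_norm (\<lambda>x. F n x - g x)) \<longlonglongrightarrow> 0"
      using tendsto_mult_left[OF D(3), of "sqrt (2 * pi)"] by simp
  qed
qed

lemma fourier_eq_fourier_integral:
  assumes f: "integrable lborel f" "f \<in> L2"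
  shows "AE \<omega> in lborel. fourier f \<omega> = fourier_integral f \<omega>"
proof (rule L2_tendsto_unique[OF fourier_tendsto[OF f(2)]])
  show "L2_tendsto (\<lambda>n. fourier_integral (truncate n f)) (fourier_integral f)"
    unfolding L2_tendsto_def
  proof (intro conjI allI)
    show "fourier_integral (truncate n f) \<in> L2" "fourier_integral f \<in> L2" for n
      by (intro fourier_integral_L2(1) integrable_truncate truncate_L2 f)+
    show "(\<lambda>n. L2_norm (\<lambda>x. fourier_integral (truncate n f) x - fourier_integral f x)) \<longlonglongrightarrow> 0"
    proof (rule Lim_null_comparison)
      show "\<forall>\<^sub>F n in sequentially. norm (L2_norm (\<lambda>x. fourier_integral (truncate n f) x - fourier_integral f x)) \<le>
          sqrt (2 * pi) * L2_norm (\<lambda>x. truncate n f x - f x)"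
        using fourier_integral_diff_norm[OF integrable_truncate[OF f(2)] truncate_L2[OF f(2)] f] by simp
      show "(\<lambda>n. sqrt (2 * pi) * L2_norm (\<lambda>x. truncate n f x - f x)) \<longlonglongrightarrow> 0"
        using tendsto_mult_left[OF L2_tendstoD(3)[OF L2_tendsto_truncation[OF f(2)]], of "sqrt (2 * pi)"] by simp
    qed
  qed
qed

subsection \<open>Plancherel's identity and inversion\<close>

lemma cnj_indicator [simp]: "cnj (indicator A x) = indicator A x"
  by (simp add: indicator_def)

lemma integrable_indicator_interval: "integrable lborel (\<lambda>x. indicator {a<..b::real} x :: complex)"
proof -
  have "integrable lborel (\<lambda>x. complex_of_real (indicator {a<..b} x))"
    by (intro integrable_of_real integrable_real_indicator, simp, cases "a \<le> b") auto
  then show ?thesis by (simp add: of_real_indicator)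
qed

lemma heat_interval_bound:
  assumes n: "n > 0"
  shows "cmod (LINT t|lborel. indicator {a<..b} t * of_real (heat n s t)) \<le> 1"
proof -
  have "cmod (LINT t|lborel. indicator {a<..b} t * of_real (heat n s t)) \<le>
      (LINT t|lborel. cmod (indicator {a<..b} t * of_real (heat n s t)))"
    by (rule integral_norm_bound)
  also have "\<dots> \<le> (LINT t|lborel. heat n s t)"
  proof (rule integral_mono_AE')
    show "integrable lborel (heat n s)" by (rule has_integral_heat[OF n])
  qed (auto simp: indicator_def norm_mult)
  also have "ennreal (LINT t|lborel. heat n s t) = 1"
    using has_integral_heat[OF n, of s] by (subst nn_integral_eq_integral[symmetric]) auto
  then have "(LINT t|lborel. heat n s t) = 1"
    by simp
  finally show ?thesis .
qed

lemma heat_interval_tendsto: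
  assumes s: "s \<noteq> a" "s \<noteq> b"
  shows "(\<lambda>n. LINT t|lborel. indicator {a<..b} t * complex_of_real (heat (Suc n) s t)) \<longlonglongrightarrow> indicator {a<..b} s"
proof -
  have eq: "(LINT t|lborel. indicator {a<..b} t * complex_of_real (heat (Suc n) s t)) =
      (LINT x|lborel. indicator {a<..b} (s + (1 / Suc n) * x) * complex_of_real (std_normal_density x))" for n
  proof -
    have "(LINT t|lborel. indicator {a<..b} t * complex_of_real (heat (Suc n) s t)) =
      \<bar>1 / real (Suc n)\<bar> *\<^sub>R (LINT x|lborel. indicator {a<..b} (s + (1 / Suc n) * x) *
        complex_of_real (heat (Suc n) s (s + (1 / Suc n) * x)))"
      by (rule lborel_integral_real_affine) simp
    also have "\<dots> = (LINT x|lborel. \<bar>1 / real (Suc n)\<bar> *\<^sub>R (indicator {a<..b} (s + (1 / Suc n) * x) *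
        complex_of_real (heat (Suc n) s (s + (1 / Suc n) * x))))"
      by (rule integral_scaleR_right[symmetric])
    also have "\<dots> = (LINT x|lborel. indicator {a<..b} (s + (1 / Suc n) * x) * complex_of_real (std_normal_density x))"
      by (intro Bochner_Integration.integral_cong refl) (simp add: heat_def scaleR_conv_of_real del: of_nat_Suc)
    finally show ?thesis .
  qed
  have int1: "(LINT x|lborel. complex_of_real (std_normal_density x)) = 1"
  proof -
    interpret prob_space std_normal_distribution by (rule prob_space_normal_density) simp
    have "(LINT x|std_normal_distribution. (1::real)) = 1" using prob_space by simp
    then have "(LINT x|lborel. std_normal_density x) = 1"
      by (simp add: integral_density normal_density_nonneg)
    then show ?thesis by simp
  qed
  have "(\<lambda>n. LINT x|lborel. indicator {a<..b} (s + (1 / Suc n) * x) * complex_of_real (std_normal_density x)) \<longlonglongrightarrow>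
      (LINT x|lborel. indicator {a<..b} s * complex_of_real (std_normal_density x))"
  proof (rule integral_dominated_convergence[where w = std_normal_density])
    show "AE x in lborel. (\<lambda>n. indicator {a<..b} (s + (1 / Suc n) * x) * complex_of_real (std_normal_density x))
        \<longlonglongrightarrow> indicator {a<..b} s * complex_of_real (std_normal_density x)"
    proof (rule AE_I2)
      fix x
      have "(\<lambda>n. s + x / real (Suc n)) \<longlonglongrightarrow> s + 0"
        by (intro tendsto_intros LIMSEQ_Suc[OF lim_const_over_n])
      then have lim: "(\<lambda>n. s + (1 / Suc n) * x) \<longlonglongrightarrow> s" by simp
      have "\<forall>\<^sub>F n in sequentially. (a < s + (1 / Suc n) * x \<longleftrightarrow> a < s) \<and> (s + (1 / Suc n) * x < b \<longleftrightarrow> s < b) \<and>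
          s + (1 / Suc n) * x \<noteq> b"
      proof (intro eventually_conj)
        show "\<forall>\<^sub>F n in sequentially. a < s + (1 / Suc n) * x \<longleftrightarrow> a < s"
          using order_tendstoD[OF lim, of a] s by (cases "a < s") (auto elim!: eventually_mono)
        show "\<forall>\<^sub>F n in sequentially. s + (1 / Suc n) * x < b \<longleftrightarrow> s < b"
          using order_tendstoD[OF lim, of b] s by (cases "s < b") (auto elim!: eventually_mono)
        show "\<forall>\<^sub>F n in sequentially. s + (1 / Suc n) * x \<noteq> b"
          using tendsto_imp_eventually_ne[OF lim s(2)] .
      qed
      then have "\<forall>\<^sub>F n in sequentially. (indicator {a<..b} (s + (1 / Suc n) * x) :: complex) = indicator {a<..b} s"
        by eventually_elim (use s in \<open>auto simp: indicator_def\<close>)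
      then show "(\<lambda>n. indicator {a<..b} (s + (1 / Suc n) * x) * complex_of_real (std_normal_density x))
        \<longlonglongrightarrow> indicator {a<..b} s * complex_of_real (std_normal_density x)"
        by (intro tendsto_mult_right tendsto_eventually)
    qed
    show "AE x in lborel. norm (indicator {a<..b} (s + (1 / Suc n) * x) * complex_of_real (std_normal_density x))
        \<le> std_normal_density x" for n
      by (auto simp: indicator_def norm_mult normal_density_nonneg)
  qed auto
  then show ?thesis unfolding eq by (simp add: int1)
qed

text \<open>
  In \<open>gauss_weighted_inner\<close> the weight tends to \<open>1\<close>, and the heat kernel averages of an interval indicator
  converge to the indicator except at the endpoints.
\<close>

lemma fourier_inner_interval_integrable:
  assumes f: "integrable lborel f" "f \<in> L2"
  shows "L2_inner (fourier_integral f) (fourier_integral (\<lambda>x. indicator {a<..b} x)) =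
    of_real (2 * pi) * L2_inner f (\<lambda>x. indicator {a<..b} x)"
proof -
  let ?I = "\<lambda>x. indicator {a<..b} x :: complex"
  have [measurable]: "f \<in> borel_measurable borel" using f(2) by (rule L2_measurable)
  have IL: "?I \<in> L2" by (rule L2_indicator_bounded[of _ a b]) auto
  have II: "integrable lborel ?I" by (rule integrable_indicator_interval)
  note FL = fourier_integral_L2(1)[OF f] fourier_integral_L2(1)[OF II IL]
  have "(\<lambda>n. LINT \<omega>|lborel. fourier_integral f \<omega> * cnj (fourier_integral ?I \<omega>) * of_real (gauss (Suc n) \<omega>)) \<longlonglongrightarrow>
      (LINT \<omega>|lborel. fourier_integral f \<omega> * cnj (fourier_integral ?I \<omega>))"
  proof (rule integral_dominated_convergence)
    show "integrable lborel (\<lambda>\<omega>. cmod (fourier_integral f \<omega> * cnj (fourier_integral ?I \<omega>)))"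
      by (intro integrable_norm L2_integrable_mult FL)
    show "AE \<omega> in lborel. (\<lambda>n. fourier_integral f \<omega> * cnj (fourier_integral ?I \<omega>) * of_real (gauss (Suc n) \<omega>))
        \<longlonglongrightarrow> fourier_integral f \<omega> * cnj (fourier_integral ?I \<omega>)"
    proof (rule AE_I2)
      fix \<omega>
      have "(\<lambda>n. fourier_integral f \<omega> * cnj (fourier_integral ?I \<omega>) * of_real (gauss (Suc n) \<omega>))
        \<longlonglongrightarrow> fourier_integral f \<omega> * cnj (fourier_integral ?I \<omega>) * of_real 1"
        by (intro tendsto_intros LIMSEQ_Suc[OF gauss_tendsto])
      then show "(\<lambda>n. fourier_integral f \<omega> * cnj (fourier_integral ?I \<omega>) * of_real (gauss (Suc n) \<omega>))
        \<longlonglongrightarrow> fourier_integral f \<omega> * cnj (fourier_integral ?I \<omega>)" by simp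
    qed
    show "AE \<omega> in lborel. norm (fourier_integral f \<omega> * cnj (fourier_integral ?I \<omega>) * of_real (gauss (Suc n) \<omega>))
        \<le> cmod (fourier_integral f \<omega> * cnj (fourier_integral ?I \<omega>))" for n
    proof (rule AE_I2)
      fix \<omega>
      show "norm (fourier_integral f \<omega> * cnj (fourier_integral ?I \<omega>) * of_real (gauss (Suc n) \<omega>))
        \<le> cmod (fourier_integral f \<omega> * cnj (fourier_integral ?I \<omega>))"
        unfolding norm_mult[of _ "of_real (gauss (Suc n) \<omega>)"] norm_of_real
        using gauss_bounds[of "Suc n" \<omega>] by (intro mult_right_le_one_le) auto
    qed
  qed measurable
  moreover have "(\<lambda>n. of_real (2 * pi) * (LINT s|lborel. f s * cnj (LINT t|lborel. ?I t * of_real (heat (Suc n) s t)))) \<longlonglongrightarrow>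
      of_real (2 * pi) * (LINT s|lborel. f s * cnj (?I s))"
  proof (intro tendsto_mult_left integral_dominated_convergence)
    show "integrable lborel (\<lambda>s. cmod (f s))" by (intro integrable_norm f)
    have "AE s in lborel. s \<noteq> a \<and> s \<noteq> b"
      using AE_lborel_singleton[of a] AE_lborel_singleton[of b] by eventually_elim simp
    then show "AE s in lborel. (\<lambda>n. f s * cnj (LINT t|lborel. ?I t * of_real (heat (Suc n) s t)))
        \<longlonglongrightarrow> f s * cnj (?I s)"
      by eventually_elim (intro tendsto_mult_left tendsto_cnj heat_interval_tendsto, auto)
    show "AE s in lborel. norm (f s * cnj (LINT t|lborel. ?I t * of_real (heat (Suc n) s t))) \<le> cmod (f s)" for n
      using heat_interval_bound[of "Suc n" a b]
      by (auto simp: norm_mult intro!: mult_right_le_one_le simp del: of_nat_Suc)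
  qed measurable
  ultimately show ?thesis
    unfolding gauss_weighted_inner[OF f(1) II zero_less_Suc] L2_inner_def by (rule LIMSEQ_unique)
qed

lemma L2_inner_tendsto_left_const:
  "L2_tendsto F g \<Longrightarrow> h \<in> L2 \<Longrightarrow> (\<lambda>n. L2_inner h (F n)) \<longlonglongrightarrow> L2_inner h g"
  unfolding L2_inner_commute[of h] by (intro tendsto_cnj L2_tendsto_inner)

text \<open>
  Both sides are continuous in \<open>f\<close> and \<open>g\<close>, so \<open>f\<close> may be truncated and \<open>g\<close> taken to be the indicator of an
  interval.
\<close>

theorem Plancherel:
  assumes f: "f \<in> L2" and g: "g \<in> L2"
  shows "L2_inner (fourier f) (fourier g) = of_real (2 * pi) * L2_inner f g"
  using g
proof (induction g rule: L2_induct)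
  case (interval a b)
  let ?I = "\<lambda>x. indicator {a<..b} x :: complex"
  have IL: "?I \<in> L2" by (rule L2_indicator_bounded[of _ a b]) auto
  have II: "integrable lborel ?I" by (rule integrable_indicator_interval)
  have "(\<lambda>n. L2_inner (fourier_integral (truncate n f)) (fourier_integral ?I)) \<longlonglongrightarrow>
      L2_inner (fourier f) (fourier_integral ?I)"
    by (intro L2_tendsto_inner fourier_tendsto f fourier_integral_L2(1) II IL)
  moreover have "(\<lambda>n. of_real (2 * pi) * L2_inner (truncate n f) ?I) \<longlonglongrightarrow> of_real (2 * pi) * L2_inner f ?I"
    by (intro tendsto_mult_left L2_tendsto_inner L2_tendsto_truncation f IL)
  ultimately have "L2_inner (fourier f) (fourier_integral ?I) = of_real (2 * pi) * L2_inner f ?I"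
    unfolding fourier_inner_interval_integrable[OF integrable_truncate[OF f] truncate_L2[OF f]]
    by (rule LIMSEQ_unique)
  moreover have "L2_inner (fourier f) (fourier ?I) = L2_inner (fourier f) (fourier_integral ?I)"
    by (intro L2_inner_cong_AE fourier_L2 f IL fourier_eq_fourier_integral II L2_measurable
        fourier_integral_L2(1)) auto
  ultimately show ?case by simp
next
  case (linear g h a b)
  have gh: "(\<lambda>x. a * g x + b * h x) \<in> L2" using linear by auto
  have "L2_inner (fourier f) (fourier (\<lambda>x. a * g x + b * h x)) =
      L2_inner (fourier f) (\<lambda>\<omega>. a * fourier g \<omega> + b * fourier h \<omega>)"
    using fourier_linear[OF linear.hyps] f linear.hyps gh
    by (intro L2_inner_cong_AE L2_measurable fourier_L2 L2_add L2_scale) auto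
  then show ?case
    using f linear by (simp add: L2_inner_add_right L2_inner_scale_right fourier_L2 L2_scale algebra_simps)
next
  case (limit F g)
  have "(\<lambda>n. L2_inner (fourier f) (fourier (F n))) \<longlonglongrightarrow> L2_inner (fourier f) (fourier g)"
    by (intro L2_inner_tendsto_left_const L2_tendsto_fourier limit.hyps fourier_L2 f)
  moreover have "(\<lambda>n. of_real (2 * pi) * L2_inner f (F n)) \<longlonglongrightarrow> of_real (2 * pi) * L2_inner f g"
    by (intro tendsto_mult_left L2_inner_tendsto_left_const limit.hyps f)
  ultimately show ?case unfolding limit.IH by (rule LIMSEQ_unique)
qed

lemma fourier_norm: "f \<in> L2 \<Longrightarrow> (L2_norm (fourier f))\<^sup>2 = 2 * pi * (L2_norm f)\<^sup>2"
  using Plancherel[of f f] unfolding L2_inner_self of_real_mult[symmetric] of_real_eq_iff .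

lemma fourier_inj:
  assumes f: "f \<in> L2" and g: "g \<in> L2" and eq: "AE \<omega> in lborel. fourier f \<omega> = fourier g \<omega>"
  shows "AE x in lborel. f x = g x"
proof -
  have "L2_norm (fourier (\<lambda>x. f x - g x)) = L2_norm (\<lambda>x. 0)"
  proof (rule L2_norm_cong_AE)
    show "AE x in lborel. fourier (\<lambda>x. f x - g x) x = 0"
      using fourier_diff[OF f g] eq by eventually_elim simp
  qed (use f g in \<open>auto intro: L2_measurable\<close>)
  then have "(L2_norm (fourier (\<lambda>x. f x - g x)))\<^sup>2 = 0" by (simp add: L2_norm_def)
  then have "L2_norm (\<lambda>x. f x - g x) = 0"
    using fourier_norm[OF L2_diff[OF f g]] by simp
  then show ?thesis using L2_norm_eq_0_iff[OF L2_diff[OF f g]] by simp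
qed

text \<open>
  Up to the factor \<open>2 \<pi>\<close>, the inverse transform is the adjoint of the Fourier transform. The adjoint is
  again a Fourier transform, conjugated on both sides, and this symmetry makes the transform surjective.
\<close>

lemma fourier_adjoint:
  assumes h: "h \<in> L2" and g: "g \<in> L2"
  shows "L2_inner (\<lambda>x. cnj (fourier (\<lambda>\<omega>. cnj (h \<omega>)) x)) g = L2_inner h (fourier g)"
proof -
  have trunc: "L2_inner (fourier_integral (truncate n (\<lambda>\<omega>. cnj (k \<omega>)))) (\<lambda>x. cnj (truncate m l x)) =
      L2_inner (\<lambda>x. cnj (truncate n k x)) (\<lambda>x. cnj (fourier_integral (truncate m l) x))"
    if k: "k \<in> L2" and l: "l \<in> L2" for k l m n
  proof -
    have eq: "cnj (truncate n k x) = truncate n (\<lambda>\<omega>. cnj (k \<omega>)) x" for x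
      by simp
    show ?thesis
      unfolding L2_inner_def complex_cnj_cnj eq
      by (rule fourier_integral_mult[OF integrable_truncate[OF L2_cnj[OF k]] integrable_truncate[OF l]])
  qed
  have c: "L2_tendsto (\<lambda>n x. cnj (F n x)) (\<lambda>x. cnj (f x))" if "L2_tendsto F f" for F f
    using that by (auto simp: L2_tendsto_def L2_norm_def simp flip: complex_cnj_diff)
  have hc: "(\<lambda>\<omega>. cnj (h \<omega>)) \<in> L2" using h by auto
  have step: "L2_inner (fourier (\<lambda>\<omega>. cnj (h \<omega>))) (\<lambda>x. cnj (truncate m g x)) =
      L2_inner (\<lambda>x. cnj (h x)) (\<lambda>x. cnj (fourier_integral (truncate m g) x))" for m
  proof (rule LIMSEQ_unique)
    show "(\<lambda>n. L2_inner (fourier_integral (truncate n (\<lambda>\<omega>. cnj (h \<omega>)))) (\<lambda>x. cnj (truncate m g x)))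
        \<longlonglongrightarrow> L2_inner (fourier (\<lambda>\<omega>. cnj (h \<omega>))) (\<lambda>x. cnj (truncate m g x))"
      by (intro L2_tendsto_inner fourier_tendsto hc L2_cnj truncate_L2 g)
    show "(\<lambda>n. L2_inner (fourier_integral (truncate n (\<lambda>\<omega>. cnj (h \<omega>)))) (\<lambda>x. cnj (truncate m g x)))
        \<longlonglongrightarrow> L2_inner (\<lambda>x. cnj (h x)) (\<lambda>x. cnj (fourier_integral (truncate m g) x))"
      unfolding trunc[OF h g]
      by (intro L2_tendsto_inner c L2_tendsto_truncation h L2_cnj fourier_integral_L2(1)
          integrable_truncate truncate_L2 g)
  qed
  have "L2_inner (fourier (\<lambda>\<omega>. cnj (h \<omega>))) (\<lambda>x. cnj (g x)) = L2_inner (\<lambda>x. cnj (h x)) (\<lambda>x. cnj (fourier g x))"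
  proof (rule LIMSEQ_unique)
    show "(\<lambda>m. L2_inner (fourier (\<lambda>\<omega>. cnj (h \<omega>))) (\<lambda>x. cnj (truncate m g x)))
        \<longlonglongrightarrow> L2_inner (fourier (\<lambda>\<omega>. cnj (h \<omega>))) (\<lambda>x. cnj (g x))"
      by (intro L2_inner_tendsto_left_const c L2_tendsto_truncation g fourier_L2 hc)
    show "(\<lambda>m. L2_inner (fourier (\<lambda>\<omega>. cnj (h \<omega>))) (\<lambda>x. cnj (truncate m g x)))
        \<longlonglongrightarrow> L2_inner (\<lambda>x. cnj (h x)) (\<lambda>x. cnj (fourier g x))"
      unfolding step by (intro L2_inner_tendsto_left_const c fourier_tendsto g hc)
  qed
  then have "cnj (L2_inner (fourier (\<lambda>\<omega>. cnj (h \<omega>))) (\<lambda>x. cnj (g x))) =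
      cnj (L2_inner (\<lambda>x. cnj (h x)) (\<lambda>x. cnj (fourier g x)))" by simp
  then show ?thesis
    by (simp add: L2_inner_def flip: Bochner_Integration.integral_cnj)
qed

lemma fourier_inversion:
  assumes f: "f \<in> L2"
  shows "AE x in lborel. cnj (fourier (\<lambda>\<omega>. cnj (fourier f \<omega>)) x) = of_real (2 * pi) * f x"
proof (rule L2_AE_eqI)
  show "(\<lambda>x. cnj (fourier (\<lambda>\<omega>. cnj (fourier f \<omega>)) x)) \<in> L2" by (intro L2_cnj fourier_L2 f)
  show "(\<lambda>x. of_real (2 * pi) * f x) \<in> L2" using f by (rule L2_scale)
  fix g assume g: "g \<in> L2"
  show "L2_inner (\<lambda>x. cnj (fourier (\<lambda>\<omega>. cnj (fourier f \<omega>)) x)) g = L2_inner (\<lambda>x. of_real (2 * pi) * f x) g"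
    unfolding fourier_adjoint[OF fourier_L2[OF f] g] L2_inner_scale_left by (rule Plancherel[OF f g])
qed

theorem fourier_surj:
  assumes h: "h \<in> L2"
  obtains f where "f \<in> L2" "AE \<omega> in lborel. fourier f \<omega> = h \<omega>"
proof
  let ?k = "\<lambda>x. cnj (fourier (\<lambda>\<omega>. cnj (h \<omega>)) x)"
  let ?f = "\<lambda>x. of_real (1 / (2 * pi)) * ?k x"
  have k: "?k \<in> L2" by (intro L2_cnj fourier_L2 h)
  show "?f \<in> L2" using k by (rule L2_scale)
  have "AE x in lborel. fourier ?f x = of_real (1 / (2 * pi)) * fourier ?k x"
    by (rule fourier_scale[OF k])
  then show "AE \<omega> in lborel. fourier ?f \<omega> = h \<omega>"
    using fourier_inversion[OF L2_cnj[OF h]]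
  proof eventually_elim
    case (elim x)
    from elim(2) have "cnj (cnj (fourier ?k x)) = cnj (of_real (2 * pi) * cnj (h x))" by (simp only:)
    then have "fourier ?k x = of_real (2 * pi) * h x" by simp
    with elim(1) show ?case by simp
  qed
qed

lemma
  assumes "h \<in> L2"
  shows fourier_inv_L2: "fourier_inv h \<in> L2"
    and fourier_fourier_inv: "AE \<omega> in lborel. fourier (fourier_inv h) \<omega> = h \<omega>"
proof -
  obtain f where "f \<in> L2" "AE \<omega> in lborel. fourier f \<omega> = h \<omega>"
    by (rule fourier_surj[OF assms])
  then have "\<exists>f. f \<in> L2 \<and> (AE \<omega> in lborel. fourier f \<omega> = h \<omega>)"
    by (intro exI conjI)
  from someI_ex[OF this] have "fourier_inv h \<in> L2 \<and> (AE \<omega> in lborel. fourier (fourier_inv h) \<omega> = h \<omega>)"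
    unfolding fourier_inv_def .
  then show "fourier_inv h \<in> L2" "AE \<omega> in lborel. fourier (fourier_inv h) \<omega> = h \<omega>" by simp_all
qed

subsection \<open>Dilations and translations\<close>

lemma L2_affine:
  assumes f: "f \<in> L2" and c: "c \<noteq> 0"
  shows "(\<lambda>x. f (t + c * x)) \<in> L2" "(L2_norm (\<lambda>x. f (t + c * x)))\<^sup>2 = (L2_norm f)\<^sup>2 / \<bar>c\<bar>"
proof -
  note [measurable] = L2_measurable[OF f]
  show "(\<lambda>x. f (t + c * x)) \<in> L2"
  proof (rule L2_I)
    show "(\<lambda>x. f (t + c * x)) \<in> borel_measurable borel" by measurable
    show "integrable lborel (\<lambda>x. (cmod (f (t + c * x)))\<^sup>2)"
      by (rule lborel_integrable_real_affine[OF L2_integrable[OF f] c])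
  qed
  show "(L2_norm (\<lambda>x. f (t + c * x)))\<^sup>2 = (L2_norm f)\<^sup>2 / \<bar>c\<bar>"
    using lborel_integral_real_affine[OF c, of "\<lambda>x. (cmod (f x))\<^sup>2" t] c
    by (simp add: L2_norm_sq field_simps)
qed

lemma L2_tendsto_affine:
  assumes F: "L2_tendsto F g" and c: "c \<noteq> 0"
  shows "L2_tendsto (\<lambda>n x. F n (t + c * x)) (\<lambda>x. g (t + c * x))"
  unfolding L2_tendsto_def
proof (intro conjI allI)
  note D = L2_tendstoD[OF F]
  show "(\<lambda>x. F n (t + c * x)) \<in> L2" for n
    by (rule L2_affine(1)[OF D(1)[of n] c, of t])
  show "(\<lambda>x. g (t + c * x)) \<in> L2"
    by (rule L2_affine(1)[OF D(2) c, of t])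
  have eq: "L2_norm (\<lambda>x. F n (t + c * x) - g (t + c * x)) = L2_norm (\<lambda>x. F n x - g x) / sqrt \<bar>c\<bar>" for n
  proof (rule power2_eq_imp_eq)
    show "(L2_norm (\<lambda>x. F n (t + c * x) - g (t + c * x)))\<^sup>2 = (L2_norm (\<lambda>x. F n x - g x) / sqrt \<bar>c\<bar>)\<^sup>2"
      unfolding L2_affine(2)[OF L2_diff[OF D(1)[of n] D(2)] c, of t] power_divide by simp
  qed simp_all
  show "(\<lambda>n. L2_norm (\<lambda>x. F n (t + c * x) - g (t + c * x))) \<longlonglongrightarrow> 0"
    unfolding eq using tendsto_divide[OF D(3) tendsto_const, of "sqrt \<bar>c\<bar>"] c by simp
qed

lemma L2_norm_mono:
  assumes f: "f \<in> borel_measurable borel" and g: "g \<in> L2" and "AE x in lborel. cmod (f x) \<le> C * cmod (g x)" and C: "C \<ge> 0"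
  shows "L2_norm f \<le> C * L2_norm g"
proof (rule power2_le_imp_le)
  have "(L2_norm f)\<^sup>2 \<le> (LINT x|lborel. C\<^sup>2 * (cmod (g x))\<^sup>2)"
    unfolding L2_norm_sq
  proof (rule integral_mono_AE)
    show "AE x in lborel. (cmod (f x))\<^sup>2 \<le> C\<^sup>2 * (cmod (g x))\<^sup>2"
      using assms(3) by eventually_elim (metis norm_ge_zero power_mono power_mult_distrib)
    show "integrable lborel (\<lambda>x. (cmod (f x))\<^sup>2)"
      by (rule L2_integrable[OF L2_bound[OF f g assms(3)]])
  qed (use L2_integrable[OF g] in simp)
  then show "(L2_norm f)\<^sup>2 \<le> (C * L2_norm g)\<^sup>2"
    by (simp add: L2_norm_sq power_mult_distrib)
qed (use C in simp)

lemma L2_mult_bounded: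
  assumes f: "f \<in> L2" and q: "q \<in> borel_measurable borel" and b: "\<And>x. cmod (q x) \<le> C"
  shows "(\<lambda>x. q x * f x) \<in> L2" "L2_norm (\<lambda>x. q x * f x) \<le> C * L2_norm f"
proof -
  note [measurable] = L2_measurable[OF f] q
  have le: "AE x in lborel. cmod (q x * f x) \<le> C * cmod (f x)"
    using b by (auto simp: norm_mult intro!: mult_right_mono)
  show "(\<lambda>x. q x * f x) \<in> L2" by (rule L2_bound[OF _ f le]) measurable
  have "C \<ge> 0" using b[of 0] norm_ge_zero order_trans by blast
  then show "L2_norm (\<lambda>x. q x * f x) \<le> C * L2_norm f" by (intro L2_norm_mono[OF _ f le]) auto
qed

lemma L2_tendsto_mult_bounded:
  assumes F: "L2_tendsto F g" and q: "q \<in> borel_measurable borel" "\<And>x. cmod (q x) \<le> C"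
  shows "L2_tendsto (\<lambda>n x. q x * F n x) (\<lambda>x. q x * g x)"
  unfolding L2_tendsto_def
proof (intro conjI allI)
  note D = L2_tendstoD[OF F]
  show "(\<lambda>x. q x * F n x) \<in> L2" "(\<lambda>x. q x * g x) \<in> L2" for n
    using L2_mult_bounded(1)[OF _ q] D by auto
  show "(\<lambda>n. L2_norm (\<lambda>x. q x * F n x - q x * g x)) \<longlonglongrightarrow> 0"
  proof (rule Lim_null_comparison)
    show "\<forall>\<^sub>F n in sequentially. norm (L2_norm (\<lambda>x. q x * F n x - q x * g x)) \<le> C * L2_norm (\<lambda>x. F n x - g x)"
      using L2_mult_bounded(2)[OF L2_diff[OF D(1) D(2)] q] by (simp add: right_diff_distrib)
    show "(\<lambda>n. C * L2_norm (\<lambda>x. F n x - g x)) \<longlonglongrightarrow> 0"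
      using tendsto_mult_left[OF D(3), of C] by simp
  qed
qed

lemma fourier_integral_affine:
  assumes c: "c > 0"
  shows "fourier_integral (\<lambda>x. f (t + c * x)) \<omega> =
    of_real (1 / c) * exp (\<i> * of_real (\<omega> * t / c)) * fourier_integral f (\<omega> / c)"
proof -
  have "fourier_integral (\<lambda>x. f (t + c * x)) \<omega> = \<bar>1 / c\<bar> *\<^sub>R (LINT x|lborel.
      f (t + c * (- t / c + (1 / c) * x)) * exp (- \<i> * of_real (\<omega> * (- t / c + (1 / c) * x))))"
    unfolding fourier_integral_def by (rule lborel_integral_real_affine) (use c in simp)
  also have "\<dots> = of_real (1 / c) * (LINT x|lborel. exp (\<i> * of_real (\<omega> * t / c)) *
      (f x * exp (- \<i> * of_real (\<omega> / c * x))))"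
  proof -
    have "f (t + c * (- t / c + (1 / c) * x)) * exp (- \<i> * of_real (\<omega> * (- t / c + (1 / c) * x))) =
        exp (\<i> * of_real (\<omega> * t / c)) * (f x * exp (- \<i> * of_real (\<omega> / c * x)))" for x
    proof -
      have "t + c * (- t / c + (1 / c) * x) = x" using c by (simp add: field_simps)
      moreover have "exp (- \<i> * of_real (\<omega> * (- t / c + (1 / c) * x))) =
          exp (\<i> * of_real (\<omega> * t / c)) * exp (- \<i> * of_real (\<omega> / c * x))"
        by (simp add: exp_add[symmetric] algebra_simps)
      ultimately show ?thesis by (simp only: mult_ac)
    qed
    then show ?thesis using c by (simp only: scaleR_conv_of_real) simp
  qed
  finally show ?thesis by (simp add: fourier_integral_def)
qed

text \<open>
  Truncation does not commute with dilation, so the formula passes to \<open>L\<^sup>2\<close> through the transforms of the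
  dilated truncations.
\<close>

lemma fourier_affine:
  assumes f: "f \<in> L2" and c: "c > 0"
  shows "AE \<omega> in lborel. fourier (\<lambda>x. f (t + c * x)) \<omega> =
    of_real (1 / c) * exp (\<i> * of_real (\<omega> * t / c)) * fourier f (\<omega> / c)"
proof -
  let ?q = "\<lambda>\<omega>. of_real (1 / c) * exp (\<i> * of_real (\<omega> * t / c))"
  let ?T = "\<lambda>n x. truncate n f (t + c * x)"
  have T: "?T n \<in> L2" "integrable lborel (?T n)" for n
    using L2_affine(1)[OF truncate_L2[OF f]] lborel_integrable_real_affine[OF integrable_truncate[OF f]] c by auto
  have *: "L2_tendsto (\<lambda>n \<omega>. ?q \<omega> * fourier_integral (truncate n f) (0 + (1 / c) * \<omega>))
      (\<lambda>\<omega>. ?q \<omega> * fourier f (0 + (1 / c) * \<omega>))"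
    using c by (intro L2_tendsto_mult_bounded[where C = "1 / c"] L2_tendsto_affine fourier_tendsto f)
      (auto simp: norm_mult norm_divide)
  have eq: "(\<lambda>\<omega>. ?q \<omega> * fourier_integral (truncate n f) (0 + (1 / c) * \<omega>)) = fourier_integral (?T n)" for n
    using fourier_integral_affine[OF c, of "truncate n f" t] by auto
  have "L2_tendsto (\<lambda>n. fourier_integral (?T n)) (\<lambda>\<omega>. ?q \<omega> * fourier f (0 + (1 / c) * \<omega>))"
    using * unfolding eq .
  moreover have "L2_tendsto (\<lambda>n. fourier_integral (?T n)) (fourier (\<lambda>x. f (t + c * x)))"
  proof -
    have lim: "L2_tendsto (\<lambda>n. fourier (?T n)) (fourier (\<lambda>x. f (t + c * x)))"
      using c by (intro L2_tendsto_fourier L2_tendsto_affine L2_tendsto_truncation f) auto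
    have "L2_norm (\<lambda>x. fourier (?T n) x - fourier (\<lambda>x. f (t + c * x)) x) =
        L2_norm (\<lambda>x. fourier_integral (?T n) x - fourier (\<lambda>x. f (t + c * x)) x)" for n
    proof (intro L2_norm_cong_AE L2_measurable L2_diff)
      show "AE x in lborel. fourier (?T n) x - fourier (\<lambda>x. f (t + c * x)) x =
          fourier_integral (?T n) x - fourier (\<lambda>x. f (t + c * x)) x"
        using fourier_eq_fourier_integral[OF T(2) T(1), of n] by eventually_elim simp
    qed (use T f c fourier_integral_L2(1) L2_tendstoD[OF lim] in auto)
    then show ?thesis
      using L2_tendstoD[OF lim] fourier_integral_L2(1)[OF T(2) T(1)] by (simp add: L2_tendsto_def)
  qed
  ultimately have "AE \<omega> in lborel. fourier (\<lambda>x. f (t + c * x)) \<omega> = ?q \<omega> * fourier f (0 + (1 / c) * \<omega>)"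
    by (intro L2_tendsto_unique)
  then show ?thesis by simp
qed

section \<open>Two-sided bounds for the Mittag-Leffler function\<close>

text \<open>
  The coefficient of \<open>z\<^sup>n\<close> in \<open>(1 - z)\<^sup>-\<^sup>a\<close>.
\<close>

definition bcoef :: "real \<Rightarrow> nat \<Rightarrow> real" where
  "bcoef a n = pochhammer a n / fact n"

definition bfps :: "real \<Rightarrow> real fps" where
  "bfps a = Abs_fps (bcoef a)"

lemma fps_nth_bfps [simp]: "fps_nth (bfps a) n = bcoef a n"
  by (simp add: bfps_def)

lemma bfps_mult: "bfps a * bfps b = bfps (a + b)"
proof (rule fps_ext)
  fix n
  have "bcoef (a + b) n = (\<Sum>k\<le>n. of_nat (n choose k) * pochhammer a k * pochhammer b (n - k) / fact n)"
    by (simp add: bcoef_def pochhammer_binomial_sum sum_divide_distrib)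
  also have "\<dots> = (\<Sum>k\<le>n. bcoef a k * bcoef b (n - k))"
    by (intro sum.cong) (auto simp: bcoef_def binomial_fact)
  finally show "fps_nth (bfps a * bfps b) n = fps_nth (bfps (a + b)) n"
    by (simp add: fps_mult_nth atLeast0AtMost)
qed

lemma bcoef_0 [simp]: "bcoef a 0 = 1"
  by (simp add: bcoef_def)

lemma bcoef_1 [simp]: "bcoef 1 n = 1"
  by (simp add: bcoef_def pochhammer_fact[symmetric])

lemma bfps_0: "bfps 0 = 1"
  by (rule fps_ext) (auto simp: bcoef_def pochhammer_0_left)

lemma bcoef_Suc: "bcoef a (Suc n) = bcoef a n * (a + n) / Suc n"
  by (simp add: bcoef_def pochhammer_Suc)

lemma bcoef_pos: "a > 0 \<Longrightarrow> bcoef a n > 0"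
  by (simp add: bcoef_def pochhammer_pos)

lemma bcoef_neg: "0 < a \<Longrightarrow> a < 1 \<Longrightarrow> n > 0 \<Longrightarrow> bcoef (- a) n < 0"
  by (cases n) (auto simp: bcoef_def pochhammer_rec pochhammer_pos divide_neg_pos mult_pos_pos)

lemma bcoef_mono: "0 < a \<Longrightarrow> a \<le> b \<Longrightarrow> bcoef a n \<le> bcoef b n"
  unfolding bcoef_def pochhammer_prod by (intro divide_right_mono prod_mono) auto

lemma sum_bcoef: "(\<Sum>k\<le>n. bcoef a k) = bcoef (a + 1) n"
  using arg_cong[OF bfps_mult[of a 1], of "\<lambda>f. fps_nth f n"] by (simp add: fps_mult_nth atLeast0AtMost)

text \<open>This is the Euler limit for the Gamma function.\<close>

lemma bcoef_tendsto:
  assumes "a > -1"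
  shows "(\<lambda>n. bcoef (a + 1) n / real n powr a) \<longlonglongrightarrow> 1 / Gamma (a + 1)"
proof -
  have "(\<lambda>n. inverse (Gamma_series' (a + 1) n)) \<longlonglongrightarrow> inverse (Gamma (a + 1))"
    using assms Gamma_real_pos[of "a + 1"] by (intro tendsto_inverse Gamma_series'_LIMSEQ) linarith
  moreover have "\<forall>\<^sub>F n in sequentially. 1 / Gamma_series' (a + 1) n = bcoef (a + 1) n / real n powr a"
    using eventually_gt_at_top[of 0]
  proof eventually_elim
    case (elim n)
    then have "fact n = real n * fact (n - 1)" by (simp add: fact_reduce)
    moreover have "exp ((a + 1) * ln (real n)) = real n * real n powr a"
      using elim by (simp add: powr_def exp_add algebra_simps)
    ultimately show ?case
      using elim by (simp add: Gamma_series'_def bcoef_def field_simps)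
  qed
  ultimately show ?thesis
    unfolding inverse_eq_divide by (rule Lim_transform_eventually)
qed

text \<open>
  The ratio of consecutive terms is \<open>(1 - t)\<^sup>a (1 + a t)\<close> with \<open>t = 1 / (n + 1)\<close>, and the two factors are at
  most \<open>e\<^sup>-\<^sup>a\<^sup>t\<close> and \<open>e\<^sup>a\<^sup>t\<close>.
\<close>

lemma bcoef_quotient_antimono:
  assumes a: "a \<ge> 0" and n: "n > 0"
  shows "bcoef (a + 1) (Suc n) / real (Suc n) powr a \<le> bcoef (a + 1) n / real n powr a"
proof -
  define t where "t = 1 / real (Suc n)"
  have t: "0 < t" "t < 1" using n by (auto simp: t_def)
  have nS: "real n = (1 - t) * real (Suc n)" by (simp add: t_def field_simps)
  have "(1 - t) powr a \<le> exp (- (a * t))"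
  proof -
    have "a * ln (1 - t) \<le> a * (- t)"
      using ln_le_minus_one[of "1 - t"] t a by (intro mult_left_mono) auto
    then show ?thesis using t by (simp add: powr_def)
  qed
  moreover have "1 + a * t \<le> exp (a * t)" by (rule exp_ge_add_one_self)
  ultimately have "(1 - t) powr a * (1 + a * t) \<le> exp (- (a * t)) * exp (a * t)"
    using a t by (intro mult_mono) auto
  then have le: "(1 - t) powr a * (1 + a * t) \<le> 1" by (simp add: exp_minus field_simps)
  have "bcoef (a + 1) (Suc n) = bcoef (a + 1) n * (1 + a * t)"
    by (simp add: bcoef_Suc t_def field_simps)
  moreover have pow: "real n powr a = (1 - t) powr a * real (Suc n) powr a"
    using t by (subst nS) (simp add: powr_mult)
  ultimately have "bcoef (a + 1) (Suc n) / real (Suc n) powr a =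
      bcoef (a + 1) n * ((1 - t) powr a * (1 + a * t)) / ((1 - t) powr a * real (Suc n) powr a)"
    using t by simp
  also have "\<dots> \<le> bcoef (a + 1) n * 1 / ((1 - t) powr a * real (Suc n) powr a)"
    using le bcoef_pos[of "a + 1" n] a by (intro divide_right_mono mult_left_mono) auto
  finally show ?thesis by (simp only: pow mult_1_right)
qed

lemma bcoef_quotient_mono:
  assumes "a \<ge> 0" "0 < m" "m \<le> n"
  shows "bcoef (a + 1) n / real n powr a \<le> bcoef (a + 1) m / real m powr a"
  using assms(3)
proof (induction n rule: dec_induct)
  case (step n)
  then show ?case using bcoef_quotient_antimono[of a n] assms by linarith
qed simp

text \<open>For fixed \<open>n\<close> the coefficient grows only polynomially in \<open>j\<close>.\<close>

lemma summable_bcoef: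
  assumes \<gamma>: "0 \<le> \<gamma>" "\<gamma> \<le> 1" and c: "0 \<le> c" "c < 1"
  shows "summable (\<lambda>j. c ^ j * bcoef (\<gamma> * real j + 1) n)"
proof -
  define d where "d = (1 + c) / 2"
  have d: "c < d" "d < 1" using c by (auto simp: d_def)
  obtain N :: nat where N: "c * n / (d - c) \<le> real N" using real_arch_simple by blast
  have "summable (\<lambda>j. c ^ j * bcoef (real j + 1) n)"
  proof (rule summable_ratio_test[OF d(2)])
    fix j assume j: "j \<ge> N"
    have "(real j + 1) * bcoef (real (Suc j) + 1) n = bcoef (real j + 1) n * (real j + 1 + n)"
      using pochhammer_rec[of "real j + 1" n] pochhammer_Suc[of "real j + 1" n]
      by (simp add: bcoef_def field_simps)
    then have eq: "bcoef (real (Suc j) + 1) n = bcoef (real j + 1) n * ((real j + 1 + n) / (real j + 1))"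
      by (simp add: field_simps)
    have "c * n \<le> (d - c) * N" using N d by (simp add: field_simps)
    also have "\<dots> \<le> (d - c) * (real j + 1)" using j d by (intro mult_left_mono) auto
    finally have le: "c * ((real j + 1 + n) / (real j + 1)) \<le> d" by (simp add: field_simps)
    have "c ^ Suc j * bcoef (real (Suc j) + 1) n =
        (c * ((real j + 1 + n) / (real j + 1))) * (c ^ j * bcoef (real j + 1) n)"
      by (simp only: eq power_Suc mult_ac)
    also have "\<dots> \<le> d * (c ^ j * bcoef (real j + 1) n)"
      using le c bcoef_pos[of "real j + 1" n] by (intro mult_right_mono) auto
    finally show "norm (c ^ Suc j * bcoef (real (Suc j) + 1) n) \<le> d * norm (c ^ j * bcoef (real j + 1) n)"
      using c bcoef_pos[of "real j + 1" n] bcoef_pos[of "real (Suc j) + 1" n] by (simp add: abs_mult)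
  qed
  then show ?thesis
  proof (rule summable_comparison_test'[where N = 0])
    fix j
    have "\<gamma> * real j \<le> 1 * real j" using \<gamma> by (intro mult_right_mono) auto
    then have "bcoef (\<gamma> * real j + 1) n \<le> bcoef (real j + 1) n"
      using \<gamma> by (intro bcoef_mono) (auto intro: add_nonneg_pos)
    moreover have "bcoef (\<gamma> * real j + 1) n > 0"
      using \<gamma> by (intro bcoef_pos) (auto intro: add_nonneg_pos)
    ultimately show "norm (c ^ j * bcoef (\<gamma> * real j + 1) n) \<le> c ^ j * bcoef (real j + 1) n"
      using c by (simp add: abs_mult mult_left_mono)
  qed
qed

text \<open>
  Coefficients of \<open>(1 - z)\<^sup>\<gamma>\<^sup>-\<^sup>1 / ((1 - z)\<^sup>\<gamma> + c)\<close>, expanded in powers of \<open>c\<close>. With \<open>c = x / n\<^sup>\<gamma>\<close> the \<open>n\<close>-th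
  coefficient is the value at time \<open>1\<close> of the convolution-quadrature discretization, with step \<open>1 / n\<close>, of
  the fractional relaxation equation solved by \<open>t \<mapsto> E\<^sub>\<gamma>(- x t\<^sup>\<gamma>)\<close>.
\<close>

definition relax :: "real \<Rightarrow> real \<Rightarrow> nat \<Rightarrow> real" where
  "relax \<gamma> c n = (\<Sum>j. (- c) ^ j * bcoef (\<gamma> * real j + 1) n)"

text \<open>
  Comparing coefficients expresses \<open>(1 + c) P\<^sub>n\<close> as a coefficient of the product minus the terms
  \<open>w\<^sub>n\<^sub>-\<^sub>i P\<^sub>i\<close> with \<open>i < n\<close>, which are nonpositive by induction.
\<close>

lemma fps_nonneg_of_mult:
  fixes P w :: "real fps"
  assumes w: "fps_nth w 0 = 1" "\<And>n. n > 0 \<Longrightarrow> fps_nth w n \<le> 0" and c: "c \<ge> 0"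
    and Q: "\<And>n. fps_nth (P * (w + fps_const c)) n \<ge> 0"
  shows "fps_nth P n \<ge> 0"
proof (induction n rule: less_induct)
  case (less n)
  have "fps_nth (P * (w + fps_const c)) n = (\<Sum>i=0..n. fps_nth P i * fps_nth w (n - i)) + c * fps_nth P n"
    by (simp add: distrib_left fps_mult_nth[of P w] mult.commute[of c])
  also have "(\<Sum>i=0..n. fps_nth P i * fps_nth w (n - i)) = fps_nth P n + (\<Sum>i<n. fps_nth P i * fps_nth w (n - i))"
    by (simp add: atLeast0AtMost lessThan_Suc_atMost[symmetric] w)
  finally have "fps_nth (P * (w + fps_const c)) n =
      (1 + c) * fps_nth P n + (\<Sum>i<n. fps_nth P i * fps_nth w (n - i))"
    by (simp add: algebra_simps)
  moreover have "(\<Sum>i<n. fps_nth P i * fps_nth w (n - i)) \<le> 0"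
    using less w by (intro sum_nonpos mult_nonneg_nonpos) auto
  ultimately have "0 \<le> (1 + c) * fps_nth P n" using Q[of n] by linarith
  then show ?case using c by (simp add: zero_le_mult_iff)
qed

text \<open>
  Let \<open>Y\<close> be the generating function and \<open>E = 1 - (1 - z) Y\<close>. The equations \<open>Y ((1 - z)\<^sup>\<gamma> + c) = (1 - z)\<^sup>\<gamma>\<^sup>-\<^sup>1\<close>
  and \<open>E ((1 - z)\<^sup>\<gamma> + c) = c\<close> show that \<open>E\<close> has nonnegative coefficients, so the sequence is decreasing.
  The upper bound follows from \<open>Y + c (1 - z)\<^sup>-\<^sup>\<gamma> Y = (1 - z)\<^sup>-\<^sup>1\<close> by replacing all values in the convolution
  by the last one. The lower bound follows from \<open>c Y = (1 - z)\<^sup>\<gamma>\<^sup>-\<^sup>1 E\<close>, because the coefficients of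
  \<open>(1 - z)\<^sup>\<gamma>\<^sup>-\<^sup>1\<close> decrease and those of \<open>E\<close> up to \<open>n\<close> add up to \<open>1\<close> minus the \<open>n\<close>-th value.
\<close>

lemma relax_bounds:
  assumes \<gamma>: "0 < \<gamma>" "\<gamma> < 1" and c: "0 \<le> c" "c < 1"
  shows "relax \<gamma> c n \<le> 1 / (1 + c * bcoef (\<gamma> + 1) n)"
    and "relax \<gamma> c n \<ge> 1 / (1 + c / bcoef (1 - \<gamma>) n)"
proof -
  define Y where "Y = Abs_fps (relax \<gamma> c)"
  have Y [simp]: "fps_nth Y n = relax \<gamma> c n" for n by (simp add: Y_def)
  have sum: "summable (\<lambda>j. (- c) ^ j * bcoef (\<gamma> * real j + 1) n)" for n
  proof (rule summable_norm_cancel)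
    have "norm ((- c) ^ j * bcoef (\<gamma> * real j + 1) n) = c ^ j * bcoef (\<gamma> * real j + 1) n" for j
    proof -
      have "bcoef (\<gamma> * real j + 1) n > 0" using \<gamma> by (intro bcoef_pos) (auto intro: add_nonneg_pos)
      then show ?thesis using c by (simp add: abs_mult power_abs)
    qed
    then show "summable (\<lambda>j. norm ((- c) ^ j * bcoef (\<gamma> * real j + 1) n))"
      using summable_bcoef[of \<gamma> c n] \<gamma> c by simp
  qed
  \<comment> \<open>The discrete Volterra equation: multiplication by \<open>(1 - z)\<^sup>-\<^sup>\<gamma>\<close> shifts the series in \<open>c\<close> by one index.\<close>
  have E1: "Y * (1 + fps_const c * bfps \<gamma>) = bfps 1"
  proof (rule fps_ext)
    fix n
    have "fps_nth (Y * bfps \<gamma>) n = (\<Sum>i\<le>n. (\<Sum>j. (- c) ^ j * bcoef (\<gamma> * real j + 1) i) * bcoef \<gamma> (n - i))"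
      by (simp add: fps_mult_nth atLeast0AtMost relax_def)
    also have "\<dots> = (\<Sum>i\<le>n. \<Sum>j. (- c) ^ j * bcoef (\<gamma> * real j + 1) i * bcoef \<gamma> (n - i))"
      by (simp only: suminf_mult2[OF sum])
    also have "\<dots> = (\<Sum>j. \<Sum>i\<le>n. (- c) ^ j * bcoef (\<gamma> * real j + 1) i * bcoef \<gamma> (n - i))"
      by (intro suminf_sum[symmetric] summable_mult2 sum)
    also have "\<dots> = (\<Sum>j. (- c) ^ j * bcoef (\<gamma> * real (Suc j) + 1) n)"
    proof (rule arg_cong[where f = suminf], rule ext)
      fix j
      have "(\<Sum>i\<le>n. bcoef (\<gamma> * real j + 1) i * bcoef \<gamma> (n - i)) = bcoef (\<gamma> * real j + 1 + \<gamma>) n"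
        using arg_cong[OF bfps_mult[of "\<gamma> * real j + 1" \<gamma>], of "\<lambda>f. fps_nth f n"]
        by (simp add: fps_mult_nth atLeast0AtMost)
      then show "(\<Sum>i\<le>n. (- c) ^ j * bcoef (\<gamma> * real j + 1) i * bcoef \<gamma> (n - i)) =
          (- c) ^ j * bcoef (\<gamma> * real (Suc j) + 1) n"
        by (simp add: mult.assoc sum_distrib_left[symmetric] algebra_simps)
    qed
    finally have conv: "fps_nth (Y * bfps \<gamma>) n = (\<Sum>j. (- c) ^ j * bcoef (\<gamma> * real (Suc j) + 1) n)" .
    have "c * (\<Sum>j. (- c) ^ j * bcoef (\<gamma> * real (Suc j) + 1) n) =
        - (\<Sum>j. (- c) ^ Suc j * bcoef (\<gamma> * real (Suc j) + 1) n)"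
    proof (cases "c = 0")
      case False
      have "summable (\<lambda>j. (- c) ^ Suc j * bcoef (\<gamma> * real (Suc j) + 1) n)"
        using sum[of n] by (subst summable_Suc_iff)
      then have "summable (\<lambda>j. (- c) * ((- c) ^ j * bcoef (\<gamma> * real (Suc j) + 1) n))"
        by (simp only: power_Suc mult.assoc)
      then have "summable (\<lambda>j. (- c) ^ j * bcoef (\<gamma> * real (Suc j) + 1) n)"
        using False by (simp only: summable_cmult_iff) simp
      from suminf_mult[OF this, of "- c"] show ?thesis by (simp add: mult.assoc)
    qed simp
    also have "(\<Sum>j. (- c) ^ Suc j * bcoef (\<gamma> * real (Suc j) + 1) n) = relax \<gamma> c n - 1"
      unfolding relax_def using suminf_split_head[OF sum[of n]] by simp
    finally show "fps_nth (Y * (1 + fps_const c * bfps \<gamma>)) n = fps_nth (bfps 1) n"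
      by (simp add: ring_distribs conv mult.left_commute[of Y])
  qed
  let ?w = "bfps (- \<gamma>)"
  have w: "fps_nth ?w 0 = 1" "\<And>n. n > 0 \<Longrightarrow> fps_nth ?w n \<le> 0"
    using bcoef_neg[OF \<gamma>] by (auto intro: less_imp_le)
  have wA: "?w * bfps \<gamma> = 1" by (simp add: bfps_mult bfps_0)
  have E2: "Y * (?w + fps_const c) = bfps (1 - \<gamma>)"
  proof -
    have "Y * (?w + fps_const c) = Y * (?w + fps_const c * (?w * bfps \<gamma>))" by (simp add: wA)
    also have "\<dots> = ?w * (Y * (1 + fps_const c * bfps \<gamma>))" by (simp add: algebra_simps)
    also have "\<dots> = bfps (1 - \<gamma>)" by (simp add: E1 bfps_mult)
    finally show ?thesis .
  qed
  \<comment> \<open>\<open>E\<close> collects the decrements of the sequence, starting from the value \<open>1\<close>.\<close>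
  define E where "E = 1 - bfps (- 1) * Y"
  have EB: "bfps (1 - \<gamma>) * E = fps_const c * Y"
  proof -
    have "bfps (1 - \<gamma>) * E = bfps (1 - \<gamma>) - (bfps (1 - \<gamma>) * bfps (- 1)) * Y"
      by (simp add: E_def algebra_simps)
    also have "bfps (1 - \<gamma>) * bfps (- 1) = ?w" by (simp add: bfps_mult)
    also have "bfps (1 - \<gamma>) - ?w * Y = fps_const c * Y" by (simp add: E2[symmetric] algebra_simps)
    finally show ?thesis .
  qed
  have E_eq: "E * (?w + fps_const c) = fps_const c"
  proof -
    have "E * (?w + fps_const c) = ?w + fps_const c - bfps (- 1) * (Y * (?w + fps_const c))"
      by (simp add: E_def algebra_simps)
    also have "bfps (- 1) * (Y * (?w + fps_const c)) = ?w" by (simp add: E2 bfps_mult)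
    finally show ?thesis by simp
  qed
  have E_nonneg: "fps_nth E n \<ge> 0" for n
    by (rule fps_nonneg_of_mult[OF w]) (use c in \<open>auto simp: E_eq\<close>)
  have E_sum: "(\<Sum>k\<le>n. fps_nth E k) = 1 - relax \<gamma> c n" for n
  proof -
    have "E * bfps 1 = bfps 1 - (bfps (- 1) * bfps 1) * Y" by (simp add: E_def algebra_simps)
    also have "bfps (- 1) * bfps 1 = 1" by (simp add: bfps_mult bfps_0)
    finally have "fps_nth (E * bfps 1) n = fps_nth (bfps 1 - 1 * Y) n" by simp
    then show ?thesis by (simp add: fps_mult_nth atLeast0AtMost)
  qed
  have anti: "relax \<gamma> c n \<le> relax \<gamma> c m" if "m \<le> n" for m n
  proof -
    have "(\<Sum>k\<le>m. fps_nth E k) \<le> (\<Sum>k\<le>n. fps_nth E k)"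
      using that E_nonneg by (intro sum_mono2) auto
    then show ?thesis by (simp add: E_sum)
  qed
  show "relax \<gamma> c n \<le> 1 / (1 + c * bcoef (\<gamma> + 1) n)"
  proof -
    have "fps_nth (Y * (1 + fps_const c * bfps \<gamma>)) n = relax \<gamma> c n + c * (\<Sum>i\<le>n. relax \<gamma> c i * bcoef \<gamma> (n - i))"
      by (simp add: ring_distribs mult.left_commute[of Y] fps_mult_nth[of Y] atLeast0AtMost)
    then have "1 = relax \<gamma> c n + c * (\<Sum>i\<le>n. relax \<gamma> c i * bcoef \<gamma> (n - i))"
      unfolding E1 by simp
    moreover have "(\<Sum>i\<le>n. relax \<gamma> c n * bcoef \<gamma> (n - i)) \<le> (\<Sum>i\<le>n. relax \<gamma> c i * bcoef \<gamma> (n - i))"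
      using anti \<gamma> bcoef_pos[of \<gamma>] by (intro sum_mono mult_right_mono) (auto intro: less_imp_le)
    moreover have "(\<Sum>i\<le>n. relax \<gamma> c n * bcoef \<gamma> (n - i)) = relax \<gamma> c n * bcoef (\<gamma> + 1) n"
    proof -
      have "(\<Sum>i\<le>n. bcoef \<gamma> (n - i)) = (\<Sum>i\<le>n. bcoef \<gamma> i)"
        by (rule sum.reindex_bij_witness[of _ "\<lambda>i. n - i" "\<lambda>i. n - i"]) auto
      then show ?thesis by (simp add: sum_distrib_left[symmetric] sum_bcoef)
    qed
    ultimately have "relax \<gamma> c n + c * (relax \<gamma> c n * bcoef (\<gamma> + 1) n) \<le> 1"
      using c mult_left_mono[of _ _ c] by fastforce
    then have "relax \<gamma> c n * (1 + c * bcoef (\<gamma> + 1) n) \<le> 1" by (simp add: algebra_simps)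
    moreover have "1 + c * bcoef (\<gamma> + 1) n > 0"
      using c \<gamma> bcoef_pos[of "\<gamma> + 1" n] by (intro add_pos_nonneg) auto
    ultimately show ?thesis by (simp add: field_simps)
  qed
  show "relax \<gamma> c n \<ge> 1 / (1 + c / bcoef (1 - \<gamma>) n)"
  proof -
    let ?b = "bcoef (1 - \<gamma>)"
    have b_pos: "?b n > 0" for n using \<gamma> by (intro bcoef_pos) simp
    have b_anti: "?b n \<le> ?b i" if "i \<le> n" for i n
    proof -
      have "(\<Sum>k\<le>n. bcoef (- \<gamma>) k) = (\<Sum>k\<le>i. bcoef (- \<gamma>) k) + (\<Sum>k\<in>{i<..n}. bcoef (- \<gamma>) k)"
        using that by (subst sum.union_disjoint[symmetric]) (auto intro!: sum.cong)
      moreover have "(\<Sum>k\<in>{i<..n}. bcoef (- \<gamma>) k) \<le> 0"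
        using bcoef_neg[OF \<gamma>] by (intro sum_nonpos) (auto intro: less_imp_le)
      ultimately show ?thesis using sum_bcoef[of "- \<gamma>"] by (simp add: add.commute)
    qed
    have "?b n * (1 - relax \<gamma> c n) = (\<Sum>i\<le>n. ?b n * fps_nth E (n - i))"
    proof -
      have "(\<Sum>i\<le>n. fps_nth E (n - i)) = (\<Sum>i\<le>n. fps_nth E i)"
        by (rule sum.reindex_bij_witness[of _ "\<lambda>i. n - i" "\<lambda>i. n - i"]) auto
      then show ?thesis by (simp add: sum_distrib_left[symmetric] E_sum)
    qed
    also have "\<dots> \<le> (\<Sum>i\<le>n. ?b i * fps_nth E (n - i))"
      using b_anti E_nonneg by (intro sum_mono mult_right_mono) auto
    also have "\<dots> = c * relax \<gamma> c n"
      using arg_cong[OF EB, of "\<lambda>f. fps_nth f n"] by (simp add: fps_mult_nth[of "bfps _"] atLeast0AtMost)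
    finally have "?b n \<le> relax \<gamma> c n * (?b n + c)" by (simp add: algebra_simps)
    moreover have "1 + c / ?b n = (?b n + c) / ?b n" using b_pos[of n] by (simp add: field_simps)
    moreover have "?b n + c > 0" using b_pos[of n] c by simp
    ultimately show ?thesis using b_pos[of n] by (simp add: field_simps)
  qed
qed

lemma eventually_powr_gt:
  assumes "\<gamma> > 0" "x \<ge> 0"
  shows "\<forall>\<^sub>F n in sequentially. real n powr \<gamma> > x"
proof -
  obtain N :: nat where N: "(x + 1) powr (1 / \<gamma>) \<le> real N" using real_arch_simple by blast
  have "real n powr \<gamma> > x" if "n \<ge> N" for n
  proof -
    have "x < ((x + 1) powr (1 / \<gamma>)) powr \<gamma>" using assms by (simp add: powr_powr)
    also have "\<dots> \<le> real n powr \<gamma>" using N that assms by (intro powr_mono2) auto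
    finally show ?thesis .
  qed
  then show ?thesis by (rule eventually_sequentiallyI)
qed

text \<open>
  Termwise the series converge to the Mittag-Leffler series. The quotients decrease in \<open>n\<close>, so the
  series for one fixed \<open>m\<close> with \<open>x < m\<^sup>\<gamma>\<close> dominates all later ones, and Tannery's theorem applies.
\<close>

lemma relax_tendsto:
  assumes \<gamma>: "0 < \<gamma>" "\<gamma> < 1" and x: "x \<ge> 0"
  shows "(\<lambda>n. relax \<gamma> (x / real n powr \<gamma>) n) \<longlonglongrightarrow> mittag_leffler \<gamma> 1 (- x)"
proof -
  obtain m where m: "real m powr \<gamma> > x" "m > 0"
    using eventually_happens'[OF sequentially_bot
        eventually_conj[OF eventually_powr_gt[OF \<gamma>(1) x] eventually_gt_at_top[of 0]]] by auto
  define a where "a j n = (- x) ^ j * (bcoef (\<gamma> * real j + 1) n / real n powr (\<gamma> * real j))" for j n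
  define M where "M j = (x / real m powr \<gamma>) ^ j * bcoef (\<gamma> * real j + 1) m" for j
  have "(\<lambda>n. \<Sum>j. a j n) \<longlonglongrightarrow> (\<Sum>j. (- x) ^ j * (1 / Gamma (\<gamma> * real j + 1)))"
  proof (intro conjunct2[OF conjunct2[OF tannerys_theorem[where M = M]]])
    show "(\<lambda>n. a j n) \<longlonglongrightarrow> (- x) ^ j * (1 / Gamma (\<gamma> * real j + 1))" for j
      unfolding a_def using \<gamma> by (intro tendsto_mult_left bcoef_tendsto) (auto intro: less_le_trans[of _ 0])
    have "norm (a j n) \<le> M j" if "n \<ge> m" for j n
    proof -
      have pos: "bcoef (\<gamma> * real j + 1) k > 0" for k
        using \<gamma> by (intro bcoef_pos) (auto intro: add_nonneg_pos)
      have "norm (a j n) = x ^ j * (bcoef (\<gamma> * real j + 1) n / real n powr (\<gamma> * real j))"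
        using x pos[of n] by (simp add: a_def abs_mult power_abs)
      also have "\<dots> \<le> x ^ j * (bcoef (\<gamma> * real j + 1) m / real m powr (\<gamma> * real j))"
        using x \<gamma> m that by (intro mult_left_mono bcoef_quotient_mono) auto
      also have "\<dots> = M j"
        using m by (simp add: M_def power_divide powr_powr[symmetric] powr_realpow)
      finally show ?thesis .
    qed
    then show "\<forall>\<^sub>F (j, n) in at_top \<times>\<^sub>F sequentially. norm (a j n) \<le> M j"
      unfolding eventually_prod_sequentially case_prod_conv
      by (intro exI[of _ m]) auto
    show "summable M"
      unfolding M_def using m x \<gamma> by (intro summable_bcoef) auto
  qed simp
  moreover have "\<forall>\<^sub>F n in sequentially. (\<Sum>j. a j n) = relax \<gamma> (x / real n powr \<gamma>) n"
    using eventually_gt_at_top[of 0]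
  proof eventually_elim
    case (elim n)
    have "a j n = (- (x / real n powr \<gamma>)) ^ j * bcoef (\<gamma> * real j + 1) n" for j
    proof -
      have "(- (x / real n powr \<gamma>)) ^ j = (- x) ^ j / real n powr (\<gamma> * real j)"
        using elim by (simp add: powr_powr[symmetric] powr_realpow flip: power_divide)
      then show ?thesis by (simp add: a_def)
    qed
    then show ?case by (simp add: relax_def)
  qed
  ultimately have "(\<lambda>n. relax \<gamma> (x / real n powr \<gamma>) n) \<longlonglongrightarrow> (\<Sum>j. (- x) ^ j * (1 / Gamma (\<gamma> * real j + 1)))"
    by (rule Lim_transform_eventually)
  then show ?thesis by (simp add: mittag_leffler_def)
qed

theorem mittag_leffler_bounds:
  assumes \<gamma>: "0 < \<gamma>" "\<gamma> < 1" and x: "x \<ge> 0"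
  shows "mittag_leffler \<gamma> 1 (- x) \<le> 1 / (1 + x / Gamma (\<gamma> + 1))"
    and "mittag_leffler \<gamma> 1 (- x) \<ge> 1 / (1 + x * Gamma (1 - \<gamma>))"
proof -
  let ?c = "\<lambda>n. x / real n powr \<gamma>"
  have G: "Gamma (\<gamma> + 1) > 0" "Gamma (1 - \<gamma>) > 0"
    using \<gamma> by (auto intro: Gamma_real_pos)
  have small: "\<forall>\<^sub>F n in sequentially. 0 \<le> ?c n \<and> ?c n < 1"
    using eventually_powr_gt[OF \<gamma>(1) x] eventually_gt_at_top[of 0] by eventually_elim (use x in auto)
  show "mittag_leffler \<gamma> 1 (- x) \<le> 1 / (1 + x / Gamma (\<gamma> + 1))"
  proof (rule tendsto_le[OF sequentially_bot _ relax_tendsto[OF \<gamma> x]])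
    have "(\<lambda>n. 1 / (1 + x * (bcoef (\<gamma> + 1) n / real n powr \<gamma>))) \<longlonglongrightarrow> 1 / (1 + x * (1 / Gamma (\<gamma> + 1)))"
      using x G \<gamma> by (intro tendsto_intros bcoef_tendsto) (auto simp: add_nonneg_eq_0_iff)
    then show "(\<lambda>n. 1 / (1 + x * (bcoef (\<gamma> + 1) n / real n powr \<gamma>))) \<longlonglongrightarrow> 1 / (1 + x / Gamma (\<gamma> + 1))"
      by simp
    show "\<forall>\<^sub>F n in sequentially. relax \<gamma> (?c n) n \<le> 1 / (1 + x * (bcoef (\<gamma> + 1) n / real n powr \<gamma>))"
      using small
    proof eventually_elim
      case (elim n)
      then show ?case using relax_bounds(1)[OF \<gamma>, of "?c n" n] by simp
    qed
  qed
  show "mittag_leffler \<gamma> 1 (- x) \<ge> 1 / (1 + x * Gamma (1 - \<gamma>))"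
  proof (rule tendsto_le[OF sequentially_bot relax_tendsto[OF \<gamma> x]])
    have lim: "(\<lambda>n. bcoef (- \<gamma> + 1) n / real n powr (- \<gamma>)) \<longlonglongrightarrow> 1 / Gamma (- \<gamma> + 1)"
      using \<gamma> by (intro bcoef_tendsto) simp
    have G': "Gamma (- \<gamma> + 1) > 0" using G by (simp add: add.commute[of "- \<gamma>"])
    then have "1 + x / (1 / Gamma (- \<gamma> + 1)) > 0"
      using x by (intro add_pos_nonneg) auto
    then have "(\<lambda>n. 1 / (1 + x / (bcoef (- \<gamma> + 1) n / real n powr (- \<gamma>)))) \<longlonglongrightarrow>
        1 / (1 + x / (1 / Gamma (- \<gamma> + 1)))"
      using G' by (intro tendsto_divide tendsto_add tendsto_const lim) auto
    then show "(\<lambda>n. 1 / (1 + x / (bcoef (- \<gamma> + 1) n / real n powr (- \<gamma>)))) \<longlonglongrightarrow> 1 / (1 + x * Gamma (1 - \<gamma>))"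
      by (simp add: add.commute[of "- \<gamma>"])
    show "\<forall>\<^sub>F n in sequentially. 1 / (1 + x / (bcoef (- \<gamma> + 1) n / real n powr (- \<gamma>))) \<le> relax \<gamma> (?c n) n"
      using small
    proof eventually_elim
      case (elim n)
      then show ?case using relax_bounds(2)[OF \<gamma>, of "?c n" n] 
        by (simp add: powr_minus field_simps add.commute[of "- \<gamma>"])
    qed
  qed
qed

section \<open>Orthonormal bases\<close>

lemma L2_norm_diff_sq:
  assumes f: "f \<in> L2" and g: "g \<in> L2"
  shows "complex_of_real ((L2_norm (\<lambda>x. f x - g x))\<^sup>2) =
    L2_inner f f - L2_inner f g - L2_inner g f + L2_inner g g"
  unfolding L2_inner_self[symmetric]
  using f g by (simp add: L2_inner_diff_left L2_inner_diff_right L2_diff)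

definition L2_orthonormal :: "('i \<Rightarrow> real \<Rightarrow> complex) \<Rightarrow> bool" where
  "L2_orthonormal e \<longleftrightarrow> (\<forall>l. e l \<in> L2) \<and> (\<forall>l m. L2_inner (e l) (e m) = (if l = m then 1 else 0))"

lemma L2_orthonormalD:
  assumes "L2_orthonormal e"
  shows "e l \<in> L2" "L2_inner (e l) (e m) = (if l = m then 1 else 0)"
  using assms by (auto simp: L2_orthonormal_def)

lemma L2_inner_orthonormal_sum:
  assumes e: "L2_orthonormal e" and S: "finite S"
  shows "L2_inner (\<lambda>x. \<Sum>l\<in>S. c l * e l x) (e m) = (if m \<in> S then c m else 0)"
proof -
  note D = L2_orthonormalD[OF e]
  have "L2_inner (\<lambda>x. \<Sum>l\<in>S. c l * e l x) (e m) = (\<Sum>l\<in>S. c l * L2_inner (e l) (e m))"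
    by (subst L2_inner_sum_left) (auto intro: L2_scale D simp: L2_inner_scale_left)
  also have "\<dots> = (\<Sum>l\<in>S. if l = m then c l else 0)"
    by (intro sum.cong) (auto simp: D(2))
  finally show ?thesis using S by simp
qed

text \<open>Pythagoras: the coefficients \<open>\<langle>f, e\<^sub>l\<rangle>\<close> are optimal, with an explicit loss for all others.\<close>

lemma L2_orthonormal_approx:
  assumes e: "L2_orthonormal e" and f: "f \<in> L2" and S: "finite S"
  shows "(L2_norm (\<lambda>x. f x - (\<Sum>l\<in>S. c l * e l x)))\<^sup>2 =
    (L2_norm f)\<^sup>2 - (\<Sum>l\<in>S. (cmod (L2_inner f (e l)))\<^sup>2) + (\<Sum>l\<in>S. (cmod (c l - L2_inner f (e l)))\<^sup>2)"
proof -
  note D = L2_orthonormalD[OF e]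
  let ?s = "\<lambda>x. \<Sum>l\<in>S. c l * e l x"
  let ?a = "\<lambda>l. L2_inner f (e l)"
  have s: "?s \<in> L2" by (intro L2_sum L2_scale D)
  have sf: "L2_inner ?s f = (\<Sum>l\<in>S. c l * cnj (?a l))"
    by (subst L2_inner_sum_left)
       (auto intro: L2_scale D f simp: L2_inner_scale_left L2_inner_commute[of "e _" f])
  have ss: "L2_inner ?s ?s = (\<Sum>l\<in>S. c l * cnj (c l))"
  proof -
    have "L2_inner ?s ?s = (\<Sum>l\<in>S. c l * L2_inner (e l) ?s)"
      by (subst L2_inner_sum_left) (auto intro: L2_scale D s simp: L2_inner_scale_left)
    also have "\<dots> = (\<Sum>l\<in>S. c l * cnj (c l))"
      by (intro sum.cong refl) (simp add: L2_inner_commute[of "e _" ?s] L2_inner_orthonormal_sum[OF e S])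
    finally show ?thesis .
  qed
  have fs: "L2_inner f ?s = (\<Sum>l\<in>S. cnj (c l) * ?a l)"
    unfolding L2_inner_commute[of f ?s] sf by simp
  have "complex_of_real ((L2_norm (\<lambda>x. f x - ?s x))\<^sup>2) =
      complex_of_real ((L2_norm f)\<^sup>2) + (\<Sum>l\<in>S. c l * cnj (c l) - cnj (c l) * ?a l - c l * cnj (?a l))"
    unfolding L2_norm_diff_sq[OF f s] sf ss fs L2_inner_self[of f]
    by (simp add: sum_subtractf)
  also have "(\<Sum>l\<in>S. c l * cnj (c l) - cnj (c l) * ?a l - c l * cnj (?a l)) =
      (\<Sum>l\<in>S. complex_of_real ((cmod (c l - ?a l))\<^sup>2 - (cmod (?a l))\<^sup>2))"
    by (intro sum.cong refl) (simp add: complex_norm_square algebra_simps del: of_real_power)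
  finally have "complex_of_real ((L2_norm (\<lambda>x. f x - ?s x))\<^sup>2) =
      complex_of_real ((L2_norm f)\<^sup>2 + (\<Sum>l\<in>S. (cmod (c l - ?a l))\<^sup>2 - (cmod (?a l))\<^sup>2))"
    by simp
  then show ?thesis by (simp only: of_real_eq_iff sum_subtractf)
qed

lemma L2_Bessel:
  assumes e: "L2_orthonormal e" and f: "f \<in> L2" and S: "finite S"
  shows "(\<Sum>l\<in>S. (cmod (L2_inner f (e l)))\<^sup>2) \<le> (L2_norm f)\<^sup>2"
  using L2_orthonormal_approx[OF e f S, of "\<lambda>l. L2_inner f (e l)"]
    zero_le_power2[of "L2_norm (\<lambda>x. f x - (\<Sum>l\<in>S. L2_inner f (e l) * e l x))"] by simp

lemma L2_orthonormal_basisD: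
  assumes "L2_orthonormal_basis e"
  shows "L2_orthonormal e"
  using assms by (auto simp: L2_orthonormal_basis_def L2_orthonormal_def)

lemma L2_orthonormal_basis_approx:
  assumes e: "L2_orthonormal_basis e" and f: "f \<in> L2" and \<epsilon>: "\<epsilon> > 0"
  obtains S where "finite S" "L2_norm (\<lambda>x. f x - (\<Sum>l\<in>S. L2_inner f (e l) * e l x)) < \<epsilon>"
proof -
  note on = L2_orthonormal_basisD[OF e]
  have "f \<in> L2_closure {f. \<exists>S c. finite S \<and> f = (\<lambda>x. \<Sum>l\<in>S. c l * e l x)}"
    using e f by (simp add: L2_orthonormal_basis_def)
  then obtain S c where S: "finite S" and lt: "L2_norm (\<lambda>x. f x - (\<Sum>l\<in>S. c l * e l x)) < \<epsilon>"
    using \<epsilon> unfolding L2_closure_def by blast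
  have "(L2_norm (\<lambda>x. f x - (\<Sum>l\<in>S. L2_inner f (e l) * e l x)))\<^sup>2 \<le>
      (L2_norm (\<lambda>x. f x - (\<Sum>l\<in>S. c l * e l x)))\<^sup>2"
    unfolding L2_orthonormal_approx[OF on f S] by (simp add: sum_nonneg)
  then have "L2_norm (\<lambda>x. f x - (\<Sum>l\<in>S. L2_inner f (e l) * e l x)) \<le>
      L2_norm (\<lambda>x. f x - (\<Sum>l\<in>S. c l * e l x))"
    by (rule power2_le_imp_le) simp
  with lt S show ?thesis by (intro that) auto
qed

text \<open>
  Families of nonnegative numbers enter only through upper bounds on their finite partial sums, which
  decide both summability and the size of the sum.
\<close>

lemma nonneg_infsum_le:
  fixes f :: "'i \<Rightarrow> real"
  assumes nn: "\<And>l. f l \<ge> 0" and le: "\<And>S. finite S \<Longrightarrow> sum f S \<le> B"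
  shows "f summable_on UNIV" "(\<Sum>\<^sub>\<infinity>l. f l) \<le> B"
proof -
  show s: "f summable_on UNIV"
    by (rule nonneg_bdd_above_summable_on) (use nn le in \<open>auto intro!: bdd_aboveI\<close>)
  show "(\<Sum>\<^sub>\<infinity>l. f l) \<le> B"
    by (rule infsum_le_finite_sums[OF s]) (use le in auto)
qed

lemma L2_Parseval:
  assumes e: "L2_orthonormal_basis e" and f: "f \<in> L2"
  shows "(\<lambda>l. (cmod (L2_inner f (e l)))\<^sup>2) summable_on UNIV"
    "(\<Sum>\<^sub>\<infinity>l. (cmod (L2_inner f (e l)))\<^sup>2) = (L2_norm f)\<^sup>2"
proof -
  note on = L2_orthonormal_basisD[OF e]
  let ?a = "\<lambda>l. (cmod (L2_inner f (e l)))\<^sup>2"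
  show s: "?a summable_on UNIV"
    by (rule nonneg_infsum_le(1)) (use L2_Bessel[OF on f] in auto)
  show "(\<Sum>\<^sub>\<infinity>l. ?a l) = (L2_norm f)\<^sup>2"
  proof (rule antisym)
    show "(\<Sum>\<^sub>\<infinity>l. ?a l) \<le> (L2_norm f)\<^sup>2"
      by (rule nonneg_infsum_le(2)) (use L2_Bessel[OF on f] in auto)
    show "(L2_norm f)\<^sup>2 \<le> (\<Sum>\<^sub>\<infinity>l. ?a l)"
    proof (rule field_le_epsilon)
      fix \<epsilon> :: real assume "\<epsilon> > 0"
      then obtain S where S: "finite S" "L2_norm (\<lambda>x. f x - (\<Sum>l\<in>S. L2_inner f (e l) * e l x)) < sqrt \<epsilon>"
        using L2_orthonormal_basis_approx[OF e f, of "sqrt \<epsilon>"] by auto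
      then have "(L2_norm (\<lambda>x. f x - (\<Sum>l\<in>S. L2_inner f (e l) * e l x)))\<^sup>2 \<le> (sqrt \<epsilon>)\<^sup>2"
        by (intro power_mono) auto
      then have "(L2_norm f)\<^sup>2 - sum ?a S \<le> \<epsilon>"
        using L2_orthonormal_approx[OF on f S(1), of "\<lambda>l. L2_inner f (e l)"] \<open>\<epsilon> > 0\<close> by simp
      moreover have "sum ?a S \<le> (\<Sum>\<^sub>\<infinity>l. ?a l)"
        by (rule finite_sum_le_infsum[OF s S(1)]) auto
      ultimately show "(L2_norm f)\<^sup>2 \<le> (\<Sum>\<^sub>\<infinity>l. ?a l) + \<epsilon>" by linarith
    qed
  qed
qed

text \<open>Parseval's identity for \<open>\<langle>x, y\<rangle>\<close> followed by a Cauchy-Schwarz inequality with weights \<open>t\<^sub>l\<close>.\<close>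

lemma L2_inner_weighted_bound:
  assumes e: "L2_orthonormal_basis e" and x: "x \<in> L2" and y: "y \<in> L2" and t: "\<And>l. t l > (0::real)"
    and A: "\<And>S. finite S \<Longrightarrow> (\<Sum>l\<in>S. (t l * cmod (L2_inner x (e l)))\<^sup>2) \<le> A"
    and B: "\<And>S. finite S \<Longrightarrow> (\<Sum>l\<in>S. (cmod (L2_inner y (e l)) / t l)\<^sup>2) \<le> B"
  shows "cmod (L2_inner x y) \<le> sqrt A * sqrt B"
proof (rule field_le_epsilon)
  note on = L2_orthonormal_basisD[OF e]
  note D = L2_orthonormalD[OF on]
  fix \<epsilon> :: real assume \<epsilon>: "\<epsilon> > 0"
  define \<eta> where "\<eta> = \<epsilon> / (L2_norm y + 1)"
  have n1: "L2_norm y + 1 > 0" by (simp add: add_nonneg_pos)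
  have \<eta>: "\<eta> > 0" using \<epsilon> n1 by (simp add: \<eta>_def)
  obtain S where S: "finite S" "L2_norm (\<lambda>z. x z - (\<Sum>l\<in>S. L2_inner x (e l) * e l z)) < \<eta>"
    by (rule L2_orthonormal_basis_approx[OF e x \<eta>])
  let ?s = "\<lambda>z. \<Sum>l\<in>S. L2_inner x (e l) * e l z"
  have s: "?s \<in> L2" by (intro L2_sum L2_scale D)
  have "L2_inner ?s y = (\<Sum>l\<in>S. L2_inner x (e l) * cnj (L2_inner y (e l)))"
    by (subst L2_inner_sum_left)
       (auto intro: L2_scale D y simp: L2_inner_scale_left L2_inner_commute[of "e _" y])
  then have "cmod (L2_inner ?s y) \<le> (\<Sum>l\<in>S. cmod (L2_inner x (e l) * cnj (L2_inner y (e l))))"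
    by (simp only: norm_sum)
  also have "\<dots> = (\<Sum>l\<in>S. \<bar>t l * cmod (L2_inner x (e l))\<bar> * \<bar>cmod (L2_inner y (e l)) / t l\<bar>)"
    using t by (intro sum.cong refl) (simp add: norm_mult abs_mult abs_divide less_imp_neq[OF t, symmetric])
  also have "\<dots> \<le> L2_set (\<lambda>l. t l * cmod (L2_inner x (e l))) S * L2_set (\<lambda>l. cmod (L2_inner y (e l)) / t l) S"
    by (rule L2_set_mult_ineq)
  also have "\<dots> \<le> sqrt A * sqrt B"
    unfolding L2_set_def using A[OF S(1)] B[OF S(1)] A[of "{}"]
    by (intro mult_mono real_sqrt_le_mono) (auto intro: sum_nonneg)
  finally have 1: "cmod (L2_inner ?s y) \<le> sqrt A * sqrt B" .
  have "cmod (L2_inner (\<lambda>z. x z - ?s z) y) \<le> L2_norm (\<lambda>z. x z - ?s z) * L2_norm y"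
    by (intro L2_Cauchy_Schwarz L2_diff x s y)
  also have "\<dots> \<le> \<eta> * (L2_norm y + 1)"
    using S(2) \<eta> by (intro mult_mono) auto
  also have "\<dots> = \<epsilon>" using n1 by (simp add: \<eta>_def)
  finally have 2: "cmod (L2_inner (\<lambda>z. x z - ?s z) y) \<le> \<epsilon>" .
  have "L2_inner x y = L2_inner ?s y + L2_inner (\<lambda>z. x z - ?s z) y"
    by (simp add: L2_inner_diff_left x s y)
  then have "cmod (L2_inner x y) \<le> cmod (L2_inner ?s y) + cmod (L2_inner (\<lambda>z. x z - ?s z) y)"
    by (simp only: norm_triangle_ineq)
  with 1 2 show "cmod (L2_inner x y) \<le> sqrt A * sqrt B + \<epsilon>" by linarith
qed

lemma fourier_sum:
  assumes "finite S" "\<And>l. l \<in> S \<Longrightarrow> u l \<in> L2"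
  shows "AE \<omega> in lborel. fourier (\<lambda>x. \<Sum>l\<in>S. c l * u l x) \<omega> = (\<Sum>l\<in>S. c l * fourier (u l) \<omega>)"
  using assms
proof (induction S)
  case empty
  have "AE \<omega> in lborel. fourier (\<lambda>x. 0 * 0) \<omega> = 0 * fourier (\<lambda>x. 0) \<omega>"
    by (rule fourier_scale) simp
  then show ?case by simp
next
  case (insert i S)
  have "AE \<omega> in lborel. fourier (\<lambda>x. c i * u i x + 1 * (\<Sum>l\<in>S. c l * u l x)) \<omega> =
      c i * fourier (u i) \<omega> + 1 * fourier (\<lambda>x. \<Sum>l\<in>S. c l * u l x) \<omega>"
    using insert.prems by (intro fourier_linear L2_sum L2_scale) auto
  moreover have "AE \<omega> in lborel. fourier (\<lambda>x. \<Sum>l\<in>S. c l * u l x) \<omega> = (\<Sum>l\<in>S. c l * fourier (u l) \<omega>)"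
    using insert by auto
  ultimately show ?case
    by eventually_elim (simp add: insert.hyps)
qed

lemma L2_orthonormal_basis_fourier:
  assumes u: "L2_orthonormal_basis u"
  shows "L2_orthonormal_basis (\<lambda>l \<omega>. of_real (1 / sqrt (2 * pi)) * fourier (u l) \<omega>)"
proof -
  let ?e = "\<lambda>l \<omega>. complex_of_real (1 / sqrt (2 * pi)) * fourier (u l) \<omega>"
  note on = L2_orthonormal_basisD[OF u]
  note D = L2_orthonormalD[OF on]
  have eL: "?e l \<in> L2" for l by (intro L2_scale fourier_L2 D)
  have inner: "L2_inner (?e l) (?e m) = (if l = m then 1 else 0)" for l m
  proof -
    let ?s = "complex_of_real (1 / sqrt (2 * pi))"
    define A where "A = sqrt (2 * pi)"
    have A: "A > 0" "2 * pi = A * A" by (simp_all add: A_def)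
    have "?s * (cnj ?s * of_real (2 * pi)) = of_real ((1 / A) * ((1 / A) * (A * A)))"
      by (simp only: of_real_mult complex_cnj_complex_of_real A_def[symmetric] A(2)[symmetric])
    also have "(1 / A) * ((1 / A) * (A * A)) = 1" using A(1) by simp
    finally have s: "?s * (cnj ?s * of_real (2 * pi)) = 1" by simp
    have "L2_inner (?e l) (?e m) = ?s * (cnj ?s * (of_real (2 * pi) * L2_inner (u l) (u m)))"
      by (simp only: L2_inner_scale_left L2_inner_scale_right Plancherel[OF D(1) D(1)])
    also have "\<dots> = (?s * (cnj ?s * of_real (2 * pi))) * L2_inner (u l) (u m)"
      by (simp only: mult.assoc)
    finally show ?thesis unfolding s D(2) by simp
  qed
  have "L2_closure {f. \<exists>S c. finite S \<and> f = (\<lambda>x. \<Sum>l\<in>S. c l * ?e l x)} = L2" (is "L2_closure ?V = L2")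
  proof (intro equalityI subsetI)
    fix g assume g: "g \<in> L2"
    obtain f where f: "f \<in> L2" "AE \<omega> in lborel. fourier f \<omega> = g \<omega>" by (rule fourier_surj[OF g])
    show "g \<in> L2_closure ?V"
      unfolding L2_closure_def
    proof (intro CollectI conjI allI impI g)
      fix \<epsilon> :: real assume \<epsilon>: "\<epsilon> > 0"
      then obtain S where S: "finite S"
          "L2_norm (\<lambda>x. f x - (\<Sum>l\<in>S. L2_inner f (u l) * u l x)) < \<epsilon> / sqrt (2 * pi)"
        using L2_orthonormal_basis_approx[OF u f(1), of "\<epsilon> / sqrt (2 * pi)"] by auto
      let ?h = "\<lambda>x. \<Sum>l\<in>S. L2_inner f (u l) * u l x"
      have h: "?h \<in> L2" by (intro L2_sum L2_scale D)
      let ?H = "\<lambda>x. \<Sum>l\<in>S. (L2_inner f (u l) * of_real (sqrt (2 * pi))) * ?e l x"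
      have H: "?H \<in> L2" by (intro L2_sum L2_scale[OF eL])
      have HF: "?H \<omega> = (\<Sum>l\<in>S. L2_inner f (u l) * fourier (u l) \<omega>)" for \<omega>
        by (intro sum.cong refl) simp
      have "L2_norm (\<lambda>\<omega>. g \<omega> - ?H \<omega>) = L2_norm (fourier (\<lambda>x. f x - ?h x))"
      proof (rule L2_norm_cong_AE)
        show "AE x in lborel. g x - ?H x = fourier (\<lambda>x. f x - ?h x) x"
          using f(2) fourier_diff[OF f(1) h] fourier_sum[OF S(1), of u "\<lambda>l. L2_inner f (u l)", OF D(1)]
          by eventually_elim (simp only: HF)
        show "(\<lambda>\<omega>. g \<omega> - ?H \<omega>) \<in> borel_measurable borel" by (intro L2_measurable L2_diff g H)
        show "fourier (\<lambda>x. f x - ?h x) \<in> borel_measurable borel"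
          by (intro L2_measurable fourier_L2 L2_diff f h)
      qed
      also have "\<dots> \<le> sqrt (2 * pi) * L2_norm (\<lambda>x. f x - ?h x)"
        by (intro fourier_norm_le L2_diff f h)
      also have "\<dots> < \<epsilon>" using S(2) by (simp add: field_simps)
      finally have lt: "L2_norm (\<lambda>\<omega>. g \<omega> - ?H \<omega>) < \<epsilon>" .
      have "?H \<in> ?V"
        by (intro CollectI exI[of _ S] exI[of _ "\<lambda>l. L2_inner f (u l) * of_real (sqrt (2 * pi))"]
            conjI S(1) refl)
      then show "\<exists>f\<in>?V \<inter> L2. L2_norm (\<lambda>x. g x - f x) < \<epsilon>"
        by (intro bexI[of _ ?H] lt IntI H)
    qed
  qed (simp add: L2_closure_def)
  then show ?thesis
    unfolding L2_orthonormal_basis_def by (intro conjI allI eL inner)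
qed

section \<open>Bases localized in dyadic frequency bands\<close>

definition band :: "real \<Rightarrow> real \<Rightarrow> int \<Rightarrow> real set" where
  "band a b j = {\<omega>. a * 2 powi j \<le> \<bar>\<omega>\<bar> \<and> \<bar>\<omega>\<bar> \<le> b * 2 powi j}"

lemma band_borel [measurable]: "band a b j \<in> sets borel"
  unfolding band_def by measurable

lemma card_bands_le:
  assumes a: "a > 0" and N: "b / a < 2 ^ N" and J: "finite J"
  shows "card {j \<in> J. \<omega> \<in> band a b j} \<le> N"
proof (cases "{j \<in> J. \<omega> \<in> band a b j} = {}")
  case True
  show ?thesis unfolding True by simp
next
  case False
  let ?B = "{j \<in> J. \<omega> \<in> band a b j}"
  define m where "m = Min ?B"
  have fin: "finite ?B" using J by simp
  have m: "m \<in> ?B" unfolding m_def using fin False by (rule Min_in)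
  have "j \<in> {m..<m + int N}" if "j \<in> ?B" for j
  proof -
    have "m \<le> j" unfolding m_def using fin that by (rule Min_le)
    have "a * 2 powi j \<le> b * 2 powi m" using that m by (auto simp: band_def)
    also have "2 powi j = 2 powi (j - m) * (2 powi m :: real)" by (simp add: power_int_add[symmetric])
    finally have "2 powi (j - m) \<le> b / a" using a by (simp add: field_simps)
    also have "\<dots> < 2 powi (int N)" using N by simp
    finally have "j - m < int N"
      by (rule power_int_le_imp_less_exp[rotated]) auto
    then show ?thesis using \<open>m \<le> j\<close> by simp
  qed
  then have "card ?B \<le> card {m..<m + int N}" by (intro card_mono) auto
  then show ?thesis by simp
qed

lemma ex_overlap_bound: "\<exists>N. b / a < (2::real) ^ N"
  by (rule real_arch_pow) simp

text \<open>
  Within one scale, the coefficients of \<open>g\<close> with respect to \<open>q\<^sub>j e\<^sub>j\<^sub>k\<close> are those of \<open>q\<^sub>j g\<close>, cut off to the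
  \<open>j\<close>-th band, with respect to \<open>e\<^sub>j\<^sub>k\<close>, and Bessel's inequality applies. Summing over the scales costs only
  the number of bands that can share a point.
\<close>

lemma dyadic_Bessel:
  assumes e: "L2_orthonormal e"
    and supp: "\<And>j k. AE \<omega> in lborel. e (j, k) \<omega> \<noteq> 0 \<longrightarrow> \<omega> \<in> band a b j"
    and a: "a > 0" and N: "b / a < 2 ^ N"
    and q [measurable]: "\<And>j. q j \<in> borel_measurable borel"
    and W [measurable]: "W \<in> borel_measurable borel" and Wnn: "\<And>\<omega>. W \<omega> \<ge> 0"
    and qW: "\<And>j \<omega>. \<omega> \<in> band a b j \<Longrightarrow> (q j \<omega>)\<^sup>2 \<le> W \<omega>"
    and g [measurable]: "g \<in> borel_measurable borel"
    and int: "integrable lborel (\<lambda>\<omega>. W \<omega> * (cmod (g \<omega>))\<^sup>2)"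
    and S: "finite S"
  shows "(\<Sum>l\<in>S. (cmod (L2_inner g (\<lambda>\<omega>. of_real (q (fst l) \<omega>) * e l \<omega>)))\<^sup>2) \<le>
    N * (LINT \<omega>|lborel. W \<omega> * (cmod (g \<omega>))\<^sup>2)"
proof -
  note D = L2_orthonormalD[OF e]
  note [measurable] = L2_measurable[OF D(1)]
  define h where "h j \<omega> = of_real (indicator (band a b j) \<omega> * q j \<omega>) * g \<omega>" for j \<omega>
  have h_meas [measurable]: "h j \<in> borel_measurable borel" for j
    unfolding h_def[abs_def] by measurable
  have h_sq: "(cmod (h j \<omega>))\<^sup>2 \<le> indicator (band a b j) \<omega> * (W \<omega> * (cmod (g \<omega>))\<^sup>2)" for j \<omega>
    using qW[of \<omega> j] by (auto simp: h_def norm_mult power_mult_distrib indicator_def intro!: mult_right_mono)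
  have int_band: "integrable lborel (\<lambda>\<omega>. indicator (band a b j) \<omega> * (W \<omega> * (cmod (g \<omega>))\<^sup>2))" for j
    using integrable_mult_indicator[OF _ int, of "band a b j"] by simp
  have hL: "h j \<in> L2" for j
  proof (rule L2_I[OF h_meas])
    show "integrable lborel (\<lambda>\<omega>. (cmod (h j \<omega>))\<^sup>2)"
      by (rule Bochner_Integration.integrable_bound[OF int_band[of j]])
         (use h_sq[of j] in \<open>auto intro!: AE_I2 order_trans[OF _ abs_ge_self]\<close>)
  qed
  have coeff: "L2_inner g (\<lambda>\<omega>. of_real (q j \<omega>) * e (j, k) \<omega>) = L2_inner (h j) (e (j, k))" for j k
    unfolding L2_inner_def
  proof (rule integral_cong_AE)
    show "AE x in lborel. g x * cnj (of_real (q j x) * e (j, k) x) = h j x * cnj (e (j, k) x)"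
      using supp[of j k] by eventually_elim (auto simp: h_def)
  qed measurable
  let ?c = "\<lambda>l. (cmod (L2_inner g (\<lambda>\<omega>. of_real (q (fst l) \<omega>) * e l \<omega>)))\<^sup>2"
  let ?J = "fst ` S" and ?K = "snd ` S"
  have "sum ?c S \<le> sum ?c (?J \<times> ?K)"
    using S subset_fst_snd[of S] by (intro sum_mono2) auto
  also have "\<dots> = (\<Sum>j\<in>?J. \<Sum>k\<in>?K. ?c (j, k))"
    unfolding sum.cartesian_product by (intro sum.cong refl) auto
  also have "\<dots> \<le> (\<Sum>j\<in>?J. (L2_norm (h j))\<^sup>2)"
  proof (rule sum_mono)
    fix j
    have "(\<Sum>k\<in>?K. ?c (j, k)) = (\<Sum>l\<in>Pair j ` ?K. (cmod (L2_inner (h j) (e l)))\<^sup>2)"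
      by (subst sum.reindex) (auto simp: coeff inj_on_def)
    also have "\<dots> \<le> (L2_norm (h j))\<^sup>2"
      using S by (intro L2_Bessel[OF e hL]) auto
    finally show "(\<Sum>k\<in>?K. ?c (j, k)) \<le> (L2_norm (h j))\<^sup>2" .
  qed
  also have "\<dots> \<le> (\<Sum>j\<in>?J. (LINT \<omega>|lborel. indicator (band a b j) \<omega> * (W \<omega> * (cmod (g \<omega>))\<^sup>2)))"
    unfolding L2_norm_sq by (intro sum_mono integral_mono L2_integrable hL int_band h_sq)
  also have "\<dots> = (LINT \<omega>|lborel. (\<Sum>j\<in>?J. indicator (band a b j) \<omega> * (W \<omega> * (cmod (g \<omega>))\<^sup>2)))"
    by (rule Bochner_Integration.integral_sum[symmetric]) (rule int_band)
  also have "\<dots> \<le> (LINT \<omega>|lborel. N * (W \<omega> * (cmod (g \<omega>))\<^sup>2))"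
  proof (rule integral_mono)
    fix \<omega>
    have "(\<Sum>j\<in>?J. indicator (band a b j) \<omega>) = real (card {j \<in> ?J. \<omega> \<in> band a b j})"
      using S by (simp add: indicator_def Int_def flip: sum.inter_filter)
    also have "\<dots> \<le> N" using card_bands_le[OF a N, of ?J \<omega>] S by simp
    finally show "(\<Sum>j\<in>?J. indicator (band a b j) \<omega> * (W \<omega> * (cmod (g \<omega>))\<^sup>2)) \<le> N * (W \<omega> * (cmod (g \<omega>))\<^sup>2)"
      using Wnn[of \<omega>] by (simp add: sum_distrib_right[symmetric] mult_right_mono)
  qed (auto intro!: Bochner_Integration.integrable_sum int_band int)
  finally show ?thesis by simp
qed

lemma sum_add_sq_le:
  fixes f g :: "'i \<Rightarrow> complex"
  shows "(\<Sum>l\<in>S. (cmod (f l + g l))\<^sup>2) \<le> 2 * (\<Sum>l\<in>S. (cmod (f l))\<^sup>2) + 2 * (\<Sum>l\<in>S. (cmod (g l))\<^sup>2)"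
  unfolding sum_distrib_left sum.distrib[symmetric] by (intro sum_mono cmod_add_sq_le)

text \<open>
  The quotient \<open>m\<^sup>-\<^sup>1 f\<close> need not be square-integrable, but on \<open>[-n, n]\<close> the factor \<open>m\<^sup>-\<^sup>1\<close> is bounded.
\<close>

lemma truncate_divide_L2:
  assumes f: "f \<in> L2" and m [measurable]: "m \<in> borel_measurable borel" and m_pos: "\<And>\<omega>. m \<omega> > 0"
    and m_inv: "\<And>R. \<exists>C. \<forall>\<omega>. \<bar>\<omega>\<bar> \<le> R \<longrightarrow> 1 / m \<omega> \<le> C"
  shows "(\<lambda>\<omega>. of_real (1 / m \<omega>) * truncate n f \<omega>) \<in> L2"
proof -
  note [measurable] = L2_measurable[OF f]
  obtain C where C: "\<And>\<omega>. \<bar>\<omega>\<bar> \<le> real n \<Longrightarrow> 1 / m \<omega> \<le> C" using m_inv by blast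
  have "cmod (of_real (1 / m \<omega>) * truncate n f \<omega>) \<le> C * cmod (truncate n f \<omega>)" for \<omega>
  proof (cases "\<bar>\<omega>\<bar> \<le> real n")
    case True
    moreover have "0 < 1 / m \<omega>" using m_pos[of \<omega>] by simp
    ultimately show ?thesis using C[OF True]
      by (simp only: norm_mult[of "of_real (1 / m \<omega>)"] norm_of_real) (intro mult_right_mono, auto)
  next
    case False
    then have "truncate n f \<omega> = 0" by (auto simp: indicator_def)
    then show ?thesis by (simp only: mult_zero_right norm_zero order_refl)
  qed
  then have "AE \<omega> in lborel. cmod (of_real (1 / m \<omega>) * truncate n f \<omega>) \<le> C * cmod (truncate n f \<omega>)"
    by (rule AE_I2)
  then show ?thesis
    by (rule L2_bound[OF _ truncate_L2[OF f, of n], rotated]) measurable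
qed

text \<open>
  The families \<open>\<kappa>\<^sub>j m\<^sup>-\<^sup>1 e\<^sub>l\<close> and \<open>\<kappa>\<^sub>j\<^sup>-\<^sup>1 m e\<^sub>l\<close> are biorthogonal. The upper bound for the second one gives the lower
  bound for the first one: write \<open>\<langle>g, g\<rangle> = \<langle>m\<^sup>-\<^sup>1 g, m g\<rangle>\<close> and expand in the basis. Since \<open>m\<^sup>-\<^sup>1\<close> may be
  unbounded, this is done for \<open>g\<close> with bounded support; the general case follows by truncation, where the
  upper bound for the first family controls the error.
\<close>

lemma dyadic_multiplier_frame:
  fixes e :: "int \<times> 'i \<Rightarrow> real \<Rightarrow> complex"
  assumes e: "L2_orthonormal_basis e"
    and supp: "\<And>j k. AE \<omega> in lborel. e (j, k) \<omega> \<noteq> 0 \<longrightarrow> \<omega> \<in> band a b j"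
    and a: "a > 0"
    and m [measurable]: "m \<in> borel_measurable borel" and m_pos: "\<And>\<omega>. m \<omega> > 0"
    and m_le: "\<And>\<omega>. m \<omega> \<le> C0"
    and m_inv: "\<And>R. \<exists>C. \<forall>\<omega>. \<bar>\<omega>\<bar> \<le> R \<longrightarrow> 1 / m \<omega> \<le> C"
    and k_pos: "\<And>j. k j > 0"
    and C1: "\<And>j \<omega>. \<omega> \<in> band a b j \<Longrightarrow> k j / m \<omega> \<le> C1"
    and C2: "\<And>j \<omega>. \<omega> \<in> band a b j \<Longrightarrow> m \<omega> / k j \<le> C2"
  shows "\<exists>A>0. \<exists>B>0. \<forall>g\<in>L2.
    (\<lambda>l. (cmod (L2_inner g (\<lambda>\<omega>. of_real (k (fst l) / m \<omega>) * e l \<omega>)))\<^sup>2) summable_on UNIV \<and>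
    A * (L2_norm g)\<^sup>2 \<le> (\<Sum>\<^sub>\<infinity>l. (cmod (L2_inner g (\<lambda>\<omega>. of_real (k (fst l) / m \<omega>) * e l \<omega>)))\<^sup>2) \<and>
    (\<Sum>\<^sub>\<infinity>l. (cmod (L2_inner g (\<lambda>\<omega>. of_real (k (fst l) / m \<omega>) * e l \<omega>)))\<^sup>2) \<le> B * (L2_norm g)\<^sup>2"
proof -
  note on = L2_orthonormal_basisD[OF e]
  note De = L2_orthonormalD[OF on]
  note [measurable] = L2_measurable[OF De(1)]
  obtain N where N: "b / a < (2::real) ^ N" using ex_overlap_bound by blast
  let ?v = "\<lambda>l \<omega>. of_real (k (fst l) / m \<omega>) * e l \<omega>"
  let ?w = "\<lambda>l \<omega>. of_real (m \<omega> / k (fst l)) * e l \<omega>"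
  have upper: "(\<Sum>l\<in>S. (cmod (L2_inner g (\<lambda>\<omega>. of_real (q (fst l) \<omega>) * e l \<omega>)))\<^sup>2) \<le> (N * C\<^sup>2 + 1) * (L2_norm g)\<^sup>2"
    if q: "\<And>j. q j \<in> borel_measurable borel" "\<And>j \<omega>. \<omega> \<in> band a b j \<Longrightarrow> 0 \<le> q j \<omega> \<and> q j \<omega> \<le> C"
      and g: "g \<in> L2" and S: "finite S" for q and C :: real and g S
  proof -
    have "(\<Sum>l\<in>S. (cmod (L2_inner g (\<lambda>\<omega>. of_real (q (fst l) \<omega>) * e l \<omega>)))\<^sup>2) \<le>
        N * (LINT \<omega>|lborel. C\<^sup>2 * (cmod (g \<omega>))\<^sup>2)"
      by (rule dyadic_Bessel[OF on supp a N q(1)])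
         (use q(2) g S in \<open>auto intro!: power_mono L2_measurable L2_integrable\<close>)
    also have "\<dots> = N * C\<^sup>2 * (L2_norm g)\<^sup>2" by (simp add: L2_norm_sq)
    also have "\<dots> \<le> (N * C\<^sup>2 + 1) * (L2_norm g)\<^sup>2" by (intro mult_right_mono) auto
    finally show ?thesis .
  qed
  define B where "B = N * C1\<^sup>2 + 1"
  define B' where "B' = N * C2\<^sup>2 + 1"
  have Bpos: "B > 0" "B' > 0" by (auto simp: B_def B'_def intro: add_nonneg_pos)
  have v_upper: "(\<Sum>l\<in>S. (cmod (L2_inner g (?v l)))\<^sup>2) \<le> B * (L2_norm g)\<^sup>2" if "g \<in> L2" "finite S" for g S
    unfolding B_def using k_pos m_pos C1 that
    by (intro upper[of "\<lambda>j \<omega>. k j / m \<omega>"]) (auto intro: less_imp_le)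
  have w_upper: "(\<Sum>l\<in>S. (cmod (L2_inner g (?w l)))\<^sup>2) \<le> B' * (L2_norm g)\<^sup>2" if "g \<in> L2" "finite S" for g S
    unfolding B'_def using k_pos m_pos C2 that
    by (intro upper[of "\<lambda>j \<omega>. m \<omega> / k j"]) (auto intro: less_imp_le)
  have vL: "?v l \<in> L2" for l
  proof (rule L2_bound[OF _ De(1)[of l], of _ C1])
    show "AE x in lborel. cmod (?v l x) \<le> C1 * cmod (e l x)"
      using supp[of "fst l" "snd l"]
    proof eventually_elim
      case (elim x)
      show ?case
      proof (cases "e l x = 0")
        case False
        with elim have "k (fst l) / m x \<le> C1" by (intro C1) simp
        moreover have "0 < k (fst l) / m x" using k_pos[of "fst l"] m_pos[of x] by simp
        ultimately show ?thesis
          by (simp only: norm_mult norm_of_real) (intro mult_right_mono, auto)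
      qed simp
    qed
  qed measurable
  have limited: "(L2_norm h)\<^sup>2 \<le> B' * D"
    if g: "g \<in> L2" and h: "h = truncate n g"
      and D: "\<And>S. finite S \<Longrightarrow> (\<Sum>l\<in>S. (cmod (L2_inner h (?v l)))\<^sup>2) \<le> D" for g h n D
  proof -
    have hL: "h \<in> L2" unfolding h by (rule truncate_L2[OF g])
    note [measurable] = L2_measurable[OF hL]
    let ?x = "\<lambda>\<omega>. of_real (1 / m \<omega>) * h \<omega>" and ?y = "\<lambda>\<omega>. of_real (m \<omega>) * h \<omega>"
    have xL: "?x \<in> L2" unfolding h by (rule truncate_divide_L2[OF g m m_pos m_inv])
    have yL: "?y \<in> L2"
      by (rule L2_mult_bounded(1)[OF hL, of _ C0]) (use m_le m_pos in \<open>auto simp: abs_of_pos\<close>)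
    have "cmod (L2_inner ?x ?y) \<le> sqrt D * sqrt (B' * (L2_norm h)\<^sup>2)"
    proof (rule L2_inner_weighted_bound[OF e xL yL, of "\<lambda>l. k (fst l)"])
      fix S :: "(int \<times> 'i) set" assume S: "finite S"
      have "(k (fst l) * cmod (L2_inner ?x (e l)))\<^sup>2 = (cmod (L2_inner h (?v l)))\<^sup>2" for l
      proof -
        have "of_real (k (fst l)) * L2_inner ?x (e l) = L2_inner h (?v l)"
          unfolding L2_inner_scale_left[symmetric] by (simp add: L2_inner_def mult_ac)
        then have "cmod (of_real (k (fst l)) * L2_inner ?x (e l)) = cmod (L2_inner h (?v l))"
          by (simp only:)
        then show ?thesis using k_pos[of "fst l"] by (simp add: norm_mult)
      qed
      then show "(\<Sum>l\<in>S. (k (fst l) * cmod (L2_inner ?x (e l)))\<^sup>2) \<le> D"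
        using D[OF S] by simp
      have "(cmod (L2_inner ?y (e l)) / k (fst l))\<^sup>2 = (cmod (L2_inner h (?w l)))\<^sup>2" for l
      proof -
        have "of_real (1 / k (fst l)) * L2_inner ?y (e l) = L2_inner h (?w l)"
          unfolding L2_inner_scale_left[symmetric] by (simp add: L2_inner_def mult_ac)
        then have "cmod (of_real (1 / k (fst l)) * L2_inner ?y (e l)) = cmod (L2_inner h (?w l))"
          by (simp only:)
        then show ?thesis using k_pos[of "fst l"] by (simp add: norm_mult norm_divide)
      qed
      then show "(\<Sum>l\<in>S. (cmod (L2_inner ?y (e l)) / k (fst l))\<^sup>2) \<le> B' * (L2_norm h)\<^sup>2"
        using w_upper[OF hL S] by simp
    qed (rule k_pos)
    also have "L2_inner ?x ?y = L2_inner h h"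
      unfolding L2_inner_def using m_pos
      by (intro Bochner_Integration.integral_cong refl) (simp add: less_imp_neq[OF m_pos, symmetric])
    finally have le: "(L2_norm h)\<^sup>2 \<le> sqrt D * sqrt (B' * (L2_norm h)\<^sup>2)"
      by (simp add: L2_inner_self norm_power)
    show ?thesis
    proof (cases "L2_norm h = 0")
      case True
      then show ?thesis using D[of "{}"] Bpos by simp
    next
      case False
      then have pos: "L2_norm h > 0" by (simp add: less_le)
      have "L2_norm h * L2_norm h \<le> sqrt (B' * D) * L2_norm h"
        using le by (simp add: real_sqrt_mult power2_eq_square mult_ac)
      then have "L2_norm h \<le> sqrt (B' * D)" using pos by simp
      then have "(L2_norm h)\<^sup>2 \<le> (sqrt (B' * D))\<^sup>2" by (intro power_mono) auto
      also have "\<dots> = B' * D" using D[of "{}"] Bpos by simp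
      finally show ?thesis .
    qed
  qed
  have v_lower: "1 / (2 * B') * (L2_norm g)\<^sup>2 \<le> D"
    if g: "g \<in> L2" and D: "\<And>S. finite S \<Longrightarrow> (\<Sum>l\<in>S. (cmod (L2_inner g (?v l)))\<^sup>2) \<le> D" for g D
  proof -
    let ?h = "\<lambda>n. truncate n g"
    let ?d = "\<lambda>n. L2_norm (\<lambda>x. ?h n x - g x)"
    have "(L2_norm (?h n))\<^sup>2 \<le> B' * (2 * D + 2 * (B * (?d n)\<^sup>2))" for n
    proof (rule limited[OF g refl])
      fix S :: "(int \<times> 'i) set" assume S: "finite S"
      have dL: "(\<lambda>x. ?h n x - g x) \<in> L2" by (intro L2_diff truncate_L2 g)
      have "L2_inner (?h n) (?v l) = L2_inner g (?v l) + L2_inner (\<lambda>x. ?h n x - g x) (?v l)" for l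
        using L2_inner_diff_left[OF truncate_L2[OF g] g vL[of l], of n] by simp
      then have "(\<Sum>l\<in>S. (cmod (L2_inner (?h n) (?v l)))\<^sup>2) =
          (\<Sum>l\<in>S. (cmod (L2_inner g (?v l) + L2_inner (\<lambda>x. ?h n x - g x) (?v l)))\<^sup>2)"
        by (simp only:)
      also have "\<dots> \<le> 2 * (\<Sum>l\<in>S. (cmod (L2_inner g (?v l)))\<^sup>2) +
          2 * (\<Sum>l\<in>S. (cmod (L2_inner (\<lambda>x. ?h n x - g x) (?v l)))\<^sup>2)"
        by (rule sum_add_sq_le)
      also have "\<dots> \<le> 2 * D + 2 * (B * (?d n)\<^sup>2)"
        using D[OF S] v_upper[OF dL S] by linarith
      finally show "(\<Sum>l\<in>S. (cmod (L2_inner (?h n) (?v l)))\<^sup>2) \<le> 2 * D + 2 * (B * (?d n)\<^sup>2)" .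
    qed
    moreover note lim = L2_tendsto_truncation[OF g]
    have "(\<lambda>n. (L2_norm (?h n))\<^sup>2) \<longlonglongrightarrow> (L2_norm g)\<^sup>2"
      by (intro tendsto_power L2_tendsto_norm lim)
    moreover have "(\<lambda>n. B' * (2 * D + 2 * (B * (?d n)\<^sup>2))) \<longlonglongrightarrow> B' * (2 * D + 2 * (B * 0\<^sup>2))"
      by (intro tendsto_intros L2_tendstoD(3)[OF lim])
    ultimately have "(L2_norm g)\<^sup>2 \<le> B' * (2 * D + 2 * (B * 0\<^sup>2))"
      by (intro LIMSEQ_le) auto
    then show ?thesis using Bpos by (simp add: field_simps)
  qed
  show ?thesis
  proof (rule exI[of _ "1 / (2 * B')"], intro conjI exI[of _ B] ballI)
    fix g assume g: "g \<in> L2"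
    show s: "(\<lambda>l. (cmod (L2_inner g (?v l)))\<^sup>2) summable_on UNIV"
      by (rule nonneg_infsum_le(1)[OF _ v_upper[OF g]]) simp
    show "(\<Sum>\<^sub>\<infinity>l. (cmod (L2_inner g (?v l)))\<^sup>2) \<le> B * (L2_norm g)\<^sup>2"
      by (rule nonneg_infsum_le(2)[OF _ v_upper[OF g]]) simp
    show "1 / (2 * B') * (L2_norm g)\<^sup>2 \<le> (\<Sum>\<^sub>\<infinity>l. (cmod (L2_inner g (?v l)))\<^sup>2)"
      by (rule v_lower[OF g]) (rule finite_sum_le_infsum[OF s], auto)
  qed (use Bpos in simp_all)
qed

section \<open>Fourier multipliers\<close>

lemma fourier_eq_0_imp:
  assumes f: "f \<in> L2" and z: "AE \<omega> in lborel. fourier f \<omega> = 0"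
  shows "AE x in lborel. f x = 0"
proof -
  have "L2_norm (fourier f) = 0" using z L2_norm_eq_0_iff[OF fourier_L2[OF f]] by simp
  then have "L2_norm f = 0" using fourier_norm[OF f] by simp
  then show ?thesis using L2_norm_eq_0_iff[OF f] by simp
qed

lemma L2_inner_fourier: "f \<in> L2 \<Longrightarrow> g \<in> L2 \<Longrightarrow> L2_inner f g = of_real (1 / (2 * pi)) * L2_inner (fourier f) (fourier g)"
  by (simp add: Plancherel)

lemma L2_norm_fourier:
  assumes "f \<in> L2"
  shows "L2_norm (fourier f) = sqrt (2 * pi) * L2_norm f"
proof (rule power2_eq_imp_eq)
  show "(L2_norm (fourier f))\<^sup>2 = (sqrt (2 * pi) * L2_norm f)\<^sup>2"
    using fourier_norm[OF assms] by (simp add: power_mult_distrib)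
qed simp_all

text \<open>
  Positivity of the symbol gives injectivity. The range is dense because it contains every function \<open>g\<close>
  with bounded frequency support: its preimage has the transform \<open>m\<^sup>-\<^sup>1\<close> times that of \<open>g\<close>.
\<close>

lemma multiplier_operator:
  assumes m [measurable]: "m \<in> borel_measurable borel" and m_pos: "\<And>\<omega>. m \<omega> > 0" and m_le: "\<And>\<omega>. m \<omega> \<le> 1"
    and m_inv: "\<And>R. \<exists>C. \<forall>\<omega>. \<bar>\<omega>\<bar> \<le> R \<longrightarrow> 1 / m \<omega> \<le> C"
    and K: "\<And>\<theta>. \<theta> \<in> L2 \<Longrightarrow> K \<theta> \<in> L2"
    and FK: "\<And>\<theta>. \<theta> \<in> L2 \<Longrightarrow> AE \<omega> in lborel. fourier (K \<theta>) \<omega> = of_real (m \<omega>) * fourier \<theta> \<omega>"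
  shows "L2_bounded_operator K" "L2_orth (L2_ker K) = L2" "L2_closure (K ` L2) = L2"
proof -
  have mc: "cmod (of_real (m \<omega>)) \<le> 1" for \<omega> using m_pos[of \<omega>] m_le[of \<omega>] by simp
  show "L2_bounded_operator K"
    unfolding L2_bounded_operator_def
  proof (intro conjI ballI allI exI[of _ 1] K)
    fix f g a b assume f: "f \<in> L2" and g: "g \<in> L2"
    have fg: "(\<lambda>x. a * f x + b * g x) \<in> L2" by (intro L2_add L2_scale f g)
    show "AE x in lborel. K (\<lambda>x. a * f x + b * g x) x = a * K f x + b * K g x"
    proof (rule fourier_inj)
      show "AE \<omega> in lborel. fourier (K (\<lambda>x. a * f x + b * g x)) \<omega> = fourier (\<lambda>x. a * K f x + b * K g x) \<omega>"
        using FK[OF fg] fourier_linear[OF f g, of a b] fourier_linear[OF K[OF f] K[OF g], of a b] FK[OF f] FK[OF g]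
        by eventually_elim (simp add: algebra_simps)
    qed (intro K fg, intro L2_add L2_scale K f g)
  next
    fix f assume f: "f \<in> L2"
    have "sqrt (2 * pi) * L2_norm (K f) = L2_norm (fourier (K f))"
      by (rule L2_norm_fourier[OF K[OF f], symmetric])
    also have "\<dots> = L2_norm (\<lambda>\<omega>. of_real (m \<omega>) * fourier f \<omega>)"
    proof (rule L2_norm_cong_AE[OF _ _ FK[OF f]])
      note [measurable] = L2_measurable[OF fourier_L2[OF f]]
      show "(\<lambda>\<omega>. of_real (m \<omega>) * fourier f \<omega>) \<in> borel_measurable borel" by measurable
    qed (intro L2_measurable fourier_L2 K f)
    also have "\<dots> \<le> 1 * L2_norm (fourier f)"
      by (rule L2_mult_bounded(2)[OF fourier_L2[OF f] _ mc]) measurable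
    also have "\<dots> = sqrt (2 * pi) * L2_norm f" by (simp add: L2_norm_fourier[OF f])
    finally show "L2_norm (K f) \<le> 1 * L2_norm f" by simp
  qed
  show "L2_orth (L2_ker K) = L2"
  proof -
    have "L2_inner f g = 0" if f: "f \<in> L2" and g: "g \<in> L2_ker K" for f g
    proof -
      have gL: "g \<in> L2" and z: "AE x in lborel. K g x = 0" using g by (auto simp: L2_ker_def)
      have "L2_norm (K g) = 0" using z L2_norm_eq_0_iff[OF K[OF gL]] by simp
      then have "L2_norm (fourier (K g)) = 0" by (simp add: L2_norm_fourier K gL)
      then have "AE \<omega> in lborel. fourier (K g) \<omega> = 0"
        using L2_norm_eq_0_iff[OF fourier_L2[OF K[OF gL]]] by simp
      then have "AE \<omega> in lborel. fourier g \<omega> = 0"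
        using FK[OF gL]
      proof eventually_elim
        case (elim \<omega>)
        then show ?case using m_pos[of \<omega>] by auto
      qed
      then have "AE x in lborel. g x = 0" by (rule fourier_eq_0_imp[OF gL])
      then have "AE x in lborel. f x * cnj (g x) = 0" by eventually_elim simp
      then show ?thesis unfolding L2_inner_def by (rule integral_eq_zero_AE)
    qed
    then show ?thesis by (auto simp: L2_orth_def)
  qed
  show "L2_closure (K ` L2) = L2"
  proof (intro equalityI subsetI)
    fix g assume g: "g \<in> L2"
    note Fg = fourier_L2[OF g]
    show "g \<in> L2_closure (K ` L2)"
      unfolding L2_closure_def
    proof (intro CollectI conjI g allI impI)
      fix e :: real assume e: "e > 0"
      have "sqrt (2 * pi) * e > 0" using e by simp
      from LIMSEQ_D[OF L2_tendstoD(3)[OF L2_tendsto_truncation[OF Fg]] this]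
      obtain n where n: "L2_norm (\<lambda>\<omega>. truncate n (fourier g) \<omega> - fourier g \<omega>) < sqrt (2 * pi) * e" by auto
      let ?h = "\<lambda>\<omega>. of_real (1 / m \<omega>) * truncate n (fourier g) \<omega>"
      have h: "?h \<in> L2" by (rule truncate_divide_L2[OF Fg m m_pos m_inv])
      let ?\<theta> = "fourier_inv ?h"
      have \<theta>: "?\<theta> \<in> L2" by (rule fourier_inv_L2[OF h])
      have "sqrt (2 * pi) * L2_norm (\<lambda>x. g x - K ?\<theta> x) = L2_norm (fourier (\<lambda>x. g x - K ?\<theta> x))"
        by (intro L2_norm_fourier[symmetric] L2_diff g K \<theta>)
      also have "\<dots> = L2_norm (\<lambda>\<omega>. fourier g \<omega> - truncate n (fourier g) \<omega>)"
      proof (rule L2_norm_cong_AE)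
        show "AE x in lborel. fourier (\<lambda>x. g x - K ?\<theta> x) x = fourier g x - truncate n (fourier g) x"
          using fourier_diff[OF g K[OF \<theta>]] FK[OF \<theta>] fourier_fourier_inv[OF h]
        proof eventually_elim
          case (elim \<omega>)
          have "of_real (m \<omega>) * ?h \<omega> = truncate n (fourier g) \<omega>"
            using m_pos[of \<omega>] by simp
          then show ?case unfolding elim(1,2,3) by simp
        qed
        show "fourier (\<lambda>x. g x - K ?\<theta> x) \<in> borel_measurable borel"
          by (intro L2_measurable fourier_L2 L2_diff g K \<theta>)
        show "(\<lambda>\<omega>. fourier g \<omega> - truncate n (fourier g) \<omega>) \<in> borel_measurable borel"
          by (intro L2_measurable L2_diff Fg truncate_L2)
      qed
      also have "\<dots> < sqrt (2 * pi) * e" using n by (simp only: L2_norm_minus_commute[of "fourier g"])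
      finally have lt: "L2_norm (\<lambda>x. g x - K ?\<theta> x) < e" by simp
      show "\<exists>f\<in>K ` L2 \<inter> L2. L2_norm (\<lambda>x. g x - f x) < e"
        by (intro bexI[of _ "K ?\<theta>"] lt IntI imageI \<theta> K)
    qed
  qed (simp add: L2_closure_def)
qed

lemma L2_closed_subspace_L2: "L2_closed_subspace L2"
  unfolding L2_closed_subspace_def
proof (intro conjI ballI allI)
  show "L2_closure L2 \<subseteq> L2" unfolding L2_closure_def by blast
  show "(\<lambda>x. a * f x + b * g x) \<in> L2" if "f \<in> L2" "g \<in> L2" for f g a b
    using that by (intro L2_add L2_scale)
qed simp_all

lemma L2_adjoint_eqI:
  assumes h: "h \<in> L2" and adj: "\<And>f. f \<in> L2 \<Longrightarrow> L2_inner (K f) g = L2_inner f h"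
  shows "AE x in lborel. L2_adjoint K g x = h x"
proof -
  have "\<exists>h. h \<in> L2 \<and> (\<forall>f\<in>L2. L2_inner (K f) g = L2_inner f h)" using h adj by blast
  from someI_ex[OF this] have A: "L2_adjoint K g \<in> L2" "\<And>f. f \<in> L2 \<Longrightarrow> L2_inner (K f) g = L2_inner f (L2_adjoint K g)"
    by (auto simp: L2_adjoint_def)
  show ?thesis
  proof (rule L2_AE_eqI[OF A(1) h])
    fix f assume f: "f \<in> L2"
    have "L2_inner f (L2_adjoint K g) = L2_inner f h" using A(2)[OF f] adj[OF f] by simp
    then show "L2_inner (L2_adjoint K g) f = L2_inner h f"
      unfolding L2_inner_commute[of _ f] L2_inner_commute[of "L2_adjoint K g" f] L2_inner_commute[of h f] by simp
  qed
qed

section \<open>Wavelets and the symbol of the time-fractional heat equation\<close>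

text \<open>These are the Mittag-Leffler bounds at \<open>x = \<omega>\<^sup>2 T\<^sup>\<gamma>\<close>: the symbol is comparable to \<open>(1 + \<omega>\<^sup>2)\<^sup>-\<^sup>1\<close>.\<close>

lemma fractional_heat_symbol:
  assumes \<gamma>: "0 < \<gamma>" "\<gamma> < 1" and T: "T > 0"
  obtains c d where "c > 0" "d > 0"
    "(\<lambda>\<omega>. mittag_leffler \<gamma> 1 (- (\<bar>\<omega>\<bar>\<^sup>2 * T powr \<gamma>)) :: real) \<in> borel_measurable borel"
    "\<And>\<omega>::real. mittag_leffler \<gamma> 1 (- (\<bar>\<omega>\<bar>\<^sup>2 * T powr \<gamma>)) > (0::real)"
    "\<And>\<omega>. 1 / mittag_leffler \<gamma> 1 (- (\<bar>\<omega>\<bar>\<^sup>2 * T powr \<gamma>)) \<le> 1 + c * \<omega>\<^sup>2"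
    "\<And>\<omega>. mittag_leffler \<gamma> 1 (- (\<bar>\<omega>\<bar>\<^sup>2 * T powr \<gamma>)) * (1 + d * \<omega>\<^sup>2) \<le> 1"
proof
  let ?c = "T powr \<gamma> * Gamma (1 - \<gamma>)" and ?d = "T powr \<gamma> / Gamma (\<gamma> + 1)"
  have G: "Gamma (\<gamma> + 1) > 0" "Gamma (1 - \<gamma>) > 0"
    using \<gamma> by (auto intro: Gamma_real_pos)
  show c: "?c > 0" and d: "?d > 0" using G T by auto
  show "(\<lambda>\<omega>. mittag_leffler \<gamma> 1 (- (\<bar>\<omega>\<bar>\<^sup>2 * T powr \<gamma>)) :: real) \<in> borel_measurable borel"
    unfolding mittag_leffler_def by measurable
  fix \<omega> :: real
  let ?m = "mittag_leffler \<gamma> 1 (- (\<bar>\<omega>\<bar>\<^sup>2 * T powr \<gamma>)) :: real"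
  have x: "\<bar>\<omega>\<bar>\<^sup>2 * T powr \<gamma> \<ge> 0" by simp
  have lo: "1 / (1 + ?c * \<omega>\<^sup>2) \<le> ?m" and hi: "?m \<le> 1 / (1 + ?d * \<omega>\<^sup>2)"
    using mittag_leffler_bounds[OF \<gamma> x] by (simp_all add: mult_ac)
  have pc: "1 + ?c * \<omega>\<^sup>2 > 0" and pd: "1 + ?d * \<omega>\<^sup>2 > 0"
    using mult_nonneg_nonneg[OF less_imp_le[OF c] zero_le_power2[of \<omega>]]
      mult_nonneg_nonneg[OF less_imp_le[OF d] zero_le_power2[of \<omega>]] by linarith+
  show m: "?m > 0" using less_le_trans[OF _ lo] pc by simp
  show "1 / ?m \<le> 1 + ?c * \<omega>\<^sup>2" using lo m pc by (simp add: divide_simps mult.commute)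
  show "?m * (1 + ?d * \<omega>\<^sup>2) \<le> 1" using hi pd by (simp add: pos_le_divide_eq)
qed

text \<open>The quasi-singular values \<open>\<kappa>\<close> as a function of the scale.\<close>

definition dyadic_weight :: "int \<Rightarrow> real" where
  "dyadic_weight j = (if j \<ge> 1 then 2 powi (- 2 * j) else 1)"

lemma dyadic_weight_eq:
  assumes "j \<ge> 1"
  shows "dyadic_weight j = inverse ((2 powi j)\<^sup>2)"
proof -
  have "dyadic_weight j = 2 powi (- (j + j))" using assms by (simp add: dyadic_weight_def)
  also have "\<dots> = inverse (2 powi j * 2 powi j)"
    unfolding power_int_minus by (subst power_int_add) auto
  finally show ?thesis by (simp add: power2_eq_square)
qed

lemma dyadic_weight_bounds: "dyadic_weight j > 0" "dyadic_weight j \<le> 1"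
proof -
  show "dyadic_weight j > 0" by (simp add: dyadic_weight_def)
  have "(2::real) powi (- 2 * j) \<le> 2 powi 0" if "j \<ge> 1"
    using that by (intro power_int_increasing) auto
  then show "dyadic_weight j \<le> 1" by (simp add: dyadic_weight_def)
qed

text \<open>On the \<open>j\<close>-th band the weight is comparable to \<open>(1 + \<omega>\<^sup>2)\<^sup>-\<^sup>1\<close>.\<close>

lemma dyadic_weight_band:
  assumes \<omega>: "\<omega> \<in> band a b j" and a: "a > 0"
  shows "dyadic_weight j * \<omega>\<^sup>2 \<le> b\<^sup>2" "j \<ge> 1 \<Longrightarrow> a\<^sup>2 \<le> dyadic_weight j * \<omega>\<^sup>2"
proof -
  have p: "(2 powi j :: real) > 0" by simp
  have lo: "a * 2 powi j \<le> \<bar>\<omega>\<bar>" and hi: "\<bar>\<omega>\<bar> \<le> b * 2 powi j" using \<omega> by (auto simp: band_def)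
  have "\<bar>\<omega>\<bar>\<^sup>2 \<le> (b * 2 powi j)\<^sup>2" using hi by (intro power_mono) auto
  then have hi2: "\<omega>\<^sup>2 \<le> b\<^sup>2 * (2 powi j)\<^sup>2" by (simp add: power_mult_distrib)
  have "(a * 2 powi j)\<^sup>2 \<le> \<bar>\<omega>\<bar>\<^sup>2" using lo a by (intro power_mono) auto
  then have lo2: "a\<^sup>2 * (2 powi j)\<^sup>2 \<le> \<omega>\<^sup>2" by (simp add: power_mult_distrib)
  show "dyadic_weight j * \<omega>\<^sup>2 \<le> b\<^sup>2"
  proof (cases "j \<ge> 1")
    case True
    then show ?thesis using hi2 p by (simp add: dyadic_weight_eq field_simps)
  next
    case False
    have "(2 powi j :: real) \<le> 2 powi 0" using False by (intro power_int_increasing) auto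
    then have "(2 powi j :: real)\<^sup>2 \<le> 1\<^sup>2" using p by (intro power_mono) auto
    then have "b\<^sup>2 * (2 powi j)\<^sup>2 \<le> b\<^sup>2 * 1" by (intro mult_left_mono) auto
    with hi2 False show ?thesis by (simp add: dyadic_weight_def)
  qed
  show "a\<^sup>2 \<le> dyadic_weight j * \<omega>\<^sup>2" if "j \<ge> 1"
    using lo2 p that by (simp add: dyadic_weight_eq field_simps)
qed

lemma dyadic_weight_symbol:
  assumes \<omega>: "\<omega> \<in> band a b j" and a: "a > 0" and c: "c > 0" and d: "d > 0" and m: "m > 0"
    and lo: "1 / m \<le> 1 + c * \<omega>\<^sup>2" and hi: "m * (1 + d * \<omega>\<^sup>2) \<le> 1"
  shows "dyadic_weight j / m \<le> 1 + c * b\<^sup>2" "m / dyadic_weight j \<le> 1 + 1 / (d * a\<^sup>2)"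
proof -
  note k = dyadic_weight_bounds[of j]
  have "dyadic_weight j * (1 / m) \<le> dyadic_weight j * (1 + c * \<omega>\<^sup>2)"
    using lo k by (intro mult_left_mono) auto
  also have "\<dots> = dyadic_weight j + c * (dyadic_weight j * \<omega>\<^sup>2)" by (simp add: algebra_simps)
  also have "\<dots> \<le> 1 + c * b\<^sup>2"
    using k c dyadic_weight_band(1)[OF \<omega> a] by (intro add_mono mult_left_mono) auto
  finally show "dyadic_weight j / m \<le> 1 + c * b\<^sup>2" by simp
  show "m / dyadic_weight j \<le> 1 + 1 / (d * a\<^sup>2)"
  proof (cases "j \<ge> 1")
    case True
    have "m * (d * a\<^sup>2) \<le> m * (d * (dyadic_weight j * \<omega>\<^sup>2))"
      using dyadic_weight_band(2)[OF \<omega> a True] m d by (intro mult_left_mono) auto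
    also have "\<dots> = dyadic_weight j * (m * (1 + d * \<omega>\<^sup>2) - m)" by (simp add: algebra_simps)
    also have "\<dots> \<le> dyadic_weight j * 1" using hi m k by (intro mult_left_mono) auto
    finally have "m / dyadic_weight j \<le> 1 / (d * a\<^sup>2)"
      using k d a by (simp add: field_simps)
    then show ?thesis by simp
  next
    case False
    have "m * 1 \<le> m * (1 + d * \<omega>\<^sup>2)" using m d by (intro mult_left_mono) auto
    then have "m \<le> 1" using hi by linarith
    moreover have "0 \<le> 1 / (d * a\<^sup>2)" using d by simp
    moreover have "m / dyadic_weight j = m" using False by (simp add: dyadic_weight_def)
    ultimately show ?thesis by linarith
  qed
qed

lemma fourier_wavelet_band:
  assumes \<psi>: "\<psi> \<in> L2" and supp: "AE \<omega> in lborel. fourier \<psi> \<omega> \<noteq> 0 \<longrightarrow> a \<le> \<bar>\<omega>\<bar> \<and> \<bar>\<omega>\<bar> \<le> b"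
  shows "AE \<omega> in lborel. fourier (\<lambda>x. s * \<psi> (2 powi j * x - t)) \<omega> \<noteq> 0 \<longrightarrow> \<omega> \<in> band a b j"
proof -
  have c: "(2 powi j :: real) > 0" by simp
  note [measurable] = L2_measurable[OF fourier_L2[OF \<psi>]]
  have "AE \<omega> in lborel. fourier \<psi> (0 + 1 / 2 powi j * \<omega>) \<noteq> 0 \<longrightarrow>
      a \<le> \<bar>0 + 1 / 2 powi j * \<omega>\<bar> \<and> \<bar>0 + 1 / 2 powi j * \<omega>\<bar> \<le> b"
    by (rule AE_borel_affine[OF _ _ supp]) (use c in simp, measurable)
  moreover have "AE \<omega> in lborel. fourier (\<lambda>x. \<psi> (- t + 2 powi j * x)) \<omega> =
      of_real (1 / 2 powi j) * exp (\<i> * of_real (\<omega> * (- t) / 2 powi j)) * fourier \<psi> (\<omega> / 2 powi j)"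
    by (rule fourier_affine[OF \<psi> c])
  moreover have "AE \<omega> in lborel. fourier (\<lambda>x. s * \<psi> (- t + 2 powi j * x)) \<omega> =
      s * fourier (\<lambda>x. \<psi> (- t + 2 powi j * x)) \<omega>"
    by (rule fourier_scale[OF L2_affine(1)[OF \<psi>]]) (use c in simp)
  ultimately show ?thesis
  proof eventually_elim
    case (elim \<omega>)
    show ?case
    proof
      assume "fourier (\<lambda>x. s * \<psi> (2 powi j * x - t)) \<omega> \<noteq> 0"
      then have "fourier \<psi> (\<omega> / 2 powi j) \<noteq> 0"
        using elim(2,3) by (auto simp: algebra_simps)
      with elim(1) have "a \<le> \<bar>\<omega> / 2 powi j\<bar> \<and> \<bar>\<omega> / 2 powi j\<bar> \<le> b" by simp
      then show "\<omega> \<in> band a b j" using c by (simp add: band_def abs_divide field_simps)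
    qed
  qed
qed

theorem theorem4p1:
  fixes \<gamma> T p a_u b_u :: real
    and \<psi> :: "real \<Rightarrow> complex"
    and K :: "(real \<Rightarrow> complex) \<Rightarrow> real \<Rightarrow> complex"
    and u v :: "int \<times> int \<Rightarrow> real \<Rightarrow> complex"
    and \<kappa> :: "int \<times> int \<Rightarrow> real"
    and \<phi> :: "real \<Rightarrow> real"
  assumes "0 < \<gamma>" and "\<gamma> < 1" and "T > 0"
    and K: "\<And>\<theta>. \<theta> \<in> L2 \<Longrightarrow> K \<theta> \<in> L2 \<and>
              (AE \<omega> in lborel. fourier (K \<theta>) \<omega> =
                 of_real (mittag_leffler \<gamma> 1 (- (\<bar>\<omega>\<bar>\<^sup>2 * T powr \<gamma>))) * fourier \<theta> \<omega>)"
    and u: "\<And>j k. u (j, k) =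
              (\<lambda>x. of_real (2 powr (of_int j / 2)) * \<psi> (2 powi j * x - of_int k))"
    and onb: "L2_orthonormal_basis u"
    and "a_u > 0" and "b_u > 0"
    and supp: "AE \<omega> in lborel. fourier \<psi> \<omega> \<noteq> 0 \<longrightarrow> a_u \<le> \<bar>\<omega>\<bar> \<and> \<bar>\<omega>\<bar> \<le> b_u"
    and \<kappa>: "\<And>j k. \<kappa> (j, k) = (if j \<ge> 1 then 2 powi (- 2 * j) else 1)"
    and v: "\<And>l. v l = (\<lambda>x. of_real (\<kappa> l) *
              K (fourier_inv (\<lambda>\<omega>.
                  of_real (\<bar>mittag_leffler \<gamma> 1 (- (\<bar>\<omega>\<bar>\<^sup>2 * T powr \<gamma>))\<bar> powi (- 2)) *
                  fourier (u l) \<omega>)) x)"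
    and "p > 0"
    and \<phi>: "\<And>\<mu>. \<phi> \<mu> = \<mu> powr (p / 2)"
  shows "L2_DFD K u v \<kappa> \<and>
    (\<forall>\<theta>\<^sub>0 \<in> sobolev p. \<exists>E\<^sub>0>0. \<forall>E\<ge>E\<^sub>0. \<theta>\<^sub>0 \<in> source_set \<phi> E \<kappa> u) \<and>
    (\<forall>E>0. \<exists>\<delta>\<^sub>0>0.
       let \<beta> = 2 powr (- (2 + p));
           \<delta>star = (\<lambda>l. inverse (frame_inf (L2_closure (K ` L2)) v) * E *
                      sqrt ((\<kappa> l)\<^sup>2 * \<phi> ((\<kappa> l)\<^sup>2)));
           D = (\<lambda>l. {\<delta>star l .. inverse \<beta> * \<delta>star l})
       in {0<..\<delta>\<^sub>0} \<subseteq> (\<Union>l. D l))"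
proof -
  let ?m = "\<lambda>\<omega>::real. mittag_leffler \<gamma> 1 (- (\<bar>\<omega>\<bar>\<^sup>2 * T powr \<gamma>)) :: real"
  obtain c d where cd: "c > 0" "d > 0" and m_meas [measurable]: "?m \<in> borel_measurable borel"
    and m_pos: "\<And>\<omega>. ?m \<omega> > 0" and m_lo: "\<And>\<omega>. 1 / ?m \<omega> \<le> 1 + c * \<omega>\<^sup>2"
    and m_hi: "\<And>\<omega>. ?m \<omega> * (1 + d * \<omega>\<^sup>2) \<le> 1"
    using fractional_heat_symbol[OF \<open>0 < \<gamma>\<close> \<open>\<gamma> < 1\<close> \<open>T > 0\<close>] by metis
  have m_le: "?m \<omega> \<le> 1" for \<omega>
  proof -
    have "?m \<omega> * 1 \<le> ?m \<omega> * (1 + d * \<omega>\<^sup>2)"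
      using m_pos[of \<omega>] cd by (intro mult_left_mono) auto
    then show ?thesis using m_hi[of \<omega>] by linarith
  qed
  have m_inv: "\<exists>C. \<forall>\<omega>. \<bar>\<omega>\<bar> \<le> R \<longrightarrow> 1 / ?m \<omega> \<le> C" for R
  proof (intro exI[of _ "1 + c * R\<^sup>2"] allI impI)
    fix \<omega> :: real assume "\<bar>\<omega>\<bar> \<le> R"
    then have "\<bar>\<omega>\<bar>\<^sup>2 \<le> R\<^sup>2" by (intro power_mono) auto
    then have "c * \<omega>\<^sup>2 \<le> c * R\<^sup>2" using cd by simp
    with m_lo[of \<omega>] show "1 / ?m \<omega> \<le> 1 + c * R\<^sup>2" by linarith
  qed
  have KL: "K \<theta> \<in> L2" if "\<theta> \<in> L2" for \<theta> using K[OF that] by blast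
  have FK: "AE \<omega> in lborel. fourier (K \<theta>) \<omega> = of_real (?m \<omega>) * fourier \<theta> \<omega>" if "\<theta> \<in> L2" for \<theta>
    using K[OF that] by blast
  have op: "L2_bounded_operator K" "L2_orth (L2_ker K) = L2" "L2_closure (K ` L2) = L2"
    by (rule multiplier_operator[OF m_meas m_pos m_le m_inv KL FK]; assumption)+

  note on = L2_orthonormal_basisD[OF onb]
  have uL: "u l \<in> L2" for l by (rule L2_orthonormalD(1)[OF on])
  have "u (0, 0) = \<psi>" unfolding u by simp
  then have \<psi>L: "\<psi> \<in> L2" using uL[of "(0, 0)"] by simp
  have band_u: "AE \<omega> in lborel. fourier (u (j, k)) \<omega> \<noteq> 0 \<longrightarrow> \<omega> \<in> band a_u b_u j" for j k
    unfolding u by (rule fourier_wavelet_band[OF \<psi>L supp])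
  define e where "e l \<omega> = complex_of_real (1 / sqrt (2 * pi)) * fourier (u l) \<omega>" for l \<omega>
  have e: "L2_orthonormal_basis e"
    unfolding e_def[abs_def] by (rule L2_orthonormal_basis_fourier[OF onb])
  have eL: "e l \<in> L2" for l by (rule L2_orthonormalD(1)[OF L2_orthonormal_basisD[OF e]])
  have band_e: "AE \<omega> in lborel. e (j, k) \<omega> \<noteq> 0 \<longrightarrow> \<omega> \<in> band a_u b_u j" for j k
    using band_u[of j k] by eventually_elim (simp add: e_def)
  have u_e: "fourier (u l) \<omega> = of_real (sqrt (2 * pi)) * e l \<omega>" for l \<omega>
    by (simp add: e_def)
  have \<kappa>_eq: "\<kappa> l = dyadic_weight (fst l)" for l
    using \<kappa>[of "fst l" "snd l"] by (simp add: dyadic_weight_def)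
  note k_pos = dyadic_weight_bounds(1)
  define C1 where "C1 = 1 + c * b_u\<^sup>2"
  have C1: "dyadic_weight j / ?m \<omega> \<le> C1" if "\<omega> \<in> band a_u b_u j" for j \<omega>
    unfolding C1_def by (rule dyadic_weight_symbol(1)[OF that \<open>a_u > 0\<close> cd m_pos m_lo m_hi])
  have C2: "?m \<omega> / dyadic_weight j \<le> 1 + 1 / (d * a_u\<^sup>2)" if "\<omega> \<in> band a_u b_u j" for j \<omega>
    by (rule dyadic_weight_symbol(2)[OF that \<open>a_u > 0\<close> cd m_pos m_lo m_hi])
  let ?V = "\<lambda>l \<omega>. complex_of_real (dyadic_weight (fst l) / ?m \<omega>) * e l \<omega>"
  have "\<exists>A>0. \<exists>B>0. \<forall>g\<in>L2. (\<lambda>l. (cmod (L2_inner g (?V l)))\<^sup>2) summable_on UNIV \<and>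
      A * (L2_norm g)\<^sup>2 \<le> (\<Sum>\<^sub>\<infinity>l. (cmod (L2_inner g (?V l)))\<^sup>2) \<and>
      (\<Sum>\<^sub>\<infinity>l. (cmod (L2_inner g (?V l)))\<^sup>2) \<le> B * (L2_norm g)\<^sup>2"
  proof (rule dyadic_multiplier_frame[OF e band_e \<open>a_u > 0\<close> m_meas m_pos m_le m_inv k_pos])
    show "dyadic_weight j / ?m \<omega> \<le> C1" if "\<omega> \<in> band a_u b_u j" for j \<omega>
      using that by (rule C1)
    show "?m \<omega> / dyadic_weight j \<le> 1 + 1 / (d * a_u\<^sup>2)" if "\<omega> \<in> band a_u b_u j" for j \<omega>
      using that by (rule C2)
  qed
  then obtain A B where AB: "A > 0" "B > 0"
    and V_frame: "\<And>g. g \<in> L2 \<Longrightarrow> (\<lambda>l. (cmod (L2_inner g (?V l)))\<^sup>2) summable_on UNIV"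
      "\<And>g. g \<in> L2 \<Longrightarrow> A * (L2_norm g)\<^sup>2 \<le> (\<Sum>\<^sub>\<infinity>l. (cmod (L2_inner g (?V l)))\<^sup>2)"
      "\<And>g. g \<in> L2 \<Longrightarrow> (\<Sum>\<^sub>\<infinity>l. (cmod (L2_inner g (?V l)))\<^sup>2) \<le> B * (L2_norm g)\<^sup>2"
    by blast

  have v_facts: "v l \<in> L2 \<and> (AE \<omega> in lborel. fourier (v l) \<omega> = of_real (sqrt (2 * pi)) * ?V l \<omega>)" for l
  proof -
    let ?h = "\<lambda>\<omega>. of_real (\<bar>?m \<omega>\<bar> powi (- 2)) * fourier (u l) \<omega>"
    have inv2: "\<bar>?m \<omega>\<bar> powi (- 2) = (1 / ?m \<omega>)\<^sup>2" for \<omega>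
      using m_pos[of \<omega>] by (simp add: power_int_minus power_int_numeral power_divide inverse_eq_divide)
    have h_eq: "?h = (\<lambda>\<omega>. of_real ((1 / ?m \<omega>)\<^sup>2) * fourier (u l) \<omega>)"
      by (simp only: inv2)
    \<comment> \<open>\<open>m\<^sup>-\<^sup>2\<close> is unbounded on the line but bounded on the band that carries the transform of \<open>u\<^sub>l\<close>.\<close>
    have hL: "?h \<in> L2"
      unfolding h_eq
    proof (rule L2_bound[OF _ fourier_L2[OF uL[of l]], of _ "(C1 / dyadic_weight (fst l))\<^sup>2"])
      note [measurable] = L2_measurable[OF fourier_L2[OF uL[of l]]]
      show "(\<lambda>\<omega>. of_real ((1 / ?m \<omega>)\<^sup>2) * fourier (u l) \<omega>) \<in> borel_measurable borel" by measurable
      show "AE \<omega> in lborel. cmod (of_real ((1 / ?m \<omega>)\<^sup>2) * fourier (u l) \<omega>) \<le>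
          (C1 / dyadic_weight (fst l))\<^sup>2 * cmod (fourier (u l) \<omega>)"
        using band_u[of "fst l" "snd l"]
      proof eventually_elim
        case (elim \<omega>)
        show ?case
        proof (cases "fourier (u l) \<omega> = 0")
          case False
          with elim have "dyadic_weight (fst l) / ?m \<omega> \<le> C1" by (intro C1) simp
          then have "1 / ?m \<omega> \<le> C1 / dyadic_weight (fst l)"
            using k_pos[of "fst l"] m_pos[of \<omega>] by (simp add: field_simps)
          then have "(1 / ?m \<omega>)\<^sup>2 \<le> (C1 / dyadic_weight (fst l))\<^sup>2"
            using m_pos[of \<omega>] by (intro power_mono) (auto intro: less_imp_le)
          moreover have "cmod (of_real ((1 / ?m \<omega>)\<^sup>2)) = (1 / ?m \<omega>)\<^sup>2"
            unfolding norm_of_real by simp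
          ultimately show ?thesis by (simp only: norm_mult) (intro mult_right_mono, auto)
        qed simp
      qed
    qed
    let ?w = "fourier_inv ?h"
    have wL: "?w \<in> L2" by (rule fourier_inv_L2[OF hL])
    have v_eq: "v l = (\<lambda>x. of_real (\<kappa> l) * K ?w x)" by (rule v)
    have "v l \<in> L2" unfolding v_eq by (intro L2_scale KL wL)
    moreover have "AE \<omega> in lborel. fourier (v l) \<omega> = of_real (sqrt (2 * pi)) * ?V l \<omega>"
      unfolding v_eq
      using fourier_scale[OF KL[OF wL], of "of_real (\<kappa> l)"] FK[OF wL] fourier_fourier_inv[OF hL]
    proof eventually_elim
      case (elim \<omega>)
      have "complex_of_real (?m \<omega>) * of_real ((1 / ?m \<omega>)\<^sup>2) = of_real (1 / ?m \<omega>)"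
        unfolding of_real_mult[symmetric] using m_pos[of \<omega>] by (simp add: power2_eq_square)
      then have "of_real (\<kappa> l) * (complex_of_real (?m \<omega>) * (of_real ((1 / ?m \<omega>)\<^sup>2) * fourier (u l) \<omega>)) =
          of_real (\<kappa> l) * (of_real (1 / ?m \<omega>) * fourier (u l) \<omega>)"
        by (simp only: mult.assoc[symmetric])
      then show ?case
        unfolding elim(1,2,3) unfolding inv2 by (simp add: u_e \<kappa>_eq)
    qed
    ultimately show ?thesis by blast
  qed
  have vL: "v l \<in> L2" for l using v_facts by blast
  have VL: "?V l \<in> L2" for l
  proof (rule L2_AE_cong[OF L2_scale[OF fourier_L2[OF vL[of l]], of "of_real (1 / sqrt (2 * pi))"]])
    note [measurable] = L2_measurable[OF eL[of l]]
    show "?V l \<in> borel_measurable borel" by measurable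
    show "AE x in lborel. of_real (1 / sqrt (2 * pi)) * fourier (v l) x = ?V l x"
      using conjunct2[OF v_facts[of l]] by eventually_elim simp
  qed
  have v_inner: "L2_inner f (v l) = of_real (1 / sqrt (2 * pi)) * L2_inner (fourier f) (?V l)" if f: "f \<in> L2" for f l
  proof -
    have "L2_inner (fourier f) (fourier (v l)) = L2_inner (fourier f) (\<lambda>\<omega>. of_real (sqrt (2 * pi)) * ?V l \<omega>)"
      by (rule L2_inner_cong_AE[OF fourier_L2[OF f] L2_measurable[OF fourier_L2[OF f]] fourier_L2[OF vL]
            L2_measurable[OF L2_scale[OF VL]] AE_I2[OF refl] conjunct2[OF v_facts]])
    then have "L2_inner f (v l) = of_real (1 / (2 * pi)) * (of_real (sqrt (2 * pi)) * L2_inner (fourier f) (?V l))"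
      unfolding L2_inner_fourier[OF f vL] by (simp only: L2_inner_scale_right complex_cnj_complex_of_real)
    also have "\<dots> = of_real (1 / (2 * pi) * sqrt (2 * pi)) * L2_inner (fourier f) (?V l)"
      by (simp only: of_real_mult mult.assoc)
    also have "1 / (2 * pi) * sqrt (2 * pi) = 1 / sqrt (2 * pi)"
      using real_div_sqrt[of "2 * pi"] by (simp add: field_simps)
    finally show ?thesis .
  qed
  have v_sq: "(cmod (L2_inner f (v l)))\<^sup>2 = 1 / (2 * pi) * (cmod (L2_inner (fourier f) (?V l)))\<^sup>2"
    if "f \<in> L2" for f l
    unfolding v_inner[OF that] by (simp add: norm_mult norm_divide power_mult_distrib power_divide)
  have v_frame: "(\<lambda>l. (cmod (L2_inner f (v l)))\<^sup>2) summable_on UNIV \<and>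
      A * (L2_norm f)\<^sup>2 \<le> (\<Sum>\<^sub>\<infinity>l. (cmod (L2_inner f (v l)))\<^sup>2) \<and>
      (\<Sum>\<^sub>\<infinity>l. (cmod (L2_inner f (v l)))\<^sup>2) \<le> B * (L2_norm f)\<^sup>2" if f: "f \<in> L2" for f
  proof -
    note V = V_frame[OF fourier_L2[OF f]]
    let ?D = "\<Sum>\<^sub>\<infinity>l. (cmod (L2_inner (fourier f) (?V l)))\<^sup>2"
    have inf: "(\<Sum>\<^sub>\<infinity>l. (cmod (L2_inner f (v l)))\<^sup>2) = 1 / (2 * pi) * ?D"
      unfolding v_sq[OF f] by (rule infsum_cmult_right')
    have "A * (2 * pi * (L2_norm f)\<^sup>2) \<le> ?D" "?D \<le> B * (2 * pi * (L2_norm f)\<^sup>2)"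
      using V(2,3) unfolding fourier_norm[OF f] .
    then have "A * (L2_norm f)\<^sup>2 \<le> 1 / (2 * pi) * ?D" "1 / (2 * pi) * ?D \<le> B * (L2_norm f)\<^sup>2"
      by (simp_all add: field_simps)
    moreover have "(\<lambda>l. (cmod (L2_inner f (v l)))\<^sup>2) summable_on UNIV"
      unfolding v_sq[OF f] by (rule summable_on_cmult_right[OF V(1)])
    ultimately show ?thesis unfolding inf by blast
  qed
  have adj: "AE x in lborel. L2_adjoint K (v l) x = of_real (\<kappa> l) * u l x" for l
  proof (rule L2_adjoint_eqI)
    show "(\<lambda>x. of_real (\<kappa> l) * u l x) \<in> L2" by (rule L2_scale[OF uL])
    fix f assume f: "f \<in> L2"
    have "L2_inner (K f) (v l) = of_real (1 / (2 * pi)) * L2_inner (fourier (K f)) (fourier (v l))"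
      by (rule L2_inner_fourier[OF KL[OF f] vL])
    also have "L2_inner (fourier (K f)) (fourier (v l)) = L2_inner (fourier f) (\<lambda>\<omega>. of_real (\<kappa> l) * fourier (u l) \<omega>)"
      unfolding L2_inner_def
    proof (rule integral_cong_AE)
      note [measurable] = L2_measurable[OF fourier_L2[OF KL[OF f]]] L2_measurable[OF fourier_L2[OF vL[of l]]]
        L2_measurable[OF fourier_L2[OF f]] L2_measurable[OF fourier_L2[OF uL[of l]]]
      show "(\<lambda>\<omega>. fourier (K f) \<omega> * cnj (fourier (v l) \<omega>)) \<in> borel_measurable lborel"
        "(\<lambda>\<omega>. fourier f \<omega> * cnj (of_real (\<kappa> l) * fourier (u l) \<omega>)) \<in> borel_measurable lborel"
        by measurable
      show "AE \<omega> in lborel. fourier (K f) \<omega> * cnj (fourier (v l) \<omega>) =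
          fourier f \<omega> * cnj (of_real (\<kappa> l) * fourier (u l) \<omega>)"
        using FK[OF f] conjunct2[OF v_facts[of l]]
      proof eventually_elim
        case (elim \<omega>)
        show ?case unfolding elim using m_pos[of \<omega>] by (simp add: u_e \<kappa>_eq)
      qed
    qed
    also have "of_real (1 / (2 * pi)) * L2_inner (fourier f) (\<lambda>\<omega>. of_real (\<kappa> l) * fourier (u l) \<omega>) =
        L2_inner f (\<lambda>x. of_real (\<kappa> l) * u l x)"
      unfolding L2_inner_scale_right L2_inner_fourier[OF f uL] by (simp only: mult.left_commute)
    finally show "L2_inner (K f) (v l) = L2_inner f (\<lambda>x. of_real (\<kappa> l) * u l x)" .
  qed

  have u_frame: "L2_frame L2 u"
    unfolding L2_frame_def
  proof (intro conjI allI L2_closed_subspace_L2 uL)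
    show "\<exists>A>0. \<exists>B>0. \<forall>f\<in>L2. (\<lambda>l. (cmod (L2_inner f (u l)))\<^sup>2) summable_on UNIV \<and>
        A * (L2_norm f)\<^sup>2 \<le> (\<Sum>\<^sub>\<infinity>l. (cmod (L2_inner f (u l)))\<^sup>2) \<and>
        (\<Sum>\<^sub>\<infinity>l. (cmod (L2_inner f (u l)))\<^sup>2) \<le> B * (L2_norm f)\<^sup>2"
    proof (rule exI[of _ 1], intro conjI exI[of _ "1::real"] ballI)
      fix f assume "f \<in> L2"
      note P = L2_Parseval[OF onb this]
      show "(\<lambda>l. (cmod (L2_inner f (u l)))\<^sup>2) summable_on UNIV" by (rule P(1))
      show "1 * (L2_norm f)\<^sup>2 \<le> (\<Sum>\<^sub>\<infinity>l. (cmod (L2_inner f (u l)))\<^sup>2)"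
        "(\<Sum>\<^sub>\<infinity>l. (cmod (L2_inner f (u l)))\<^sup>2) \<le> 1 * (L2_norm f)\<^sup>2"
        by (simp_all add: P(2))
    qed simp_all
  qed
  have "L2_frame L2 v"
    unfolding L2_frame_def
  proof (intro conjI allI L2_closed_subspace_L2 vL)
    show "\<exists>A>0. \<exists>B>0. \<forall>f\<in>L2. (\<lambda>l. (cmod (L2_inner f (v l)))\<^sup>2) summable_on UNIV \<and>
        A * (L2_norm f)\<^sup>2 \<le> (\<Sum>\<^sub>\<infinity>l. (cmod (L2_inner f (v l)))\<^sup>2) \<and>
        (\<Sum>\<^sub>\<infinity>l. (cmod (L2_inner f (v l)))\<^sup>2) \<le> B * (L2_norm f)\<^sup>2"
      using AB v_frame by blast
  qed
  moreover have "\<kappa> l > 0" for l by (simp add: \<kappa>_eq k_pos)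
  ultimately have dfd: "L2_DFD K u v \<kappa>"
    unfolding L2_DFD_def op(2,3) using op(1) u_frame adj by (intro conjI allI)

  have source: "\<exists>E\<^sub>0>0. \<forall>E\<ge>E\<^sub>0. \<theta> \<in> source_set \<phi> E \<kappa> u" if \<theta>: "\<theta> \<in> sobolev p" for \<theta>
  proof -
    have \<theta>L: "\<theta> \<in> L2" and int: "integrable lborel (\<lambda>\<omega>. (1 + \<omega>\<^sup>2) powr p * (cmod (fourier \<theta> \<omega>))\<^sup>2)"
      using \<theta> by (auto simp: sobolev_def)
    obtain N where N: "b_u / a_u < (2::real) ^ N" using ex_overlap_bound by blast
    define C where "C = 1 + (1 / a_u\<^sup>2) powr p"
    define W where "W \<omega> = C * (1 + \<omega>\<^sup>2) powr p" for \<omega>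
    define q where "q j = dyadic_weight j powr (- p / 2)" for j
    have q_sq: "(q j)\<^sup>2 = dyadic_weight j powr (- p)" for j
      by (simp add: q_def power2_eq_square powr_add[symmetric])
    have \<phi>_eq: "inverse (\<phi> ((\<kappa> l)\<^sup>2)) = (q (fst l))\<^sup>2" for l
    proof -
      have "((\<kappa> l)\<^sup>2) powr (p / 2) = \<kappa> l powr p"
        using k_pos[of "fst l"] by (simp add: \<kappa>_eq power2_eq_square powr_mult powr_add[symmetric])
      then show ?thesis by (simp add: \<phi> q_sq powr_minus \<kappa>_eq)
    qed
    have C: "C \<ge> 1" by (simp add: C_def)
    have qW: "(q j)\<^sup>2 \<le> W \<omega>" if "\<omega> \<in> band a_u b_u j" for j \<omega>
    proof (cases "j \<ge> 1")
      case True
      have "a_u\<^sup>2 \<le> dyadic_weight j * \<omega>\<^sup>2" by (rule dyadic_weight_band(2)[OF that \<open>a_u > 0\<close> True])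
      then have "1 / dyadic_weight j \<le> (1 / a_u\<^sup>2) * \<omega>\<^sup>2"
        using k_pos[of j] \<open>a_u > 0\<close> by (simp add: field_simps)
      also have "\<dots> \<le> (1 / a_u\<^sup>2) * (1 + \<omega>\<^sup>2)" by (intro mult_left_mono) auto
      finally have "(1 / dyadic_weight j) powr p \<le> ((1 / a_u\<^sup>2) * (1 + \<omega>\<^sup>2)) powr p"
        using k_pos[of j] \<open>p > 0\<close> by (intro powr_mono2) (auto intro: less_imp_le)
      also have "\<dots> = (1 / a_u\<^sup>2) powr p * (1 + \<omega>\<^sup>2) powr p" by (rule powr_mult)
      also have "\<dots> \<le> W \<omega>" unfolding W_def C_def by (intro mult_right_mono) auto
      also have "(1 / dyadic_weight j) powr p = (q j)\<^sup>2"
        using k_pos[of j] by (simp add: q_sq powr_minus powr_divide inverse_eq_divide)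
      finally show ?thesis .
    next
      case False
      have "1 \<le> (1 + \<omega>\<^sup>2) powr p" using \<open>p > 0\<close> by (intro ge_one_powr_ge_zero) auto
      then have "1 * 1 \<le> W \<omega>" unfolding W_def using C by (intro mult_mono) auto
      then show ?thesis using False by (simp add: q_def dyadic_weight_def)
    qed
    define M where "M = 1 / (2 * pi) * (N * (LINT \<omega>|lborel. W \<omega> * (cmod (fourier \<theta> \<omega>))\<^sup>2))"
    let ?a = "\<lambda>l. inverse (\<phi> ((\<kappa> l)\<^sup>2)) * (cmod (L2_inner \<theta> (u l)))\<^sup>2"
    have fin: "sum ?a S \<le> M" if S: "finite S" for S
    proof -
      have "?a l = 1 / (2 * pi) * (cmod (L2_inner (fourier \<theta>) (\<lambda>\<omega>. of_real (q (fst l)) * e l \<omega>)))\<^sup>2" for l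
      proof -
        have "L2_inner \<theta> (u l) = of_real (1 / (2 * pi)) * (of_real (sqrt (2 * pi)) * L2_inner (fourier \<theta>) (e l))"
          unfolding L2_inner_fourier[OF \<theta>L uL] u_e[abs_def] by (simp add: L2_inner_scale_right)
        then have "(cmod (L2_inner \<theta> (u l)))\<^sup>2 = (1 / (2 * pi))\<^sup>2 * (2 * pi) * (cmod (L2_inner (fourier \<theta>) (e l)))\<^sup>2"
          by (simp add: norm_mult norm_divide power_mult_distrib power_divide)
        also have "(1 / (2 * pi))\<^sup>2 * (2 * pi) = 1 / (2 * pi)" by (simp add: power2_eq_square)
        finally show ?thesis
          by (simp add: \<phi>_eq L2_inner_scale_right norm_mult power_mult_distrib)
      qed
      then have "sum ?a S = 1 / (2 * pi) *
          (\<Sum>l\<in>S. (cmod (L2_inner (fourier \<theta>) (\<lambda>\<omega>. of_real (q (fst l)) * e l \<omega>)))\<^sup>2)"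
        by (simp only: sum_distrib_left)
      also have "\<dots> \<le> 1 / (2 * pi) * (N * (LINT \<omega>|lborel. W \<omega> * (cmod (fourier \<theta> \<omega>))\<^sup>2))"
      proof (intro mult_left_mono dyadic_Bessel[OF L2_orthonormal_basisD[OF e] band_e \<open>a_u > 0\<close> N, where q = "\<lambda>j \<omega>. q j"])
        show "W \<in> borel_measurable borel" unfolding W_def[abs_def] by measurable
        show "W \<omega> \<ge> 0" for \<omega> using C by (simp add: W_def)
        show "integrable lborel (\<lambda>\<omega>. W \<omega> * (cmod (fourier \<theta> \<omega>))\<^sup>2)"
          using integrable_mult_right[OF int, of C] by (simp add: W_def mult.assoc)
        show "fourier \<theta> \<in> borel_measurable borel" by (rule L2_measurable[OF fourier_L2[OF \<theta>L]])
      qed (use qW S in auto)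
      finally show ?thesis by (simp add: M_def)
    qed
    have nn: "?a l \<ge> 0" for l by (simp add: \<phi>_eq)
    note s = nonneg_infsum_le[of ?a M, OF nn fin]
    have "\<theta> \<in> source_set \<phi> E \<kappa> u" if E: "E \<ge> sqrt \<bar>M\<bar> + 1" for E
    proof -
      have "(sqrt \<bar>M\<bar>)\<^sup>2 \<le> E\<^sup>2" using E by (intro power_mono) auto
      then have "M \<le> E\<^sup>2" by simp
      then show ?thesis using s \<theta>L by (auto simp: source_set_def)
    qed
    moreover have "sqrt \<bar>M\<bar> + 1 > 0" by (simp add: add_nonneg_pos)
    ultimately show ?thesis by blast
  qed

  have cover: "\<exists>\<delta>\<^sub>0>0.
       let \<beta> = 2 powr (- (2 + p));
           \<delta>star = (\<lambda>l. inverse (frame_inf (L2_closure (K ` L2)) v) * E *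
                      sqrt ((\<kappa> l)\<^sup>2 * \<phi> ((\<kappa> l)\<^sup>2)));
           D = (\<lambda>l. {\<delta>star l .. inverse \<beta> * \<delta>star l})
       in {0<..\<delta>\<^sub>0} \<subseteq> (\<Union>l. D l)" if E: "E > 0" for E
  proof -
    \<comment> \<open>The lower frame bound keeps the infimum away from \<open>0\<close>; a basis element shows that it is taken over a
      nonempty set.\<close>
    define F where "F = frame_inf L2 v"
    have "F \<ge> sqrt A"
      unfolding F_def frame_inf_def
    proof (rule cInf_greatest)
      have "u (0, 0) \<in> L2 \<and> L2_norm (u (0, 0)) = 1"
      proof
        have "complex_of_real ((L2_norm (u (0, 0)))\<^sup>2) = 1"
          unfolding L2_inner_self[symmetric] L2_orthonormalD(2)[OF on] by simp
        then have "(L2_norm (u (0, 0)))\<^sup>2 = 1" by (simp only: of_real_eq_1_iff)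
        then show "L2_norm (u (0, 0)) = 1"
          using L2_norm_nonneg[of "u (0, 0)"] by (simp add: power2_eq_1_iff)
      qed (rule uL)
      then show "{sqrt (\<Sum>\<^sub>\<infinity>l. (cmod (L2_inner f (v l)))\<^sup>2) |f. f \<in> L2 \<and> L2_norm f = 1} \<noteq> {}"
        by blast
    next
      fix x assume "x \<in> {sqrt (\<Sum>\<^sub>\<infinity>l. (cmod (L2_inner f (v l)))\<^sup>2) |f. f \<in> L2 \<and> L2_norm f = 1}"
      then obtain f where f: "f \<in> L2" "L2_norm f = 1" "x = sqrt (\<Sum>\<^sub>\<infinity>l. (cmod (L2_inner f (v l)))\<^sup>2)" by blast
      then show "sqrt A \<le> x" using v_frame[OF f(1)] by simp
    qed
    then have F: "F > 0" using AB by (meson less_le_trans real_sqrt_gt_zero)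
    define G where "G = inverse F * E"
    have G: "G > 0" using F E by (simp add: G_def)
    define s where "s = 2 + p"
    have s: "s > 0" using \<open>p > 0\<close> by (simp add: s_def)
    have star: "sqrt ((\<kappa> (int n + 1, 0))\<^sup>2 * \<phi> ((\<kappa> (int n + 1, 0))\<^sup>2)) = 2 powr (- (real n + 1) * s)" for n
    proof -
      have k: "\<kappa> (int n + 1, 0) = 2 powr (- 2 * (real n + 1))"
      proof -
        have "\<kappa> (int n + 1, 0) = 2 powi (- 2 * (int n + 1))" by (simp add: \<kappa>)
        also have "\<dots> = 2 powr (of_int (- 2 * (int n + 1)))" by (rule powr_real_of_int'[symmetric]) auto
        finally show ?thesis by simp
      qed
      have sq: "(\<kappa> (int n + 1, 0))\<^sup>2 = 2 powr (- 4 * (real n + 1))"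
        unfolding k power2_eq_square powr_add[symmetric] by simp
      have "(\<kappa> (int n + 1, 0))\<^sup>2 * \<phi> ((\<kappa> (int n + 1, 0))\<^sup>2) =
          2 powr (- 4 * (real n + 1) + - 4 * (real n + 1) * (p / 2))"
        unfolding sq \<phi> powr_powr powr_add ..
      also have "- 4 * (real n + 1) + - 4 * (real n + 1) * (p / 2) = - (real n + 1) * s + - (real n + 1) * s"
        by (simp add: s_def field_simps)
      also have "2 powr (- (real n + 1) * s + - (real n + 1) * s) = (2 powr (- (real n + 1) * s))\<^sup>2"
        by (simp only: powr_add power2_eq_square)
      finally have "(\<kappa> (int n + 1, 0))\<^sup>2 * \<phi> ((\<kappa> (int n + 1, 0))\<^sup>2) = (2 powr (- (real n + 1) * s))\<^sup>2" .
      then show ?thesis by (simp only: real_sqrt_abs) simp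
    qed
    \<comment> \<open>Consecutive scales give consecutive intervals with a common endpoint, starting from \<open>G\<close>.\<close>
    have scale: "\<exists>l. \<delta> \<in> {G * sqrt ((\<kappa> l)\<^sup>2 * \<phi> ((\<kappa> l)\<^sup>2)) .. 2 powr s * (G * sqrt ((\<kappa> l)\<^sup>2 * \<phi> ((\<kappa> l)\<^sup>2)))}"
      if \<delta>: "0 < \<delta>" "\<delta> \<le> G" for \<delta>
    proof -
      \<comment> \<open>The exponent \<open>y\<close> with \<open>\<delta> = G 2\<^sup>-\<^sup>y\<^sup>s\<close>; its integer part selects the scale \<open>n + 1\<close>.\<close>
      define y where "y = log 2 (G / \<delta>) / s"
      have y0: "y \<ge> 0" unfolding y_def using \<delta> G s by (intro divide_nonneg_pos) auto
      define n where "n = nat \<lfloor>y\<rfloor>"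
      have n: "real n \<le> y" "y \<le> real n + 1" using y0 unfolding n_def by linarith+
      have \<delta>_eq: "\<delta> = G * 2 powr (- (y * s))"
        using \<delta> G s by (simp add: y_def powr_minus)
      have ns: "real n * s \<le> y * s" "y * s \<le> (real n + 1) * s"
        using n s by (intro mult_right_mono; simp)+
      then have "G * 2 powr (- (real n + 1) * s) \<le> \<delta>"
        unfolding \<delta>_eq using G by (intro mult_left_mono powr_mono) (auto simp: algebra_simps)
      moreover have "\<delta> \<le> 2 powr s * (G * 2 powr (- (real n + 1) * s))"
      proof -
        have "2 powr s * (G * 2 powr (- (real n + 1) * s)) = G * 2 powr (- (real n * s))"
          by (simp add: powr_add[symmetric] algebra_simps mult.left_commute[of _ G])
        moreover have "\<delta> \<le> G * 2 powr (- (real n * s))"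
          unfolding \<delta>_eq using G ns by (intro mult_left_mono powr_mono) auto
        ultimately show ?thesis by (simp only:)
      qed
      ultimately show ?thesis
        by (intro exI[of _ "(int n + 1, 0)"]) (unfold star atLeastAtMost_iff, rule conjI)
    qed
    have "{0<..G} \<subseteq> (\<Union>l. {G * sqrt ((\<kappa> l)\<^sup>2 * \<phi> ((\<kappa> l)\<^sup>2)) ..
        inverse (2 powr (- (2 + p))) * (G * sqrt ((\<kappa> l)\<^sup>2 * \<phi> ((\<kappa> l)\<^sup>2)))})"
      unfolding powr_minus inverse_inverse_eq s_def[symmetric]
    proof
      fix \<delta> assume "\<delta> \<in> {0<..G}"
      then obtain l where
        "\<delta> \<in> {G * sqrt ((\<kappa> l)\<^sup>2 * \<phi> ((\<kappa> l)\<^sup>2)) .. 2 powr s * (G * sqrt ((\<kappa> l)\<^sup>2 * \<phi> ((\<kappa> l)\<^sup>2)))}"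
        using scale[of \<delta>] by auto
      then show "\<delta> \<in> (\<Union>l. {G * sqrt ((\<kappa> l)\<^sup>2 * \<phi> ((\<kappa> l)\<^sup>2)) ..
          2 powr s * (G * sqrt ((\<kappa> l)\<^sup>2 * \<phi> ((\<kappa> l)\<^sup>2)))})"
        by (rule UN_I[OF UNIV_I])
    qed
    then show ?thesis
      unfolding Let_def op(3) F_def[symmetric] G_def[symmetric] using G by (intro exI[of _ G] conjI)
  qed

  show ?thesis
    by (intro conjI ballI allI impI dfd) (erule source, erule cover)
qed

end
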